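(* Let $N\geq 1$ and $0\leq n\leq N-1$ be integers, let $q\in W^{N,\infty}(\mathbb{R}_+;\mathbb{R})$, where $\mathbb R_+=[0,\infty)$, and let $\gamma_n:\mathbb R\to(0,\infty)$ be an even function for which there are constants $c_n,C_n>0$ with $$c_n(1+|t|)^{-n}\leq \gamma_n(t)\leq C_n(1+|t|)^{-n},\qquad t\in\mathbb R.$$ Put $$\Omega_{n,+}^{\rm S}=\{k=\lambda+i\eta\in\mathbb C:\ \lambda,\eta\in\mathbb R,\ \lambda>\gamma_n(\eta)\}.$$ Then there exist differential polynomials $c_j$ in $q$ such that the Titchmarsh--Weyl function $m_+^{\rm S}$ of $-\frac{d^2}{dx^2}+q$ on $\mathbb R_+$ satisfies, as $|k|\to\infty$, $$m_+^{\rm S}(0,-k^2)=-k+\sum_{j=1}^{N-n-1}c_j(0)k^{-j}+O(|k|^{n-N}),\qquad k\in\Omega_{n,+}^{\rm S},$$ with the error term uniform for $k\in\Omega_{n,+}^{\rm S}$. The coefficients are determined by $$c_1=-\frac q2,\qquad c_{j+1}=\frac12\Bigl(c_j'+\sum_{\ell=1}^{j-1}c_\ell c_{j-\ell}\Bigr),\quad j\geq 1.$$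
   Context: $W^{N,\infty}(\mathbb R_+;\mathbb R)$ is the Sobolev space of real-valued functions on $\mathbb R_+$ whose weak derivatives up to order $N$ are in $L^\infty$; continuous representatives are used, so that $q^{(i)}(0)$ makes sense for $i\le N-1$. Titchmarsh--Weyl function: let $H_q=-\frac{d^2}{dx^2}+q(x)$ on $\mathbb R_+$ (limit point at $+\infty$ since $q$ is bounded). For $z\in\mathbb C\setminus\mathbb R$ let $\psi_+(\cdot,z)$ be the nonzero solution, unique up to a constant factor, of $-\psi''+q\psi=z\psi$ that is square integrable near $+\infty$, and set $$m_+^{\rm S}(x,z)=\frac{\psi_+'(x,z)}{\psi_+(x,z)}.$$ By analytic continuation the same notation is used at sufficiently negative real $z$, below the spectrum of a fixed self-adjoint half-line realization; these are the only real spectral parameters occurring in the asymptotics. The $O$-statement means: there are constants $C,R>0$ such that for all $k\in\Omega_{n,+}^{\rm S}$ with $|k|\ge R$ the remainder is bounded in modulus by $C|k|^{n-N}$. Empty sums are zero. *)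

theory Defs
  imports "HOL-Complex_Analysis.Complex_Analysis" "HOL-Library.Poly_Mapping"
begin

section \<open>Derivatives on the half-line\<close>

text \<open>The derivative is two-sided for positive arguments and one-sided at \<open>0\<close>. Values of a function
  at negative arguments never matter.\<close>

definition hl_deriv :: "(real \<Rightarrow> 'a::real_normed_vector) \<Rightarrow> real \<Rightarrow> 'a" where
  "hl_deriv f x = vector_derivative f (at x within {0..})"

section \<open>The Sobolev space \<open>W\<^sup>N\<^sup>,\<^sup>\<infinity>\<close> on the half-line\<close>

definition half_line :: "real measure" where
  "half_line = lebesgue_on {0<..}"

definition Linf :: "(real \<Rightarrow> real) set" where
  "Linf = {g. g \<in> borel_measurable half_line \<and> (\<exists>B. AE x in half_line. \<bar>g x\<bar> \<le> B)}"

definition test_functions :: "(real \<Rightarrow> real) set" where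
  "test_functions = {\<phi>. (\<forall>i. (deriv ^^ i) \<phi> differentiable_on UNIV) \<and>
     compact (closure {x. \<phi> x \<noteq> 0}) \<and> closure {x. \<phi> x \<noteq> 0} \<subseteq> {0<..}}"

definition weak_derivative :: "nat \<Rightarrow> (real \<Rightarrow> real) \<Rightarrow> (real \<Rightarrow> real) \<Rightarrow> bool" where
  "weak_derivative i f g \<longleftrightarrow> (\<forall>\<phi>\<in>test_functions.
     (LINT x|half_line. f x * (deriv ^^ i) \<phi> x) = (-1) ^ i * (LINT x|half_line. g x * \<phi> x))"

definition sobolev_Linf :: "nat \<Rightarrow> (real \<Rightarrow> real) set" where
  "sobolev_Linf N = {q \<in> Linf. \<forall>i\<le>N. \<exists>g\<in>Linf. weak_derivative i q g}"

section \<open>The Titchmarsh--Weyl function\<close>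

text \<open>For continuous \<open>q\<close> the solutions of \<open>- \<psi>'' + q \<psi> = z \<psi>\<close> are classical.\<close>

definition schroedinger_solution :: "(real \<Rightarrow> real) \<Rightarrow> complex \<Rightarrow> (real \<Rightarrow> complex) \<Rightarrow> bool" where
  "schroedinger_solution q z \<psi> \<longleftrightarrow>
     \<psi> differentiable_on {0..} \<and> hl_deriv \<psi> differentiable_on {0..} \<and>
     (\<forall>x\<ge>0. - hl_deriv (hl_deriv \<psi>) x + of_real (q x) * \<psi> x = z * \<psi> x)"

definition weyl_solution :: "(real \<Rightarrow> real) \<Rightarrow> complex \<Rightarrow> (real \<Rightarrow> complex) \<Rightarrow> bool" where
  "weyl_solution q z \<psi> \<longleftrightarrow>
     schroedinger_solution q z \<psi> \<and> (\<exists>x\<ge>0. \<psi> x \<noteq> 0) \<and>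
     (\<exists>a\<ge>0. set_integrable lborel {a..} (\<lambda>x. (cmod (\<psi> x))\<^sup>2))"

definition weyl_m_nonreal :: "(real \<Rightarrow> real) \<Rightarrow> real \<Rightarrow> complex \<Rightarrow> complex" where
  "weyl_m_nonreal q x z = (THE w. \<exists>\<psi>. weyl_solution q z \<psi> \<and> w = hl_deriv \<psi> x / \<psi> x)"

text \<open>At a real spectral parameter the value is the one of the analytic continuation across the
  real axis near that point. Its value is unique if it exists; for bounded \<open>q\<close>
  it exists at all sufficiently negative points.\<close>

definition weyl_m :: "(real \<Rightarrow> real) \<Rightarrow> real \<Rightarrow> complex \<Rightarrow> complex" where
  "weyl_m q x z =
     (if Im z \<noteq> 0 then weyl_m_nonreal q x z
      else (THE w. \<exists>f. f analytic_on {z} \<and>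
              (\<forall>\<^sub>F u in at z. Im u \<noteq> 0 \<longrightarrow> f u = weyl_m_nonreal q x u) \<and> w = f z))"

definition Omega_plus :: "(real \<Rightarrow> real) \<Rightarrow> complex set" where
  "Omega_plus \<gamma> = {k. Re k > \<gamma> (Im k)}"

section \<open>Differential polynomials\<close>

text \<open>Polynomials over the reals in indeterminates \<open>u\<^sub>0, u\<^sub>1, u\<^sub>2, \<dots>\<close>, where \<open>u\<^sub>i\<close> stands for the
  \<open>i\<close>-th derivative of the potential. A monomial is its finitely supported exponent function.\<close>

type_synonym diff_poly = "(nat \<Rightarrow>\<^sub>0 nat) \<Rightarrow>\<^sub>0 real"

definition dp_const :: "real \<Rightarrow> diff_poly" where
  "dp_const a = Poly_Mapping.single 0 a"

definition dp_var :: "nat \<Rightarrow> diff_poly" where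
  "dp_var i = Poly_Mapping.single (Poly_Mapping.single i 1) 1"

text \<open>The derivation \<open>u\<^sub>i \<mapsto> u\<^sub>i\<^sub>+\<^sub>1\<close>, constants being mapped to \<open>0\<close>.\<close>

definition dp_deriv :: "diff_poly \<Rightarrow> diff_poly" where
  "dp_deriv p = (\<Sum>m\<in>Poly_Mapping.keys p. \<Sum>i\<in>Poly_Mapping.keys m.
     Poly_Mapping.single (m - Poly_Mapping.single i 1 + Poly_Mapping.single (Suc i) 1)
       (Poly_Mapping.lookup p m * of_nat (Poly_Mapping.lookup m i)))"

definition dp_eval :: "diff_poly \<Rightarrow> (nat \<Rightarrow> real) \<Rightarrow> real" where
  "dp_eval p v = (\<Sum>m\<in>Poly_Mapping.keys p. Poly_Mapping.lookup p m *
     (\<Prod>i\<in>Poly_Mapping.keys m. v i ^ Poly_Mapping.lookup m i))"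

definition dp_at :: "diff_poly \<Rightarrow> (real \<Rightarrow> real) \<Rightarrow> real \<Rightarrow> real" where
  "dp_at p q x = dp_eval p (\<lambda>i. (hl_deriv ^^ i) q x)"

subsection \<open>The formal derivation is differentiation with respect to \<open>x\<close>\<close>

abbreviation mono_eval :: "(nat \<Rightarrow>\<^sub>0 nat) \<Rightarrow> (nat \<Rightarrow> real) \<Rightarrow> real" where
  "mono_eval m v \<equiv> \<Prod>i\<in>Poly_Mapping.keys m. v i ^ Poly_Mapping.lookup m i"

lemma mono_eval_superset:
  assumes "finite A" "Poly_Mapping.keys m \<subseteq> A"
  shows "mono_eval m v = (\<Prod>i\<in>A. v i ^ Poly_Mapping.lookup m i)"
  using assms by (intro prod.mono_neutral_left) (auto simp: in_keys_iff)

lemma mono_eval_plus: "mono_eval (m + m') v = mono_eval m v * mono_eval m' v"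
proof -
  let ?A = "Poly_Mapping.keys m \<union> Poly_Mapping.keys m'"
  have "Poly_Mapping.keys (m + m') \<subseteq> ?A" by (rule keys_add)
  then have "mono_eval (m + m') v = (\<Prod>i\<in>?A. v i ^ Poly_Mapping.lookup (m + m') i)"
    by (intro mono_eval_superset) auto
  also have "\<dots> = (\<Prod>i\<in>?A. v i ^ Poly_Mapping.lookup m i) *
      (\<Prod>i\<in>?A. v i ^ Poly_Mapping.lookup m' i)"
    by (simp add: lookup_add power_add prod.distrib)
  also have "\<dots> = mono_eval m v * mono_eval m' v"
    by (simp add: mono_eval_superset[of ?A m] mono_eval_superset[of ?A m'])
  finally show ?thesis .
qed

lemma mono_eval_single: "mono_eval (Poly_Mapping.single i 1) v = v i"
  by simp

lemma dp_eval_superset: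
  assumes "finite A" "Poly_Mapping.keys p \<subseteq> A"
  shows "dp_eval p v = (\<Sum>m\<in>A. Poly_Mapping.lookup p m * mono_eval m v)"
  unfolding dp_eval_def using assms by (intro sum.mono_neutral_left) (auto simp: in_keys_iff)

lemma dp_eval_add: "dp_eval (p + p') v = dp_eval p v + dp_eval p' v"
proof -
  let ?A = "Poly_Mapping.keys p \<union> Poly_Mapping.keys p'"
  have "Poly_Mapping.keys (p + p') \<subseteq> ?A" by (rule keys_add)
  then show ?thesis
    by (simp add: dp_eval_superset[of ?A] lookup_add distrib_right sum.distrib)
qed

lemma dp_eval_sum: "dp_eval (\<Sum>a\<in>A. f a) v = (\<Sum>a\<in>A. dp_eval (f a) v)"
  by (induction A rule: infinite_finite_induct) (simp_all add: dp_eval_add dp_eval_def[of 0])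

lemma dp_eval_single: "dp_eval (Poly_Mapping.single m a) v = a * mono_eval m v"
  by (simp add: dp_eval_def)

lemma mono_eval_deriv:
  assumes i: "i \<in> Poly_Mapping.keys m"
  shows "mono_eval (m - Poly_Mapping.single i 1 + Poly_Mapping.single j 1) v =
    v i ^ (Poly_Mapping.lookup m i - 1) * v j *
      (\<Prod>l\<in>Poly_Mapping.keys m - {i}. v l ^ Poly_Mapping.lookup m l)"
proof -
  have sub: "Poly_Mapping.keys (m - Poly_Mapping.single i 1) \<subseteq> Poly_Mapping.keys m"
    by (auto simp: in_keys_iff lookup_minus)
  have "mono_eval (m - Poly_Mapping.single i 1) v =
      (\<Prod>l\<in>Poly_Mapping.keys m. v l ^ Poly_Mapping.lookup (m - Poly_Mapping.single i 1) l)"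
    using sub by (intro mono_eval_superset) auto
  also have "\<dots> = v i ^ (Poly_Mapping.lookup m i - 1) *
      (\<Prod>l\<in>Poly_Mapping.keys m - {i}. v l ^ Poly_Mapping.lookup (m - Poly_Mapping.single i 1) l)"
    using i by (subst prod.remove[of _ i]) (auto simp: lookup_minus)
  also have "(\<Prod>l\<in>Poly_Mapping.keys m - {i}.
        v l ^ Poly_Mapping.lookup (m - Poly_Mapping.single i 1) l) =
      (\<Prod>l\<in>Poly_Mapping.keys m - {i}. v l ^ Poly_Mapping.lookup m l)"
    by (intro prod.cong) (auto simp: lookup_minus lookup_single when_def)
  finally show ?thesis
    unfolding mono_eval_plus mono_eval_single by (simp only: mult_ac)
qed

lemma dp_eval_deriv:
  assumes "\<And>m i. m \<in> Poly_Mapping.keys p \<Longrightarrow> i \<in> Poly_Mapping.keys m \<Longrightarrow>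
    ((\<lambda>x. u x i) has_real_derivative u x (Suc i)) (at x within S)"
  shows "((\<lambda>x. dp_eval p (u x)) has_real_derivative dp_eval (dp_deriv p) (u x)) (at x within S)"
proof -
  have "((\<lambda>x. mono_eval m (u x)) has_real_derivative
      (\<Sum>i\<in>Poly_Mapping.keys m. real (Poly_Mapping.lookup m i) *
         mono_eval (m - Poly_Mapping.single i 1 + Poly_Mapping.single (Suc i) 1) (u x)))
      (at x within S)" if m: "m \<in> Poly_Mapping.keys p" for m
  proof -
    have "((\<lambda>x. u x i ^ Poly_Mapping.lookup m i) has_real_derivative
        real (Poly_Mapping.lookup m i) * (u x (Suc i) * u x i ^ (Poly_Mapping.lookup m i - 1)))
        (at x within S)" if "i \<in> Poly_Mapping.keys m" for i
      using DERIV_power[OF assms[OF m that], of "Poly_Mapping.lookup m i"] by simp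
    then have "((\<lambda>x. mono_eval m (u x)) has_real_derivative
        (\<Sum>i\<in>Poly_Mapping.keys m.
          (real (Poly_Mapping.lookup m i) * (u x (Suc i) * u x i ^ (Poly_Mapping.lookup m i - 1))) *
          (\<Prod>l\<in>Poly_Mapping.keys m - {i}. u x l ^ Poly_Mapping.lookup m l))) (at x within S)"
      unfolding has_field_derivative_def
      by (auto intro!: has_derivative_eq_rhs[OF has_derivative_prod]
          simp: fun_eq_iff sum_distrib_left sum_distrib_right mult_ac)
    moreover have "(\<Sum>i\<in>Poly_Mapping.keys m.
          (real (Poly_Mapping.lookup m i) * (u x (Suc i) * u x i ^ (Poly_Mapping.lookup m i - 1))) *
          (\<Prod>l\<in>Poly_Mapping.keys m - {i}. u x l ^ Poly_Mapping.lookup m l)) =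
        (\<Sum>i\<in>Poly_Mapping.keys m. real (Poly_Mapping.lookup m i) *
         mono_eval (m - Poly_Mapping.single i 1 + Poly_Mapping.single (Suc i) 1) (u x))"
      by (intro sum.cong refl) (simp only: mono_eval_deriv mult_ac)
    ultimately show ?thesis by simp
  qed
  then have "((\<lambda>x. dp_eval p (u x)) has_real_derivative
      (\<Sum>m\<in>Poly_Mapping.keys p. Poly_Mapping.lookup p m *
        (\<Sum>i\<in>Poly_Mapping.keys m. real (Poly_Mapping.lookup m i) *
         mono_eval (m - Poly_Mapping.single i 1 + Poly_Mapping.single (Suc i) 1) (u x))))
      (at x within S)"
    unfolding dp_eval_def by (intro DERIV_sum DERIV_cmult)
  then show ?thesis
    unfolding dp_deriv_def dp_eval_sum dp_eval_single by (simp only: sum_distrib_left mult.assoc)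
qed

end

theory Submission
  imports Defs
begin

text \<open>
  Put \<open>z = - k\<^sup>2\<close> and let \<open>\<psi>\<close> be the solution of \<open>\<psi>'' = (q + k\<^sup>2) \<psi>\<close> that is square integrable at infinity. Its
  logarithmic derivative solves the Riccati equation \<open>\<phi>' + \<phi>\<^sup>2 = q + k\<^sup>2\<close>. Inserting
  \<open>\<sigma> = - k + c\<^sub>1 / k + c\<^sub>2 / k\<^sup>2 + \<dots> + c\<^sub>N / k\<^sup>N\<close> and comparing powers of \<open>k\<close> gives the recursion for the \<open>c\<^sub>j\<close> and
  leaves a residual \<open>\<rho> = \<sigma>' + \<sigma>\<^sup>2 - q - k\<^sup>2\<close> of size \<open>|k|\<^sup>-\<^sup>N\<close>. The task is to compare \<open>\<psi>'(0) / \<psi>(0)\<close> with \<open>\<sigma>(0)\<close>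
  in a region where \<open>Re k\<close> may be as small as \<open>|k|\<^sup>-\<^sup>n\<close>, so that the potential is no longer a small
  perturbation and a fixed point argument for the Riccati equation would break down.

  The comparison is linear instead. Let \<open>y\<close> solve \<open>y' = \<sigma> y\<close>, \<open>y(0) = 1\<close>, and normalize \<open>\<psi>(0) = 1\<close>. The
  quantity \<open>W = y \<psi>' - \<sigma> y \<psi>\<close> equals \<open>\<psi>'(0) - \<sigma>(0)\<close> at \<open>0\<close>, tends to \<open>0\<close> at infinity and satisfies
  \<open>W' = - \<rho> y \<psi>\<close>; hence \<open>|\<psi>'(0) - \<sigma>(0)|\<close> is at most \<open>sup |\<rho>|\<close> times the integral of \<open>|y \<psi>|\<close>
  (\<open>riccati_comparison\<close>). Both factors have square integral of order \<open>1 / Re k\<close>, which costs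
  a factor \<open>|k|\<^sup>n\<close> and explains the exponent \<open>n - N\<close>.

  For \<open>\<psi>\<close> this comes from an energy identity: the real part of \<open>cnj k * \<psi>' * cnj \<psi>\<close> has derivative
  \<open>Re k * (|\<psi>'|\<^sup>2 + (q + |k|\<^sup>2) |\<psi>|\<^sup>2)\<close>, which is coercive in the whole right half-plane as soon as \<open>|k|\<^sup>2\<close>
  exceeds the bound of \<open>|q|\<close>. The same identity yields existence (as a limit of Neumann problems on
  \<open>[0, n]\<close>), uniqueness and a bound for the slope. For \<open>y\<close> the integral of \<open>Re \<sigma>\<close> cannot simply be
  estimated by absolute values: the even powers of \<open>1 / k\<close> contribute real parts of size \<open>|k|\<^sup>-\<^sup>2\<close>,
  possibly much larger than \<open>Re k\<close>. But the part \<open>U\<close> of \<open>\<sigma>\<close> that is odd in \<open>k\<close> and the even part \<open>V\<close>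
  satisfy \<open>U' + 2 U V = O(|k|\<^sup>-\<^sup>N)\<close>, because \<open>k\<close> and \<open>- k\<close> lead to the same Riccati equation. Thus \<open>y\<^sup>2 U\<close> has
  logarithmic derivative \<open>2 U\<close> up to a negligible term, and the real part of an odd power of \<open>1 / k\<close> is
  proportional to \<open>Re k\<close> (\<open>exponential_bound_by_odd_part\<close>, \<open>abs_Re_power_odd_part\<close>).

  The potential has its \<open>N\<close>-th derivative only in the weak sense, so \<open>c\<^sub>N\<close> is merely Lipschitz. In \<open>\<sigma>\<close>
  it is replaced by its average over an interval of length \<open>1 / |k|\<close>, which changes the residual by
  another \<open>O(|k|\<^sup>-\<^sup>N)\<close>. That \<open>q\<close> is classically \<open>N - 1\<close> times differentiable with bounded Lipschitz derivatives is
  obtained by mollification. At a real spectral parameter the definition asks for an analytic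
  continuation; there \<open>m\<close> is holomorphic since the Wronskian of the solutions at \<open>w\<close> and \<open>z\<close> exhibits
  \<open>m(w) - m(z)\<close> as \<open>(w - z)\<close> times the integral of their product.
\<close>

section \<open>Calculus on the half-line\<close>

lemma at_within_initial_segment:
  fixes x T :: real
  assumes "x < T"
  shows "at x within {0..T} = at x within {0..}"
  by (rule at_within_nhd[of x "{..<T}"]) (use assms in auto)

lemma has_vector_derivative_half_line_subset:
  fixes a b :: real
  assumes "(f has_vector_derivative f') (at x within {0..})" "0 \<le> a"
  shows "(f has_vector_derivative f') (at x within {a..b})"
  using assms(1) by (rule has_vector_derivative_within_subset) (use assms in auto)

lemma has_vector_derivative_half_line_at:
  fixes x :: real
  assumes "(f has_vector_derivative f') (at x within {0..})" "0 < x"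
  shows "(f has_vector_derivative f') (at x)"
proof -
  have "at x within {0..} = at x within {0<..}"
    by (rule at_within_nhd[of x "{0<..}"]) (use assms in auto)
  then show ?thesis using assms by (simp add: at_within_open[of x "{0<..}"])
qed

lemma continuous_on_half_lineI:
  assumes "\<And>x. 0 \<le> x \<Longrightarrow> (f has_vector_derivative f' x) (at x within {0..})"
  shows "continuous_on {0..} f"
  using assms by (auto simp: continuous_on_eq_continuous_within
      intro!: has_vector_derivative_continuous)

text \<open>The majorant \<open>\<phi>\<close> is usually an energy whose derivative dominates the
  square of a solution; in this way integrals over the half-line are estimated without being formed.\<close>

lemma norm_increment_le_half_line:
  fixes f :: "real \<Rightarrow> 'a::real_normed_vector" and \<phi> :: "real \<Rightarrow> real"
  assumes "0 \<le> a" "a \<le> b"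
    and f: "\<And>x. 0 \<le> x \<Longrightarrow> (f has_vector_derivative f' x) (at x within {0..})"
    and \<phi>: "\<And>x. 0 \<le> x \<Longrightarrow> (\<phi> has_vector_derivative \<phi>' x) (at x within {0..})"
    and le: "\<And>x. a < x \<Longrightarrow> x < b \<Longrightarrow> norm (f' x) \<le> \<phi>' x"
  shows "norm (f b - f a) \<le> \<phi> b - \<phi> a"
proof (cases "a = b")
  case False
  have c: "continuous_on {a..b} f" "continuous_on {a..b} \<phi>"
    using continuous_on_half_lineI[OF f] continuous_on_half_lineI[OF \<phi>] assms(1)
    by (auto elim!: continuous_on_subset)
  show ?thesis
    by (rule differentiable_bound_general[OF _ c, of f' \<phi>'])
      (use False assms in \<open>auto intro!: has_vector_derivative_half_line_at\<close>)
qed auto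

lemma mono_half_line:
  fixes \<phi> :: "real \<Rightarrow> real"
  assumes "\<And>x. 0 \<le> x \<Longrightarrow> (\<phi> has_vector_derivative \<phi>' x) (at x within {0..})"
    and "\<And>x. 0 \<le> x \<Longrightarrow> 0 \<le> \<phi>' x" and "0 \<le> a" "a \<le> b"
  shows "\<phi> a \<le> \<phi> b"
  using norm_increment_le_half_line[of a b "\<lambda>_. 0::real" "\<lambda>_. 0" \<phi> \<phi>'] assms by simp

lemma integral_half_line_has_vector_derivative:
  fixes f :: "real \<Rightarrow> 'a::banach"
  assumes "continuous_on {0..} f" "0 \<le> x"
  shows "((\<lambda>x. integral {0..x} f) has_vector_derivative f x) (at x within {0..})"
proof -
  have "((\<lambda>x. integral {0..x} f) has_vector_derivative f x) (at x within {0..x + 1})"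
    by (rule integral_has_vector_derivative) (use assms in \<open>auto elim: continuous_on_subset\<close>)
  then show ?thesis by (simp add: at_within_initial_segment)
qed

lemma hl_deriv_eq:
  assumes "(f has_vector_derivative f') (at x within {0..})" "0 \<le> x"
  shows "hl_deriv f x = f'"
  unfolding hl_deriv_def
proof (rule vector_derivative_within[OF _ assms(1)])
  have "{x..x + 1} \<subseteq> {0..}" "x islimpt {x..x + 1}" using assms(2) by auto
  then show "at x within {0..} \<noteq> bot"
    by (metis islimpt_subset trivial_limit_within)
qed

lemma hl_deriv_works:
  assumes "f differentiable_on {0..}" "0 \<le> x"
  shows "(f has_vector_derivative hl_deriv f x) (at x within {0..})"
  unfolding hl_deriv_def using assms
  by (auto simp: differentiable_on_def vector_derivative_works)

lemma has_vector_derivative_half_line_cong: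
  assumes "(f has_vector_derivative f') (at x within {0..})" "0 \<le> x"
    and "\<And>y. 0 \<le> y \<Longrightarrow> f y = g y"
  shows "(g has_vector_derivative f') (at x within {0..})"
  by (rule has_vector_derivative_transform[OF _ _ assms(1)]) (use assms in auto)

lemma has_vector_derivative_half_line_of_initial:
  fixes x :: real
  assumes "\<And>T. T > x \<Longrightarrow> (f has_vector_derivative f') (at x within {0..T})"
  shows "(f has_vector_derivative f') (at x within {0..})"
  using assms[of "x + 1"] at_within_initial_segment[of x "x + 1"] by simp

text \<open>The summable majorants may depend on the interval: differentiability at \<open>x\<close>
  only involves values on some \<open>{0..T}\<close> with \<open>x < T\<close>.\<close>

lemma has_vector_derivative_suminf_half_line:
  fixes F :: "nat \<Rightarrow> real \<Rightarrow> 'a::banach"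
  assumes der: "\<And>n x. 0 \<le> x \<Longrightarrow> (F n has_vector_derivative F' n x) (at x within {0..})"
    and bd: "\<And>T. \<exists>M. summable M \<and> (\<forall>n. \<forall>x\<in>{0..T}. norm (F' n x) \<le> M n)"
    and s0: "summable (\<lambda>n. F n 0)" and x: "0 \<le> x"
  shows "((\<lambda>x. suminf (\<lambda>n. F n x)) has_vector_derivative (suminf (\<lambda>n. F' n x))) (at x within {0..})"
proof (rule has_vector_derivative_half_line_of_initial)
  fix T assume T: "x < T"
  obtain M where M: "summable M" "\<And>n x. x \<in> {0..T} \<Longrightarrow> norm (F' n x) \<le> M n"
    using bd[of T] by blast
  have "uniform_limit {0..T} (\<lambda>n x. \<Sum>i<n. F' i x) (\<lambda>x. suminf (\<lambda>i. F' i x)) sequentially"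
    by (rule Weierstrass_m_test[OF M(2) M(1)])
  then have u: "\<forall>\<^sub>F n in sequentially. \<forall>x\<in>{0..T}. norm ((\<Sum>i<n. F' i x) - (suminf (\<lambda>i. F' i x))) < e"
    if "e > 0" for e
    using that by (auto simp: uniform_limit_iff dist_norm)
  have "\<exists>g. \<forall>x\<in>{0..T}. (\<lambda>n. F n x) sums g x \<and>
      (g has_derivative (\<lambda>h. h *\<^sub>R (suminf (\<lambda>n. F' n x)))) (at x within {0..T})"
  proof (rule has_derivative_series[where x = 0 and l = "suminf (\<lambda>n. F n 0)"])
    show "(F n has_derivative (\<lambda>h. h *\<^sub>R F' n x)) (at x within {0..T})" if "x \<in> {0..T}" for n x
      using has_vector_derivative_half_line_subset[OF der, of x 0 n T] that
      by (auto simp: has_vector_derivative_def)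
    show "\<forall>\<^sub>F n in sequentially. \<forall>x\<in>{0..T}. \<forall>h.
        norm ((\<Sum>i<n. h *\<^sub>R F' i x) - h *\<^sub>R (suminf (\<lambda>n. F' n x))) \<le> e * norm h" if "e > 0" for e
      using u[OF that]
    proof eventually_elim
      case (elim n)
      have "norm ((\<Sum>i<n. h *\<^sub>R F' i x) - h *\<^sub>R (suminf (\<lambda>n. F' n x))) \<le> e * norm h" if "x \<in> {0..T}" for x h
      proof -
        have "(\<Sum>i<n. h *\<^sub>R F' i x) - h *\<^sub>R (suminf (\<lambda>n. F' n x)) = h *\<^sub>R ((\<Sum>i<n. F' i x) - (suminf (\<lambda>n. F' n x)))"
          by (simp add: scaleR_sum_right scaleR_diff_right)
        moreover have "\<bar>h\<bar> * norm ((\<Sum>i<n. F' i x) - (suminf (\<lambda>n. F' n x))) \<le> \<bar>h\<bar> * e"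
          using elim that by (intro mult_left_mono) (auto intro: less_imp_le)
        ultimately show ?thesis by (simp add: mult.commute)
      qed
      then show ?case by blast
    qed
  qed (use x T s0 in auto)
  then obtain g where g: "\<And>x. x \<in> {0..T} \<Longrightarrow> (\<lambda>n. F n x) sums g x"
    "\<And>x. x \<in> {0..T} \<Longrightarrow> (g has_vector_derivative (suminf (\<lambda>n. F' n x))) (at x within {0..T})"
    unfolding has_vector_derivative_def by blast
  show "((\<lambda>x. suminf (\<lambda>n. F n x)) has_vector_derivative (suminf (\<lambda>n. F' n x))) (at x within {0..T})"
    by (rule has_vector_derivative_transform[OF _ _ g(2)])
       (use x T g(1) in \<open>auto simp: sums_iff\<close>)
qed

text \<open>In this form differentiability is read off from inequalities that survive a limit.\<close>

lemma has_field_derivative_of_quadratic_error: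
  fixes F :: "'a::real_normed_field \<Rightarrow> 'a"
  assumes "\<forall>\<^sub>F w in at z within S. norm (F w - F z - (w - z) * D) \<le> C * (norm (w - z))\<^sup>2"
  shows "(F has_field_derivative D) (at z within S)"
  unfolding has_field_derivative_iff
proof (rule LIM_zero_cancel, rule Lim_null_comparison)
  show "\<forall>\<^sub>F w in at z within S. norm ((F w - F z) / (w - z) - D) \<le> C * norm (w - z)"
    using assms eventually_neq_at_within[of z]
  proof eventually_elim
    case (elim w)
    have "(F w - F z) / (w - z) - D = (F w - F z - (w - z) * D) / (w - z)"
      using elim(2) by (simp add: field_simps)
    then have "norm ((F w - F z) / (w - z) - D) = norm (F w - F z - (w - z) * D) / norm (w - z)"
      by (simp add: norm_divide)
    also have "\<dots> \<le> C * (norm (w - z))\<^sup>2 / norm (w - z)"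
      by (intro divide_right_mono elim) auto
    also have "\<dots> = C * norm (w - z)" using elim(2) by (simp add: power2_eq_square)
    finally show ?case .
  qed
  show "((\<lambda>w. C * norm (w - z)) \<longlongrightarrow> 0) (at z within S)"
    by (auto intro!: tendsto_eq_intros)
qed

section \<open>The linear second-order equation\<close>

text \<open>The equation \<open>f'' = p f\<close> written as a first-order system for the pair \<open>(f, g) = (f, f')\<close>.\<close>

definition solves :: "(real \<Rightarrow> complex) \<Rightarrow> (real \<Rightarrow> complex) \<Rightarrow> (real \<Rightarrow> complex) \<Rightarrow> bool" where
  "solves p f g \<longleftrightarrow> (\<forall>x\<ge>0. (f has_vector_derivative g x) (at x within {0..}) \<and>
     (g has_vector_derivative p x * f x) (at x within {0..}))"

text \<open>The terms of the Neumann series for \<open>f(x) = a + b x + \<integral>\<^sub>0\<^sup>x \<integral>\<^sub>0\<^sup>t p f\<close>.\<close>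

primrec picard_iterate :: "(real \<Rightarrow> complex) \<Rightarrow> complex \<Rightarrow> complex \<Rightarrow> nat \<Rightarrow> real \<Rightarrow> complex" where
  "picard_iterate p a b 0 = (\<lambda>x. a + x *\<^sub>R b)"
| "picard_iterate p a b (Suc n) = (\<lambda>x. integral {0..x} (\<lambda>t. integral {0..t}
     (\<lambda>s. p s * picard_iterate p a b n s)))"

lemma picard_iterate_continuous:
  assumes "continuous_on {0..} p"
  shows "continuous_on {0..} (picard_iterate p a b n)"
proof (induction n)
  case 0
  show ?case by (auto intro!: continuous_intros)
next
  case (Suc n)
  have "continuous_on {0..} (\<lambda>s. p s * picard_iterate p a b n s)"
    using assms Suc by (intro continuous_intros)
  note c = continuous_on_half_lineI[OF integral_half_line_has_vector_derivative[OF this]]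
  show ?case
    using continuous_on_half_lineI[OF integral_half_line_has_vector_derivative[OF c]] by simp
qed

text \<open>Picard iteration. On \<open>{0..T}\<close> the \<open>n\<close>-th term is at most a constant times
  \<open>(P T x)\<^sup>n / n!\<close>: one of the two integrations in each step is estimated by the factor \<open>T\<close>, the other one
  produces the factorial.\<close>

lemma solves_exists:
  assumes p: "continuous_on {0..} p" and P: "\<And>x. 0 \<le> x \<Longrightarrow> norm (p x) \<le> P"
  shows "\<exists>f g. solves p f g \<and> f 0 = a \<and> g 0 = b"
proof -
  define S where "S = picard_iterate p a b"
  define D where "D n = (case n of 0 \<Rightarrow> (\<lambda>x. b) |
     Suc n \<Rightarrow> (\<lambda>x. integral {0..x} (\<lambda>s. p s * S n s)))" for n
  define D' where "D' n = (case n of 0 \<Rightarrow> (\<lambda>x. 0) | Suc n \<Rightarrow> (\<lambda>x. p x * S n x))" for n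
  have P0: "0 \<le> P" using norm_ge_zero[of "p 0"] P[of 0] by linarith
  have Sc: "continuous_on {0..} (\<lambda>s. p s * S n s)" for n
    unfolding S_def using p picard_iterate_continuous[OF p] by (intro continuous_intros)
  have D'D: "(D n has_vector_derivative D' n x) (at x within {0..})" if "0 \<le> x" for n x
    using integral_half_line_has_vector_derivative[OF Sc that]
    by (cases n) (auto simp: D_def D'_def)
  have DS: "(S n has_vector_derivative D n x) (at x within {0..})" if x: "0 \<le> x" for n x
  proof (cases n)
    case 0
    have "((\<lambda>x. a + x *\<^sub>R b) has_vector_derivative b) (at x within {0..})"
      by (auto intro!: derivative_eq_intros)
    then show ?thesis by (simp add: 0 S_def D_def)
  next
    case (Suc m)
    have "continuous_on {0..} (D n)" by (rule continuous_on_half_lineI[OF D'D])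
    then have "continuous_on {0..} (\<lambda>t. integral {0..t} (\<lambda>s. p s * S m s))"
      by (simp add: D_def Suc)
    from integral_half_line_has_vector_derivative[OF this x] show ?thesis
      by (simp add: S_def D_def Suc)
  qed
  define e where "e T n = (norm a + T * norm b) * (P * T) ^ n / fact n" for T :: real and n
  have Sb: "norm (S n x) \<le> e T n * x ^ n" if "0 \<le> x" "x \<le> T" for n x T
    using that
  proof (induction n arbitrary: x)
    case 0
    have "norm (a + x *\<^sub>R b) \<le> norm a + x * norm b"
      using norm_triangle_ineq[of a "x *\<^sub>R b"] 0 by simp
    also have "\<dots> \<le> norm a + T * norm b" using 0 by (intro add_left_mono mult_right_mono) auto
    finally show ?case by (simp add: S_def e_def)
  next
    case (Suc n)
    have T: "0 \<le> T" using Suc.prems by simp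
    have e0: "0 \<le> e T n" unfolding e_def using T P0 by simp
    have D: "norm (D (Suc n) t) \<le> P * e T n * T * t ^ n" if t: "0 \<le> t" "t \<le> T" for t
    proof -
      have "norm (D (Suc n) t) \<le> P * (e T n * t ^ n) * (t - 0)"
        unfolding D_def nat.case
      proof (rule integral_bound)
        show "continuous_on {0..t} (\<lambda>s. p s * S n s)"
          using Sc[of n] by (rule continuous_on_subset) auto
        fix s assume s: "s \<in> {0..t}"
        then have "norm (S n s) \<le> e T n * s ^ n" using Suc.IH[of s] t by auto
        also have "\<dots> \<le> e T n * t ^ n" using s e0 by (intro mult_left_mono power_mono) auto
        finally show "norm (p s * S n s) \<le> P * (e T n * t ^ n)"
          unfolding norm_mult using s P0 by (intro mult_mono P) auto
      qed (use t in auto)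
      also have "\<dots> \<le> P * (e T n * t ^ n) * T"
        using P0 e0 t by (intro mult_left_mono) auto
      finally show ?thesis by (simp add: mult_ac)
    qed
    have "norm (S (Suc n) x - S (Suc n) 0) \<le> e T (Suc n) * x ^ Suc n - e T (Suc n) * 0 ^ Suc n"
    proof (cases "x = 0")
      case False
      show ?thesis
      proof (rule differentiable_bound_general[where f' = "D (Suc n)"
            and \<phi>' = "\<lambda>t. e T (Suc n) * (real (Suc n) * t ^ n)"])
        show "continuous_on {0..x} (S (Suc n))"
          using continuous_on_half_lineI[OF DS] by (rule continuous_on_subset) auto
        show "(S (Suc n) has_vector_derivative D (Suc n) t) (at t)" if "0 < t" for t
          using has_vector_derivative_half_line_at[OF DS[of t "Suc n"]] that by simp
        show "((\<lambda>x. e T (Suc n) * x ^ Suc n) has_vector_derivative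
            e T (Suc n) * (real (Suc n) * t ^ n)) (at t)" for t
          unfolding has_real_derivative_iff_has_vector_derivative[symmetric]
          using DERIV_cmult[OF DERIV_pow[of "Suc n" t UNIV], of "e T (Suc n)"]
          by (simp del: of_nat_Suc)
        show "norm (D (Suc n) t) \<le> e T (Suc n) * (real (Suc n) * t ^ n)" if "0 < t" "t < x" for t
        proof -
          have "e T (Suc n) * real (Suc n) = P * e T n * T"
            by (simp add: e_def field_simps del: of_nat_Suc)
          then have "e T (Suc n) * (real (Suc n) * t ^ n) = P * e T n * T * t ^ n"
            by (metis mult.assoc)
          moreover have "norm (D (Suc n) t) \<le> P * e T n * T * t ^ n"
            using D[of t] that Suc.prems by simp
          ultimately show ?thesis by (simp only:)
        qed
      qed (use False Suc.prems in \<open>auto intro!: continuous_intros\<close>)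
    qed auto
    moreover have "S (Suc n) 0 = 0" by (simp add: S_def)
    ultimately show ?case by simp
  qed
  have Sb': "norm (S n x) \<le> (norm a + T * norm b) * ((P * T * T) ^ n / fact n)"
    if "0 \<le> x" "x \<le> T" for n x T
  proof -
    have "norm (S n x) \<le> e T n * x ^ n" by (rule Sb[OF that])
    also have "\<dots> \<le> e T n * T ^ n"
      using that P0 by (intro mult_left_mono power_mono) (auto simp: e_def)
    finally show ?thesis by (simp add: e_def power_mult_distrib mult_ac)
  qed
  have sum: "summable (\<lambda>n. C * (r ^ n / fact n))" for C r :: real
    using summable_exp_generic[of r] by (intro summable_mult) (simp add: divide_inverse mult.commute scaleR_conv_of_real)
  have Dbd: "\<exists>M. summable M \<and> (\<forall>n. \<forall>x\<in>{0..T}. norm (D' n x) \<le> M n)" for T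
  proof (intro exI conjI allI ballI)
    let ?M = "\<lambda>n. P * (norm a + T * norm b) * ((P * T * T) ^ n / fact n)"
    show "summable (\<lambda>n. case n of 0 \<Rightarrow> 0 | Suc n \<Rightarrow> ?M n)"
      by (subst summable_Suc_iff[symmetric]) (simp only: nat.case sum)
    fix n x assume x: "x \<in> {0..T}"
    show "norm (D' n x) \<le> (case n of 0 \<Rightarrow> 0 | Suc n \<Rightarrow> ?M n)"
    proof (cases n)
      case (Suc m)
      have "norm (p x * S m x) \<le> P * ((norm a + T * norm b) * ((P * T * T) ^ m / fact m))"
        unfolding norm_mult using x P0 by (intro mult_mono P Sb') auto
      then show ?thesis by (simp add: Suc D'_def mult.assoc)
    qed (simp add: D'_def)
  qed
  have Sbd: "\<exists>M. summable M \<and> (\<forall>n. \<forall>x\<in>{0..T}. norm (D n x) \<le> M n)" for T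
  proof (intro exI conjI allI ballI)
    let ?M = "\<lambda>n. P * (norm a + T * norm b) * T * ((P * T * T) ^ n / fact n)"
    show "summable (\<lambda>n. case n of 0 \<Rightarrow> norm b | Suc n \<Rightarrow> ?M n)"
      by (subst summable_Suc_iff[symmetric]) (simp only: nat.case sum)
    fix n x assume x: "x \<in> {0..T}"
    show "norm (D n x) \<le> (case n of 0 \<Rightarrow> norm b | Suc n \<Rightarrow> ?M n)"
    proof (cases n)
      case (Suc m)
      have "norm (D n x) \<le> P * ((norm a + T * norm b) * ((P * T * T) ^ m / fact m)) * (x - 0)"
        unfolding D_def Suc nat.case
      proof (rule integral_bound)
        show "continuous_on {0..x} (\<lambda>s. p s * S m s)"
          using Sc[of m] by (rule continuous_on_subset) auto
        show "norm (p s * S m s) \<le> P * ((norm a + T * norm b) * ((P * T * T) ^ m / fact m))"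
          if "s \<in> {0..x}" for s
          unfolding norm_mult using x P0 that by (intro mult_mono P Sb') auto
      qed (use x in auto)
      also have "\<dots> \<le> P * ((norm a + T * norm b) * ((P * T * T) ^ m / fact m)) * T"
        using x P0 by (intro mult_left_mono) auto
      finally show ?thesis by (simp add: Suc mult_ac)
    qed (simp add: D_def)
  qed
  have S00: "S n 0 = (if n = 0 then a else 0)" for n by (cases n) (auto simp: S_def)
  have D00: "D n 0 = (if n = 0 then b else 0)" for n by (cases n) (auto simp: D_def)
  have s1: "(\<lambda>n. S n 0) sums a" unfolding S00 by (rule sums_single)
  have s2: "(\<lambda>n. D n 0) sums b" unfolding D00 by (rule sums_single)
  have "(suminf (\<lambda>n. D' n x)) = p x * (suminf (\<lambda>n. S n x))" if x: "0 \<le> x" for x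
  proof -
    have "summable (\<lambda>n. S n x)"
      by (rule summable_comparison_test'[OF sum, where N = 0]) (use Sb'[OF x order.refl] in auto)
    then have "(\<lambda>n. p x * S n x) sums (p x * (suminf (\<lambda>n. S n x)))"
      by (intro sums_mult summable_sums)
    then have "(\<lambda>n. D' (Suc n) x) sums (p x * (suminf (\<lambda>n. S n x)))" by (simp add: D'_def)
    then have "(\<lambda>n. D' n x) sums (p x * (suminf (\<lambda>n. S n x)) + D' 0 x)" by (rule iffD1[OF sums_Suc_iff])
    then show ?thesis by (simp add: D'_def sums_iff)
  qed
  then have "solves p (\<lambda>x. suminf (\<lambda>n. S n x)) (\<lambda>x. suminf (\<lambda>n. D n x))"
    unfolding solves_def
    using has_vector_derivative_suminf_half_line[OF DS Sbd sums_summable[OF s1]]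
      has_vector_derivative_suminf_half_line[OF D'D Dbd sums_summable[OF s2]]
    by simp
  then show ?thesis using s1 s2 by (intro exI[of _ "\<lambda>x. suminf (\<lambda>n. S n x)"] exI[of _ "\<lambda>x. suminf (\<lambda>n. D n x)"]) (auto simp: sums_iff)
qed

lemma set_integrable_half_line_iff_bounded_integrals:
  fixes h :: "real \<Rightarrow> real"
  assumes h: "continuous_on {0..} h" "\<And>x. 0 \<le> x \<Longrightarrow> 0 \<le> h x"
  shows "(\<exists>a\<ge>0. set_integrable lborel {a..} h) \<longleftrightarrow> (\<exists>C. \<forall>b\<ge>0. integral {0..b} h \<le> C)"
proof
  have on: "set_integrable lborel {a..b} h" if "0 \<le> a" for a b
    by (rule borel_integrable_atLeastAtMost') (use h(1) that in \<open>auto elim: continuous_on_subset\<close>)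
  assume "\<exists>a\<ge>0. set_integrable lborel {a..} h"
  then obtain a where a: "0 \<le> a" "set_integrable lborel {a..} h" by blast
  have "set_integrable lborel ({0..a} \<union> {a..}) h"
    by (rule set_integrable_Un) (use a on in auto)
  moreover have "{0..a} \<union> {a..} = {0..}" using a by auto
  ultimately have i: "set_integrable lborel {0..} h" by simp
  have "integral {0..b} h \<le> (LINT x:{0..}|lborel. h x)" for b
  proof -
    have "integral {0..b} h = (LINT x:{0..b}|lborel. h x)"
      using on[of 0 b] by (simp add: set_borel_integral_eq_integral)
    also have "\<dots> \<le> (LINT x:{0..}|lborel. h x)"
      unfolding set_lebesgue_integral_def
      by (rule integral_mono)
        (use on[of 0 b] i h(2) in \<open>auto simp: set_integrable_def indicator_def\<close>)
    finally show ?thesis .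
  qed
  then show "\<exists>C. \<forall>b\<ge>0. integral {0..b} h \<le> C" by blast
next
  have on: "set_integrable lborel {a..b} h" if "0 \<le> a" for a b
    by (rule borel_integrable_atLeastAtMost') (use h(1) that in \<open>auto elim: continuous_on_subset\<close>)
  assume "\<exists>C. \<forall>b\<ge>0. integral {0..b} h \<le> C"
  then obtain C where C: "\<And>b. 0 \<le> b \<Longrightarrow> integral {0..b} h \<le> C" by blast
  let ?f = "\<lambda>i x. indicator {0..real i} x *\<^sub>R h x"
  have int: "(\<integral>x. ?f i x \<partial>lborel) = integral {0..real i} h" for i
    using set_borel_integral_eq_integral(2)[OF on[of 0 "real i"]] by (simp add: set_lebesgue_integral_def)
  have inc: "incseq (\<lambda>i. integral {0..real i} h)"
    unfolding incseq_def
    by (auto intro!: integral_subset_le integrable_continuous_real continuous_on_subset[OF h(1)] h(2))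
  moreover have "\<forall>i. integral {0..real i} h \<le> C" using C by simp
  ultimately obtain L where L: "(\<lambda>i. integral {0..real i} h) \<longlonglongrightarrow> L"
    using incseq_convergent by blast
  have "integrable lborel (\<lambda>x. indicator {0..} x *\<^sub>R h x)"
  proof (rule integrable_monotone_convergence[where f = ?f and x = L])
    show "integrable lborel (?f i)" for i using on[of 0 "real i"] by (simp add: set_integrable_def)
    show "AE x in lborel. mono (\<lambda>n. ?f n x)"
    proof (intro AE_I2 monoI)
      fix x :: real and i j :: nat
      assume "i \<le> j"
      then have "real i \<le> real j" by simp
      then show "?f i x \<le> ?f j x" using h(2)[of x] by (simp split: split_indicator)
    qed
    show "AE x in lborel. (\<lambda>i. ?f i x) \<longlonglongrightarrow> indicator {0..} x *\<^sub>R h x"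
    proof (intro AE_I2 tendsto_eventually)
      fix x :: real
      obtain n where "x < real n" using reals_Archimedean2 by blast
      then show "\<forall>\<^sub>F i in sequentially. ?f i x = indicator {0..} x *\<^sub>R h x"
        by (intro eventually_sequentiallyI[of n]) (auto simp: indicator_def)
    qed
    show "(\<lambda>i. \<integral>x. ?f i x \<partial>lborel) \<longlonglongrightarrow> L" unfolding int by (rule L)
    show "(\<lambda>x. indicator {0..} x *\<^sub>R h x) \<in> borel_measurable lborel"
      using borel_measurable_continuous_on_indicator[OF _ h(1)] by simp
  qed
  then show "\<exists>a\<ge>0. set_integrable lborel {a..} h" by (auto simp: set_integrable_def)
qed

lemma solves_continuous:
  assumes "solves p f g" shows "continuous_on {0..} f" "continuous_on {0..} g"
  using assms by (auto simp: solves_def intro!: continuous_on_half_lineI)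

lemma integral_norm_square_derivative:
  assumes "solves p f g" "0 \<le> x"
  shows "((\<lambda>x. integral {0..x} (\<lambda>t. (cmod (f t))\<^sup>2)) has_vector_derivative (cmod (f x))\<^sup>2) (at x within {0..})"
  by (rule integral_half_line_has_vector_derivative)
    (use assms solves_continuous in \<open>auto intro!: continuous_intros\<close>)

text \<open>Multiplying the equation on \<open>{x..x+1}\<close> by \<open>(1 - (s - x))\<^sup>r\<close>, which vanishes at the right end
  together with its derivative, and integrating by parts expresses \<open>g x + r f x\<close> as the integral of \<open>f\<close> over \<open>{x..x+1}\<close>
  against a bounded weight. That integral tends to \<open>0\<close>; the values \<open>r = 2\<close> and \<open>r = 3\<close> separate \<open>f\<close> from \<open>g\<close>.\<close>

lemma solves_decay:
  assumes fg: "solves p f g" and P: "\<And>x. 0 \<le> x \<Longrightarrow> cmod (p x) \<le> P"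
    and C: "\<And>b. 0 \<le> b \<Longrightarrow> integral {0..b} (\<lambda>t. (cmod (f t))\<^sup>2) \<le> C"
  shows "(f \<longlongrightarrow> 0) at_top" "(g \<longlongrightarrow> 0) at_top"
proof -
  define E where "E x = integral {0..x} (\<lambda>t. (cmod (f t))\<^sup>2)" for x
  have P0: "0 \<le> P" using norm_ge_zero[of "p 0"] P[of 0] by linarith
  have E': "(E has_vector_derivative (cmod (f x))\<^sup>2) (at x within {0..})" if "0 \<le> x" for x
    unfolding E_def by (rule integral_norm_square_derivative[OF fg that])
  have mono: "E x \<le> E y" if "0 \<le> x" "x \<le> y" for x y
    by (rule mono_half_line[OF E']) (use that in auto)
  have small: "\<exists>X\<ge>0. \<forall>x\<ge>X. E (x + 1) - E x < e" if e: "e > 0" for e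
  proof -
    have bdd: "bdd_above (E ` {0..})" using C by (auto simp: E_def bdd_above_def)
    have "\<exists>X\<in>{0..}. Sup (E ` {0..}) - e < E X"
      using e bdd by (subst less_cSUP_iff[symmetric]) auto
    then obtain X where X: "0 \<le> X" "Sup (E ` {0..}) - e < E X" by auto
    have "E (x + 1) - E x < e" if "X \<le> x" for x
      using cSUP_upper[OF _ bdd, of "x + 1"] mono[of X x] X that by auto
    then show ?thesis using X by blast
  qed
  have lim: "((\<lambda>x. g x + of_nat r * f x) \<longlongrightarrow> 0) at_top" if r: "r = 2 \<or> r = 3" for r :: nat
  proof (rule tendstoI)
    fix e :: real assume e: "e > 0"
    \<comment> \<open>\<open>P + 6\<close> will bound the weight \<open>w\<close> against which \<open>f\<close> is integrated.\<close>
    define d where "d = e / (P + 7)"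
    have d: "d > 0" using e P0 by (simp add: d_def)
    obtain X where X: "0 \<le> X" "\<And>x. X \<le> x \<Longrightarrow> E (x + 1) - E x < d\<^sup>2"
      using small[of "d\<^sup>2"] d by auto
    have "cmod (g x + of_nat r * f x) < e" if x: "X \<le> x" for x
    proof -
      define G where "G s = of_real ((1 - (s - x)) ^ r) * g s + of_real (real r * (1 - (s - x)) ^ (r - 1)) * f s" for s
      define w where "w s = (1 - (s - x)) ^ r * p s - of_real (real r * (real r - 1) * (1 - (s - x)) ^ (r - 2))" for s
      have G': "(G has_vector_derivative w s * f s) (at s within {0..})" if "0 \<le> s" for s
      proof -
        have d1: "((\<lambda>s. of_real ((1 - (s - x)) ^ n) :: complex) has_vector_derivative
            of_real (- real n * (1 - (s - x)) ^ (n - 1))) (at s within {0..})" for n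
          by (rule has_vector_derivative_of_real)
            (auto intro!: derivative_eq_intros simp: has_real_derivative_iff_has_vector_derivative[symmetric])
        have d2: "((\<lambda>s. of_real (real r * (1 - (s - x)) ^ (r - 1)) :: complex) has_vector_derivative
            of_real (real r * (- real (r - 1) * (1 - (s - x)) ^ (r - 2)))) (at s within {0..})"
          by (rule has_vector_derivative_of_real)
            (use r in \<open>auto intro!: derivative_eq_intros simp: has_real_derivative_iff_has_vector_derivative[symmetric]\<close>)
        have "(G has_vector_derivative
             (of_real ((1 - (s - x)) ^ r) * (p s * f s) + of_real (- real r * (1 - (s - x)) ^ (r - 1)) * g s) +
             (of_real (real r * (1 - (s - x)) ^ (r - 1)) * g s +
              of_real (real r * (- real (r - 1) * (1 - (s - x)) ^ (r - 2))) * f s)) (at s within {0..})"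
          unfolding G_def
          using fg that by (intro has_vector_derivative_add has_vector_derivative_mult d1 d2) (auto simp: solves_def)
        then show ?thesis
          by (rule has_vector_derivative_eq_rhs) (use r in \<open>auto simp: w_def algebra_simps\<close>)
      qed
      have "norm (G (x + 1) - G x) \<le> ((P + 6) / 2 * (d * (x + 1) + E (x + 1) / d)) - ((P + 6) / 2 * (d * x + E x / d))"
      proof (rule norm_increment_le_half_line[OF _ _ G'])
        show "((\<lambda>x. (P + 6) / 2 * (d * x + E x / d)) has_vector_derivative
            (P + 6) / 2 * (d + (cmod (f s))\<^sup>2 / d)) (at s within {0..})" if "0 \<le> s" for s
          using E'[OF that] d unfolding has_real_derivative_iff_has_vector_derivative[symmetric]
          by (auto intro!: derivative_eq_intros)
        fix s assume s: "x < s" "s < x + 1"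
        have "cmod (w s) \<le> cmod ((1 - (s - x)) ^ r * p s) + cmod (of_real (real r * (real r - 1) * (1 - (s - x)) ^ (r - 2)))"
          unfolding w_def by (rule norm_triangle_ineq4)
        also have "\<dots> \<le> P + 6"
        proof (rule add_mono)
          have "\<bar>1 - (s - x)\<bar> ^ r * cmod (p s) \<le> 1 * P"
            using s x X by (intro mult_mono P power_le_one) auto
          then show "cmod ((1 - (s - x)) ^ r * p s) \<le> P" by (simp add: norm_mult power_abs flip: of_real_diff of_real_power)
          show "cmod (of_real (real r * (real r - 1) * (1 - (s - x)) ^ (r - 2))) \<le> 6"
            unfolding norm_of_real using r s by auto
        qed
        finally have w: "cmod (w s) \<le> P + 6" .
        have "2 * cmod (f s) \<le> d + (cmod (f s))\<^sup>2 / d"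
          using sum_squares_bound[of "cmod (f s)" d] d by (simp add: field_simps power2_eq_square)
        then have "cmod (f s) \<le> (d + (cmod (f s))\<^sup>2 / d) / 2" by simp
        then have "cmod (w s) * cmod (f s) \<le> (P + 6) * ((d + (cmod (f s))\<^sup>2 / d) / 2)"
          using w P0 by (intro mult_mono) auto
        then show "norm (w s * f s) \<le> (P + 6) / 2 * (d + (cmod (f s))\<^sup>2 / d)"
          by (simp add: norm_mult)
      qed (use x X in auto)
      also have "\<dots> = (P + 6) / 2 * (d + (E (x + 1) - E x) / d)"
      proof -
        have "(d * (x + 1) + E (x + 1) / d) - (d * x + E x / d) = d + (E (x + 1) - E x) / d"
          by (simp add: diff_divide_distrib distrib_left)
        then show ?thesis by (simp only: right_diff_distrib[symmetric])
      qed
      also have "\<dots> \<le> (P + 6) / 2 * (d + d)"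
        using X(2)[OF x] d P0 by (intro mult_left_mono add_left_mono) (auto simp: field_simps power2_eq_square)
      also have "\<dots> < (P + 7) * d" using d by (simp add: field_simps)
      also have "\<dots> = e" using P0 by (simp add: d_def)
      finally have "norm (G (x + 1) - G x) < e" .
      moreover have "G (x + 1) = 0" "G x = g x + of_nat r * f x" using r by (auto simp: G_def)
      ultimately show ?thesis by (simp only: diff_0 norm_minus_cancel)
    qed
    then show "\<forall>\<^sub>F x in at_top. dist (g x + of_nat r * f x) 0 < e"
      by (auto simp: eventually_at_top_linorder)
  qed
  have l: "((\<lambda>x. g x + 2 * f x) \<longlongrightarrow> 0) at_top" "((\<lambda>x. g x + 3 * f x) \<longlongrightarrow> 0) at_top"
    using lim[of 2] lim[of 3] by auto
  show "(f \<longlongrightarrow> 0) at_top" using tendsto_diff[OF l(2) l(1)] by simp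
  show "(g \<longlongrightarrow> 0) at_top"
    using tendsto_diff[OF tendsto_mult_left[OF l(1), of 3] tendsto_mult_left[OF l(2), of 2]]
    by (simp add: algebra_simps)
qed

section \<open>Energy estimates and decaying solutions\<close>

text \<open>The boundary term that appears when \<open>f'' = p f\<close> is multiplied by \<open>\<tau> * cnj f\<close> and integrated by
  parts.\<close>

definition energy :: "complex \<Rightarrow> (real \<Rightarrow> complex) \<Rightarrow> (real \<Rightarrow> complex) \<Rightarrow> real \<Rightarrow> real" where
  "energy \<tau> f g x = Re (\<tau> * g x * cnj (f x))"

lemma has_vector_derivative_complex_cnj:
  "(f has_vector_derivative f') F \<Longrightarrow> ((\<lambda>x. cnj (f x)) has_vector_derivative cnj f') F"
  by (rule bounded_linear.has_vector_derivative[OF bounded_linear_cnj])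

lemma has_vector_derivative_complex_Re:
  "(f has_vector_derivative f') F \<Longrightarrow> ((\<lambda>x. Re (f x)) has_vector_derivative Re f') F"
  by (rule bounded_linear.has_vector_derivative[OF bounded_linear_Re])

lemma energy_has_vector_derivative:
  assumes "(f has_vector_derivative g x) (at x within S)" "(g has_vector_derivative g') (at x within S)"
  shows "(energy \<tau> f g has_vector_derivative
    Re \<tau> * (cmod (g x))\<^sup>2 + Re (\<tau> * g' * cnj (f x))) (at x within S)"
proof -
  have "((\<lambda>x. Re ((\<tau> * g x) * cnj (f x))) has_vector_derivative
      Re ((\<tau> * g x) * cnj (g x) + (\<tau> * g') * cnj (f x))) (at x within S)"
    using assms by (intro has_vector_derivative_complex_Re has_vector_derivative_mult
      has_vector_derivative_complex_cnj has_vector_derivative_mult_right)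
  moreover have "Re ((\<tau> * g x) * cnj (g x) + (\<tau> * g') * cnj (f x)) =
      Re \<tau> * (cmod (g x))\<^sup>2 + Re (\<tau> * g' * cnj (f x))"
    unfolding cmod_power2 by (simp add: algebra_simps power2_eq_square)
  ultimately show ?thesis by (simp only: energy_def[abs_def])
qed

lemma energy_solves_has_vector_derivative:
  assumes "solves p f g" "0 \<le> x"
  shows "(energy \<tau> f g has_vector_derivative
    Re \<tau> * (cmod (g x))\<^sup>2 + Re (\<tau> * p x) * (cmod (f x))\<^sup>2) (at x within {0..})"
proof -
  have "\<tau> * (p x * f x) * cnj (f x) = of_real ((cmod (f x))\<^sup>2) * (\<tau> * p x)"
    by (simp only: complex_norm_square mult_ac)
  then have "Re (\<tau> * (p x * f x) * cnj (f x)) = Re (\<tau> * p x) * (cmod (f x))\<^sup>2"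
    by (simp only: Re_complex_of_real mult.commute) simp
  then show ?thesis
    using energy_has_vector_derivative[of f g x "{0..}" "p x * f x" \<tau>] assms by (auto simp: solves_def)
qed

lemma norm_square_has_vector_derivative:
  assumes "(g has_vector_derivative g') (at x within S)"
  shows "((\<lambda>x. (cmod (g x))\<^sup>2) has_vector_derivative 2 * Re (g' * cnj (g x))) (at x within S)"
proof -
  have "((\<lambda>x. Re (g x * cnj (g x))) has_vector_derivative Re (g x * cnj g' + g' * cnj (g x))) (at x within S)"
    using assms by (intro has_vector_derivative_complex_Re has_vector_derivative_mult has_vector_derivative_complex_cnj)
  moreover have "Re (g x * cnj (g x)) = (cmod (g x))\<^sup>2" for x
    by (simp add: complex_norm_square[symmetric] del: of_real_power)
  moreover have "Re (g x * cnj g' + g' * cnj (g x)) = 2 * Re (g' * cnj (g x))" by simp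
  ultimately show ?thesis by (simp only:)
qed

definition wronskian :: "(real \<Rightarrow> complex) \<Rightarrow> (real \<Rightarrow> complex) \<Rightarrow> (real \<Rightarrow> complex) \<Rightarrow> (real \<Rightarrow> complex) \<Rightarrow> real \<Rightarrow> complex" where
  "wronskian f1 g1 f2 g2 x = f1 x * g2 x - g1 x * f2 x"

lemma wronskian_has_vector_derivative:
  assumes "solves p1 f1 g1" "solves p2 f2 g2" "0 \<le> x"
  shows "(wronskian f1 g1 f2 g2 has_vector_derivative (p2 x - p1 x) * (f1 x * f2 x)) (at x within {0..})"
proof -
  have "((\<lambda>x. f1 x * g2 x - g1 x * f2 x) has_vector_derivative
      (f1 x * (p2 x * f2 x) + g1 x * g2 x) - (g1 x * g2 x + (p1 x * f1 x) * f2 x)) (at x within {0..})"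
    using assms by (intro has_vector_derivative_diff has_vector_derivative_mult) (auto simp: solves_def)
  then show ?thesis
    unfolding wronskian_def[abs_def] by (rule has_vector_derivative_eq_rhs) (simp add: algebra_simps)
qed

lemma solves_linear_combination:
  assumes "solves p f1 g1" "solves p f2 g2"
  shows "solves p (\<lambda>x. f1 x + c * f2 x) (\<lambda>x. g1 x + c * g2 x)"
  unfolding solves_def
proof (intro allI impI conjI)
  fix x :: real assume x: "0 \<le> x"
  show "((\<lambda>x. f1 x + c * f2 x) has_vector_derivative g1 x + c * g2 x) (at x within {0..})"
    using assms x by (intro has_vector_derivative_add has_vector_derivative_mult_right) (auto simp: solves_def)
  have "((\<lambda>x. g1 x + c * g2 x) has_vector_derivative p x * f1 x + c * (p x * f2 x)) (at x within {0..})"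
    using assms x by (intro has_vector_derivative_add has_vector_derivative_mult_right) (auto simp: solves_def)
  then show "((\<lambda>x. g1 x + c * g2 x) has_vector_derivative p x * (f1 x + c * f2 x)) (at x within {0..})"
    by (rule has_vector_derivative_eq_rhs) (simp add: algebra_simps)
qed

text \<open>The multiplier \<open>\<tau>\<close> rotates the equation so that its quadratic form becomes coercive. For
  \<open>p = q + k\<^sup>2\<close> the choice \<open>\<tau> = cnj k\<close> works in the right half-plane, since \<open>Re (cnj k * k\<^sup>2) = |k|\<^sup>2 Re k\<close>; to the
  left of the spectrum \<open>\<tau> = 1\<close> suffices and does not depend on the spectral parameter.\<close>

locale dissipative =
  fixes p :: "real \<Rightarrow> complex" and \<tau> :: complex and \<alpha> P :: real
  assumes p_continuous: "continuous_on {0..} p" and p_bound: "\<And>x. 0 \<le> x \<Longrightarrow> cmod (p x) \<le> P"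
    and \<alpha>_pos: "0 < \<alpha>" and \<tau>_ge: "\<alpha> \<le> Re \<tau>" and p_ge: "\<And>x. 0 \<le> x \<Longrightarrow> \<alpha> \<le> Re (\<tau> * p x)"
begin

lemma P_nonneg: "0 \<le> P" using norm_ge_zero[of "p 0"] p_bound[of 0] by linarith

lemma energy_derivative_ge:
  assumes "0 \<le> x"
  shows "\<alpha> * ((cmod a)\<^sup>2 + (cmod b)\<^sup>2) \<le> Re \<tau> * (cmod a)\<^sup>2 + Re (\<tau> * p x) * (cmod b)\<^sup>2"
  unfolding distrib_left using \<tau>_ge p_ge[OF assms] by (intro add_mono mult_right_mono) auto

lemma energy_mono:
  assumes "solves p f g" "0 \<le> a" "a \<le> b"
  shows "energy \<tau> f g a \<le> energy \<tau> f g b"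
proof (rule mono_half_line[OF energy_solves_has_vector_derivative[OF assms(1)]])
  fix x :: real assume "0 \<le> x"
  then show "0 \<le> Re \<tau> * (cmod (g x))\<^sup>2 + Re (\<tau> * p x) * (cmod (f x))\<^sup>2"
    using energy_derivative_ge[of x "g x" "f x"] \<alpha>_pos
    by (smt (verit) mult_nonneg_nonneg zero_le_power2)
qed (use assms in auto)

text \<open>The weight \<open>P / \<alpha>\<close> is just large enough for the derivative of the energy to absorb the mixed
  term \<open>2 Re (p f (cnj g))\<close> in the derivative of \<open>|g|\<^sup>2\<close>.\<close>

lemma slope_energy_mono:
  assumes fg: "solves p f g" and "0 \<le> a" "a \<le> b"
  shows "(cmod (g a))\<^sup>2 + P / \<alpha> * energy \<tau> f g a \<le> (cmod (g b))\<^sup>2 + P / \<alpha> * energy \<tau> f g b"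
proof (rule mono_half_line[where \<phi> = "\<lambda>x. (cmod (g x))\<^sup>2 + P / \<alpha> * energy \<tau> f g x" and \<phi>' = "\<lambda>x. 2 * Re (p x * f x * cnj (g x)) +
      P / \<alpha> * (Re \<tau> * (cmod (g x))\<^sup>2 + Re (\<tau> * p x) * (cmod (f x))\<^sup>2)"])
  fix x :: real assume x: "0 \<le> x"
  let ?e = "Re \<tau> * (cmod (g x))\<^sup>2 + Re (\<tau> * p x) * (cmod (f x))\<^sup>2"
  let ?s = "2 * Re (p x * f x * cnj (g x))"
  have "(g has_vector_derivative p x * f x) (at x within {0..})" using fg x by (simp add: solves_def)
  then show "((\<lambda>x. (cmod (g x))\<^sup>2 + P / \<alpha> * energy \<tau> f g x) has_vector_derivative
      ?s + P / \<alpha> * ?e) (at x within {0..})"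
    by (intro has_vector_derivative_add has_vector_derivative_mult_right
      norm_square_has_vector_derivative energy_solves_has_vector_derivative fg x)
  have "\<bar>Re (p x * f x * cnj (g x))\<bar> \<le> cmod (p x * f x * cnj (g x))" by (rule abs_Re_le_cmod)
  also have "\<dots> \<le> P * (cmod (f x) * cmod (g x))"
    using p_bound[OF x] by (simp add: norm_mult mult.assoc mult_right_mono)
  finally have "- (P * (2 * cmod (f x) * cmod (g x))) \<le> ?s" by simp
  moreover have "P * (2 * cmod (f x) * cmod (g x)) \<le> P * ((cmod (f x))\<^sup>2 + (cmod (g x))\<^sup>2)"
    using P_nonneg sum_squares_bound by (intro mult_left_mono) auto
  moreover have "P / \<alpha> * (\<alpha> * ((cmod (g x))\<^sup>2 + (cmod (f x))\<^sup>2)) \<le> P / \<alpha> * ?e"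
    using P_nonneg \<alpha>_pos by (intro mult_left_mono energy_derivative_ge x) auto
  moreover have "P / \<alpha> * (\<alpha> * ((cmod (g x))\<^sup>2 + (cmod (f x))\<^sup>2)) = P * ((cmod (f x))\<^sup>2 + (cmod (g x))\<^sup>2)"
    using \<alpha>_pos by (simp add: add.commute)
  ultimately show "0 \<le> ?s + P / \<alpha> * ?e" by linarith
qed (use assms in auto)

text \<open>The quadratic term in \<open>m\<close> beats the linear one. With \<open>m\<close> the slope at \<open>0\<close> of a solution with
  value \<open>1\<close> there, the hypothesis says that the monotone quantity of the preceding lemma ends at \<open>0\<close>.\<close>

lemma slope_bound_of_energy:
  assumes "(cmod m)\<^sup>2 + P / \<alpha> * Re (\<tau> * m) \<le> 0"
  shows "cmod m \<le> P / \<alpha> * cmod \<tau>"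
proof (cases "m = 0")
  case False
  have "(cmod m)\<^sup>2 \<le> P / \<alpha> * (- Re (\<tau> * m))" using assms by (simp only: mult_minus_right)
  also have "\<dots> \<le> P / \<alpha> * cmod (\<tau> * m)"
    using P_nonneg \<alpha>_pos abs_Re_le_cmod[of "\<tau> * m"] by (intro mult_left_mono) auto
  finally have "cmod m * cmod m \<le> P / \<alpha> * cmod \<tau> * cmod m"
    by (simp add: norm_mult power2_eq_square mult_ac)
  then show ?thesis using False by (simp del: times_divide_eq_left)
qed (use P_nonneg \<alpha>_pos in simp)

lemma energy_tendsto_zero:
  assumes "(f \<longlongrightarrow> 0) at_top" "(g \<longlongrightarrow> 0) at_top"
  shows "(energy t f g \<longlongrightarrow> 0) at_top"
proof -
  have "((\<lambda>x. Re (t * g x * cnj (f x))) \<longlongrightarrow> Re (t * 0 * cnj 0)) at_top"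
    using assms by (intro tendsto_intros)
  then show ?thesis by (simp add: energy_def[abs_def])
qed

lemma decaying_energy_nonpos:
  assumes "solves p f g" "(f \<longlongrightarrow> 0) at_top" "(g \<longlongrightarrow> 0) at_top" "0 \<le> x"
  shows "energy \<tau> f g x \<le> 0"
proof (rule tendsto_lowerbound[OF energy_tendsto_zero[OF assms(2,3)]])
  show "\<forall>\<^sub>F y in at_top. energy \<tau> f g x \<le> energy \<tau> f g y"
    using eventually_ge_at_top[of x] by eventually_elim (use assms energy_mono in auto)
qed simp

text \<open>The energy increases from \<open>0\<close> to its limit \<open>0\<close>, so it is constant and its derivative, which
  dominates \<open>|f|\<^sup>2\<close>, vanishes.\<close>

lemma decaying_zero:
  assumes "solves p f g" "(f \<longlongrightarrow> 0) at_top" "(g \<longlongrightarrow> 0) at_top" "f 0 = 0" "0 \<le> x"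
  shows "f x = 0"
proof -
  have z: "energy \<tau> f g y = 0" if "0 \<le> y" for y
    using decaying_energy_nonpos[OF assms(1-3) that] energy_mono[OF assms(1) order.refl that] assms(4)
    by (simp add: energy_def)
  have "((\<lambda>_. 0) has_vector_derivative
      (Re \<tau> * (cmod (g x))\<^sup>2 + Re (\<tau> * p x) * (cmod (f x))\<^sup>2)) (at x within {0..})"
    by (rule has_vector_derivative_half_line_cong[OF energy_solves_has_vector_derivative[OF assms(1,5)] assms(5) z])
  then have "Re \<tau> * (cmod (g x))\<^sup>2 + Re (\<tau> * p x) * (cmod (f x))\<^sup>2 = 0"
    using hl_deriv_eq[of "\<lambda>_. 0 :: real" _ x] has_vector_derivative_const[of "0::real"] assms(5) by metis
  then have "\<alpha> * ((cmod (g x))\<^sup>2 + (cmod (f x))\<^sup>2) \<le> 0"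
    using energy_derivative_ge[OF assms(5), of "g x" "f x"] by simp
  then have "(cmod (g x))\<^sup>2 + (cmod (f x))\<^sup>2 \<le> 0" using \<alpha>_pos by (simp add: mult_le_0_iff)
  then show ?thesis by (simp add: sum_power2_le_zero_iff)
qed

lemma decaying_slope_bound:
  assumes "solves p f g" "(f \<longlongrightarrow> 0) at_top" "(g \<longlongrightarrow> 0) at_top" "f 0 = 1"
  shows "cmod (g 0) \<le> P / \<alpha> * cmod \<tau>"
proof (rule slope_bound_of_energy)
  have "((\<lambda>x. (cmod (g x))\<^sup>2 + P / \<alpha> * energy \<tau> f g x) \<longlongrightarrow> (cmod 0)\<^sup>2 + P / \<alpha> * 0) at_top"
    using assms energy_tendsto_zero by (intro tendsto_intros) auto
  then have l: "((\<lambda>x. (cmod (g x))\<^sup>2 + P / \<alpha> * energy \<tau> f g x) \<longlongrightarrow> 0) at_top" by simp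
  have "(cmod (g 0))\<^sup>2 + P / \<alpha> * energy \<tau> f g 0 \<le> 0"
  proof (rule tendsto_lowerbound[OF l])
    show "\<forall>\<^sub>F x in at_top. (cmod (g 0))\<^sup>2 + P / \<alpha> * energy \<tau> f g 0 \<le> (cmod (g x))\<^sup>2 + P / \<alpha> * energy \<tau> f g x"
      using eventually_ge_at_top[of 0] by eventually_elim (use assms slope_energy_mono in auto)
  qed simp
  then show "(cmod (g 0))\<^sup>2 + P / \<alpha> * Re (\<tau> * g 0) \<le> 0" using assms(4) by (simp add: energy_def)
qed

text \<open>The Wronskian of the two solutions is constant and tends to \<open>0\<close>.\<close>

lemma decaying_unique:
  assumes "solves p f1 g1" "(f1 \<longlongrightarrow> 0) at_top" "(g1 \<longlongrightarrow> 0) at_top"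
    "solves p f2 g2" "(f2 \<longlongrightarrow> 0) at_top" "(g2 \<longlongrightarrow> 0) at_top"
  shows "f1 0 * g2 0 = g1 0 * f2 0"
proof -
  have inc: "norm (wronskian f1 g1 f2 g2 b - wronskian f1 g1 f2 g2 0) \<le> 0 - 0" if "0 \<le> b" for b
    by (rule norm_increment_le_half_line[OF _ _ wronskian_has_vector_derivative[OF assms(1,4)],
          where \<phi> = "\<lambda>_. 0" and \<phi>' = "\<lambda>_. 0"])
      (use that in \<open>auto intro: has_vector_derivative_const\<close>)
  have eq: "wronskian f1 g1 f2 g2 b = wronskian f1 g1 f2 g2 0" if "0 \<le> b" for b
    using inc[OF that] by simp
  have "(wronskian f1 g1 f2 g2 \<longlongrightarrow> wronskian f1 g1 f2 g2 0) at_top"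
    by (rule tendsto_eventually, rule eventually_mono[OF eventually_ge_at_top[of 0]]) (rule eq)
  moreover have "((\<lambda>x. f1 x * g2 x - g1 x * f2 x) \<longlongrightarrow> 0 * 0 - 0 * 0) at_top"
    using assms by (intro tendsto_intros)
  ultimately have "wronskian f1 g1 f2 g2 0 = 0"
    unfolding wronskian_def[abs_def] by (metis (no_types, lifting) diff_0_right mult_zero_left tendsto_unique trivial_limit_at_top_linorder)
  then show ?thesis by (simp add: wronskian_def)
qed

text \<open>The solutions with \<open>f(0) = 1\<close> and \<open>f'(n) = 0\<close> have slopes at \<open>0\<close> that are bounded independently of \<open>n\<close>,
  and so are the integrals of \<open>|f|\<^sup>2\<close> over \<open>{0..n}\<close>. A limit point of the slopes is the slope of a
  solution that inherits the bound on every interval.\<close>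

lemma square_integrable_solution_exists:
  "\<exists>f g C. solves p f g \<and> f 0 = 1 \<and> (\<forall>b\<ge>0. integral {0..b} (\<lambda>t. (cmod (f t))\<^sup>2) \<le> C)"
proof -
  obtain u u' where u: "solves p u u'" "u 0 = 1" "u' 0 = 0"
    using solves_exists[OF p_continuous p_bound] by blast
  obtain v v' where v: "solves p v v'" "v 0 = 0" "v' 0 = 1"
    using solves_exists[OF p_continuous p_bound] by blast
  have v'0: "v' b \<noteq> 0" if "0 \<le> b" for b
  proof
    assume "v' b = 0"
    then show False using slope_energy_mono[OF v(1) order.refl that] v by (simp add: energy_def)
  qed
  \<comment> \<open>Chosen so that the combination \<open>u + m n * v\<close> has derivative \<open>0\<close> at \<open>n\<close>.\<close>
  define m where "m n = - u' (real n) / v' (real n)" for n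
  let ?f = "\<lambda>n x. u x + m n * v x" and ?g = "\<lambda>n x. u' x + m n * v' x"
  have fg: "solves p (?f n) (?g n)" for n by (rule solves_linear_combination[OF u(1) v(1)])
  have gn: "?g n (real n) = 0" for n using v'0[of "real n"] by (simp add: m_def)
  define K where "K = P / \<alpha> * cmod \<tau>"
  have mK: "cmod (m n) \<le> K" for n
    unfolding K_def
  proof (rule slope_bound_of_energy)
    show "(cmod (m n))\<^sup>2 + P / \<alpha> * Re (\<tau> * m n) \<le> 0"
      using slope_energy_mono[OF fg[of n], of 0 "real n"] gn[of n] u v by (simp add: energy_def)
  qed
  define C where "C = cmod \<tau> * K / \<alpha>"
  have fC: "integral {0..b} (\<lambda>t. (cmod (?f n t))\<^sup>2) \<le> C" if b: "0 \<le> b" "b \<le> real n" for n b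
  proof -
    let ?E = "\<lambda>x. integral {0..x} (\<lambda>t. (cmod (?f n t))\<^sup>2)"
    have "\<alpha> * ?E b - \<alpha> * ?E 0 \<le> energy \<tau> (?f n) (?g n) b - energy \<tau> (?f n) (?g n) 0"
    proof -
      have "norm (\<alpha> * ?E b - \<alpha> * ?E 0) \<le> energy \<tau> (?f n) (?g n) b - energy \<tau> (?f n) (?g n) 0"
      proof (rule norm_increment_le_half_line[OF _ _ _ energy_solves_has_vector_derivative[OF fg[of n]]])
        show "((\<lambda>x. \<alpha> * ?E x) has_vector_derivative \<alpha> * (cmod (?f n x))\<^sup>2) (at x within {0..})" if "0 \<le> x" for x
          by (intro has_vector_derivative_mult_right integral_norm_square_derivative[OF fg that])
        show "norm (\<alpha> * (cmod (?f n x))\<^sup>2) \<le> Re \<tau> * (cmod (?g n x))\<^sup>2 + Re (\<tau> * p x) * (cmod (?f n x))\<^sup>2"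
          if "0 < x" for x
        proof -
          have "\<alpha> * (cmod (?f n x))\<^sup>2 \<le> \<alpha> * ((cmod (?g n x))\<^sup>2 + (cmod (?f n x))\<^sup>2)"
            using \<alpha>_pos by (intro mult_left_mono) auto
          also have "\<dots> \<le> Re \<tau> * (cmod (?g n x))\<^sup>2 + Re (\<tau> * p x) * (cmod (?f n x))\<^sup>2"
            using that by (intro energy_derivative_ge) simp
          finally show ?thesis using \<alpha>_pos by (simp only: real_norm_def abs_mult abs_power2)
        qed
      qed (use b in auto)
      then show ?thesis by simp
    qed
    also have "energy \<tau> (?f n) (?g n) b \<le> energy \<tau> (?f n) (?g n) (real n)"
      by (rule energy_mono[OF fg]) (use b in auto)
    also have "\<dots> = 0" by (simp add: energy_def gn)
    also have "0 - energy \<tau> (?f n) (?g n) 0 \<le> cmod (\<tau> * m n)"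
      using abs_Re_le_cmod[of "\<tau> * m n"] u v by (simp add: energy_def)
    also have "\<dots> \<le> cmod \<tau> * K" by (simp add: norm_mult mK mult_left_mono)
    finally show ?thesis using \<alpha>_pos by (simp add: C_def field_simps)
  qed
  have "seq_compact (cball (0::complex) K)" by (simp add: compact_imp_seq_compact)
  then obtain l r where r: "strict_mono r" "(m \<circ> r) \<longlonglongrightarrow> l"
    using mK unfolding seq_compact_def by (metis mem_cball_0)
  have "integral {0..b} (\<lambda>t. (cmod (u t + l * v t))\<^sup>2) \<le> 2 * C + 2" if b: "0 \<le> b" for b
  proof -
    let ?V = "integral {0..b} (\<lambda>t. (cmod (v t))\<^sup>2)"
    have cu: "continuous_on {0..b} u" and cv: "continuous_on {0..b} v"
      using solves_continuous[OF u(1)] solves_continuous[OF v(1)] by (auto elim: continuous_on_subset)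
    have "(\<lambda>j. (cmod (l - (m \<circ> r) j))\<^sup>2 * ?V) \<longlonglongrightarrow> (cmod (l - l))\<^sup>2 * ?V"
      using r(2) by (intro tendsto_intros)
    then have "\<forall>\<^sub>F j in sequentially. (cmod (l - (m \<circ> r) j))\<^sup>2 * ?V < 1"
      by (rule order_tendstoD) simp
    moreover have "\<forall>\<^sub>F j in sequentially. b \<le> real j"
      using eventually_ge_at_top[of "nat \<lceil>b\<rceil>"] by eventually_elim linarith
    ultimately obtain j where j: "(cmod (l - m (r j)))\<^sup>2 * ?V < 1" "b \<le> real j"
      using eventually_happens'[OF sequentially_bot eventually_conj] by fastforce
    have jr: "b \<le> real (r j)" using j(2) seq_suble[OF r(1), of j] by linarith
    have "integral {0..b} (\<lambda>t. (cmod (u t + l * v t))\<^sup>2) \<le>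
        integral {0..b} (\<lambda>t. 2 * (cmod (?f (r j) t))\<^sup>2 + 2 * (cmod (l - m (r j)))\<^sup>2 * (cmod (v t))\<^sup>2)"
    proof (rule integral_le)
      fix t
      let ?a = "?f (r j) t" and ?b = "(l - m (r j)) * v t"
      have "cmod (u t + l * v t) = cmod (?a + ?b)" by (simp add: algebra_simps)
      then have "(cmod (u t + l * v t))\<^sup>2 \<le> (cmod ?a + cmod ?b)\<^sup>2"
        by (simp only:) (intro power_mono norm_triangle_ineq, simp)
      also have "\<dots> \<le> 2 * (cmod ?a)\<^sup>2 + 2 * (cmod ?b)\<^sup>2"
        using sum_squares_bound[of "cmod ?a" "cmod ?b"] by (simp add: power2_sum)
      finally show "(cmod (u t + l * v t))\<^sup>2 \<le> 2 * (cmod ?a)\<^sup>2 + 2 * (cmod (l - m (r j)))\<^sup>2 * (cmod (v t))\<^sup>2"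
        by (simp add: norm_mult power_mult_distrib)
    qed (use cu cv in \<open>auto intro!: integrable_continuous_real continuous_intros\<close>)
    also have "\<dots> = integral {0..b} (\<lambda>t. 2 * (cmod (?f (r j) t))\<^sup>2) +
        integral {0..b} (\<lambda>t. 2 * (cmod (l - m (r j)))\<^sup>2 * (cmod (v t))\<^sup>2)"
      by (rule integral_add) (use cu cv in \<open>auto intro!: integrable_continuous_real continuous_intros\<close>)
    also have "\<dots> = 2 * integral {0..b} (\<lambda>t. (cmod (?f (r j) t))\<^sup>2) + 2 * (cmod (l - m (r j)))\<^sup>2 * ?V"
      by simp
    also have "\<dots> \<le> 2 * C + 2" using fC[OF b jr] j(1) by (simp add: mult.assoc)
    finally show ?thesis .
  qed
  then show ?thesis
    using solves_linear_combination[OF u(1) v(1), of l] u v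
    by (intro exI[of _ "\<lambda>x. u x + l * v x"] exI[of _ "\<lambda>x. u' x + l * v' x"] exI[of _ "2 * C + 2"]) auto
qed

end

section \<open>The Titchmarsh--Weyl function as the slope of a decaying solution\<close>

lemma schroedinger_solution_imp_solves:
  assumes "schroedinger_solution q z \<psi>"
  shows "solves (\<lambda>x. of_real (q x) - z) \<psi> (hl_deriv \<psi>)"
  unfolding solves_def
proof (intro allI impI conjI)
  fix x :: real assume x: "0 \<le> x"
  show "(\<psi> has_vector_derivative hl_deriv \<psi> x) (at x within {0..})"
    using assms x by (intro hl_deriv_works) (auto simp: schroedinger_solution_def)
  have "(hl_deriv \<psi> has_vector_derivative hl_deriv (hl_deriv \<psi>) x) (at x within {0..})"
    using assms x by (intro hl_deriv_works) (auto simp: schroedinger_solution_def)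
  moreover have "- hl_deriv (hl_deriv \<psi>) x + of_real (q x) * \<psi> x = z * \<psi> x"
    using assms x by (auto simp: schroedinger_solution_def)
  then have "hl_deriv (hl_deriv \<psi>) x = (of_real (q x) - z) * \<psi> x"
    by (simp add: algebra_simps)
  ultimately show "(hl_deriv \<psi> has_vector_derivative (of_real (q x) - z) * \<psi> x) (at x within {0..})"
    by simp
qed

lemma solves_imp_schroedinger_solution:
  assumes "solves (\<lambda>x. of_real (q x) - z) f g"
  shows "schroedinger_solution q z f"
proof -
  have f: "(f has_vector_derivative g x) (at x within {0..})"
    and g: "(g has_vector_derivative (of_real (q x) - z) * f x) (at x within {0..})" if "0 \<le> x" for x
    using assms that by (auto simp: solves_def)
  have fg: "g x = hl_deriv f x" if "0 \<le> x" for x using hl_deriv_eq[OF f[OF that] that] by simp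
  have g': "(hl_deriv f has_vector_derivative (of_real (q x) - z) * f x) (at x within {0..})" if "0 \<le> x" for x
    by (rule has_vector_derivative_half_line_cong[OF g[OF that] that fg])
  show ?thesis
    unfolding schroedinger_solution_def differentiable_on_def
    using f g' hl_deriv_eq[OF g'] by (auto intro: differentiableI_vector simp: algebra_simps)
qed

text \<open>Existence and uniqueness of the decaying solution turn the definite description into the
  slope of an actual solution. At real points to the left of the spectrum the same formula supplies
  the candidate for the analytic continuation.\<close>

lemma weyl_m_nonreal_characterization:
  assumes "dissipative (\<lambda>x. of_real (q x) - z) \<tau> \<alpha> P"
  shows "\<exists>f g. solves (\<lambda>x. of_real (q x) - z) f g \<and> f 0 = 1 \<and>
    (f \<longlongrightarrow> 0) at_top \<and> (g \<longlongrightarrow> 0) at_top \<and> g 0 = weyl_m_nonreal q 0 z"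
proof -
  interpret dissipative "\<lambda>x. of_real (q x) - z" \<tau> \<alpha> P by fact
  obtain f g C where f: "solves (\<lambda>x. of_real (q x) - z) f g" "f 0 = 1"
    and C: "\<And>b. 0 \<le> b \<Longrightarrow> integral {0..b} (\<lambda>t. (cmod (f t))\<^sup>2) \<le> C"
    using square_integrable_solution_exists by blast
  note fd = solves_decay[OF f(1) p_bound C]
  have square: "continuous_on {0..} (\<lambda>x. (cmod (h x))\<^sup>2)" if "solves (\<lambda>x. of_real (q x) - z) h h'" for h h'
    using solves_continuous[OF that] by (intro continuous_intros)
  have hf: "hl_deriv f 0 = g 0"
    using f(1) by (intro hl_deriv_eq) (auto simp: solves_def)
  have "\<exists>a\<ge>0. set_integrable lborel {a..} (\<lambda>x. (cmod (f x))\<^sup>2)"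
    using C by (subst set_integrable_half_line_iff_bounded_integrals[OF square[OF f(1)]]) auto
  then have wf: "weyl_solution q z f"
    using solves_imp_schroedinger_solution[OF f(1)] f(2) by (auto simp: weyl_solution_def intro!: exI[of _ 0])
  have "weyl_m_nonreal q 0 z = g 0"
    unfolding weyl_m_nonreal_def
  proof (rule the_equality)
    show "\<exists>\<psi>. weyl_solution q z \<psi> \<and> g 0 = hl_deriv \<psi> 0 / \<psi> 0"
      using wf hf f(2) by (intro exI[of _ f]) auto
    fix w assume "\<exists>\<psi>. weyl_solution q z \<psi> \<and> w = hl_deriv \<psi> 0 / \<psi> 0"
    then obtain \<psi> where \<psi>: "weyl_solution q z \<psi>" "w = hl_deriv \<psi> 0 / \<psi> 0" by blast
    then have s: "solves (\<lambda>x. of_real (q x) - z) \<psi> (hl_deriv \<psi>)"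
      by (intro schroedinger_solution_imp_solves) (auto simp: weyl_solution_def)
    have "\<exists>C. \<forall>b\<ge>0. integral {0..b} (\<lambda>x. (cmod (\<psi> x))\<^sup>2) \<le> C"
      using \<psi>(1) by (subst set_integrable_half_line_iff_bounded_integrals[OF square[OF s], symmetric])
        (auto simp: weyl_solution_def)
    then obtain C' where C': "\<And>b. 0 \<le> b \<Longrightarrow> integral {0..b} (\<lambda>x. (cmod (\<psi> x))\<^sup>2) \<le> C'" by blast
    note d = solves_decay[OF s p_bound C']
    obtain y where y: "0 \<le> y" "\<psi> y \<noteq> 0" using \<psi>(1) by (auto simp: weyl_solution_def)
    then have "\<psi> 0 \<noteq> 0" using decaying_zero[OF s d _ y(1)] by blast
    moreover have "\<psi> 0 * g 0 = hl_deriv \<psi> 0 * f 0" by (rule decaying_unique[OF s d f(1) fd])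
    ultimately show "w = g 0"
      using \<psi>(2) f(2) by (metis mult.right_neutral nonzero_mult_div_cancel_left)
  qed
  then show ?thesis using f fd by auto
qed

context
  fixes q :: "real \<Rightarrow> real" and Q :: real
  assumes q_continuous: "continuous_on {0..} q" and q_bound: "\<And>x. 0 \<le> x \<Longrightarrow> \<bar>q x\<bar> \<le> Q"
begin

lemma norm_potential_le:
  assumes "0 \<le> x" shows "cmod (of_real (q x) - z) \<le> Q + cmod z"
  using norm_triangle_ineq4[of "of_real (q x)" z] q_bound[OF assms] by simp

lemma dissipative_far_left:
  assumes "Re z < - (Q + 1)"
  shows "dissipative (\<lambda>x. of_real (q x) - z) 1 1 (Q + cmod z)"
proof
  show "continuous_on {0..} (\<lambda>x. complex_of_real (q x) - z)"
    using q_continuous by (intro continuous_intros)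
  show "1 \<le> Re (1 * (complex_of_real (q x) - z))" if "0 \<le> x" for x
    using assms q_bound[OF that] by simp
qed (use norm_potential_le in auto)

lemma dissipative_right_half_plane:
  assumes "Re k > 0" "(cmod k)\<^sup>2 \<ge> Q + 1"
  shows "dissipative (\<lambda>x. of_real (q x) - (- (k\<^sup>2))) (cnj k) (Re k) (Q + (cmod k)\<^sup>2)"
proof
  show "continuous_on {0..} (\<lambda>x. complex_of_real (q x) - (- (k\<^sup>2)))"
    using q_continuous by (intro continuous_intros)
  show "cmod (complex_of_real (q x) - (- (k\<^sup>2))) \<le> Q + (cmod k)\<^sup>2" if "0 \<le> x" for x
    using norm_potential_le[OF that, of "- (k\<^sup>2)"] by (simp add: norm_power)
  show "Re k \<le> Re (cnj k * (complex_of_real (q x) - (- (k\<^sup>2))))" if "0 \<le> x" for x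
  proof -
    have "Re (cnj k * (complex_of_real (q x) - (- (k\<^sup>2)))) = Re k * (q x + (cmod k)\<^sup>2)"
      unfolding cmod_power2 by (simp add: power2_eq_square algebra_simps)
    moreover have "Re k * 1 \<le> Re k * (q x + (cmod k)\<^sup>2)"
      using assms q_bound[OF that] by (intro mult_left_mono) auto
    ultimately show ?thesis by simp
  qed
qed (use assms in auto)

text \<open>Let \<open>f\<close> and \<open>h\<close> be the normalized decaying solutions at \<open>z\<close> and \<open>w\<close>. Their Wronskian is the increment of the
  slope at \<open>0\<close> and has derivative \<open>(z - w) f h\<close>; so the increment is \<open>(w - z)\<close> times the integral of \<open>f h\<close>,
  and \<open>D\<close> is the integral of \<open>f\<^sup>2\<close>. The difference \<open>u = h - f\<close> solves the equation at \<open>z\<close> with right-hand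
  side \<open>(z - w) h\<close> and \<open>u(0) = 0\<close>, whence its square integral is of order \<open>|w - z|\<^sup>2\<close>. All integrals are
  bounded by differences of energies.\<close>

lemma weyl_m_nonreal_increment:
  assumes z: "Re z < - (Q + 1)"
  shows "\<exists>D. \<forall>w. Re w < - (Q + 1) \<longrightarrow>
    cmod (weyl_m_nonreal q 0 w - weyl_m_nonreal q 0 z - (w - z) * D) \<le>
      (cmod (w - z))\<^sup>2 * ((2 * Q + cmod z + cmod w) / 2)"
proof -
  let ?p = "\<lambda>z x. of_real (q x) - z :: complex"
  interpret Z: dissipative "?p z" 1 1 "Q + cmod z" by (rule dissipative_far_left[OF z])
  obtain f g where f: "solves (?p z) f g" "f 0 = 1" and fd: "(f \<longlongrightarrow> 0) at_top" "(g \<longlongrightarrow> 0) at_top"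
    and g0: "g 0 = weyl_m_nonreal q 0 z"
    using weyl_m_nonreal_characterization[OF dissipative_far_left[OF z]] by blast
  define A where "A x = integral {0..x} (\<lambda>t. (f t)\<^sup>2)" for x
  have A': "(A has_vector_derivative (f x)\<^sup>2) (at x within {0..})" if "0 \<le> x" for x
    unfolding A_def by (rule integral_half_line_has_vector_derivative)
      (use that solves_continuous[OF f(1)] in \<open>auto intro!: continuous_intros\<close>)
  have A_inc: "cmod (A b - A a) \<le> energy 1 f g b - energy 1 f g a" if "0 \<le> a" "a \<le> b" for a b
  proof (rule norm_increment_le_half_line[OF that A' energy_solves_has_vector_derivative[OF f(1)]])
    fix x :: real assume "a < x"
    then have "1 * ((cmod (g x))\<^sup>2 + (cmod (f x))\<^sup>2) \<le> Re 1 * (cmod (g x))\<^sup>2 + Re (1 * ?p z x) * (cmod (f x))\<^sup>2"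
      using that by (intro Z.energy_derivative_ge) auto
    moreover have "(cmod (f x))\<^sup>2 \<le> 1 * ((cmod (g x))\<^sup>2 + (cmod (f x))\<^sup>2)" by simp
    ultimately show "cmod ((f x)\<^sup>2) \<le> Re 1 * (cmod (g x))\<^sup>2 + Re (1 * ?p z x) * (cmod (f x))\<^sup>2"
      unfolding norm_power by linarith
  qed auto
  have seq: "filterlim real at_top sequentially" by (rule filterlim_real_sequentially)
  have "Cauchy (\<lambda>n. energy 1 f g (real n))"
    by (rule LIMSEQ_imp_Cauchy[OF filterlim_compose[OF Z.energy_tendsto_zero[OF fd] seq]])
  then have "Cauchy (\<lambda>n. A (real n))"
    unfolding Cauchy_altdef2
  proof -
    assume E: "\<forall>e>0. \<exists>N. \<forall>n\<ge>N. dist (energy 1 f g (real n)) (energy 1 f g (real N)) < e"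
    show "\<forall>e>0. \<exists>N. \<forall>n\<ge>N. dist (A (real n)) (A (real N)) < e"
    proof (intro allI impI)
      fix e :: real assume "e > 0"
      then obtain N where N: "\<And>n. N \<le> n \<Longrightarrow> dist (energy 1 f g (real n)) (energy 1 f g (real N)) < e"
        using E by blast
      have "dist (A (real n)) (A (real N)) < e" if "N \<le> n" for n
        using A_inc[of "real N" "real n"] N[OF that] that by (simp add: dist_norm)
      then show "\<exists>N. \<forall>n\<ge>N. dist (A (real n)) (A (real N)) < e" by blast
    qed
  qed
  then obtain D where D: "(\<lambda>n. A (real n)) \<longlonglongrightarrow> D"
    using Cauchy_convergent convergent_def by blast
  have "cmod (weyl_m_nonreal q 0 w - weyl_m_nonreal q 0 z - (w - z) * D) \<le>
      (cmod (w - z))\<^sup>2 * ((2 * Q + cmod z + cmod w) / 2)" if w: "Re w < - (Q + 1)" for w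
  proof -
    interpret W: dissipative "?p w" 1 1 "Q + cmod w" by (rule dissipative_far_left[OF w])
    obtain h h' where h: "solves (?p w) h h'" "h 0 = 1" and hd: "(h \<longlongrightarrow> 0) at_top" "(h' \<longlongrightarrow> 0) at_top"
      and h0: "h' 0 = weyl_m_nonreal q 0 w"
      using weyl_m_nonreal_characterization[OF dissipative_far_left[OF w]] by blast
    define d where "d = cmod (w - z)"
    define u where "u x = h x - f x" for x
    define u' where "u' x = h' x - g x" for x
    define V where "V x = wronskian f g h h' x + (w - z) * A x" for x
    \<comment> \<open>The derivative of \<open>V\<close> is at most \<open>(d\<^sup>2 |f|\<^sup>2 + |u|\<^sup>2) / 2\<close>, and the equation for \<open>u\<close> bounds \<open>|u|\<^sup>2\<close> by twice
    the derivative of the energy of \<open>u\<close> plus \<open>d\<^sup>2 |h|\<^sup>2\<close>; the weights in \<open>\<phi>\<close> collect these terms.\<close>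
    define \<phi> where "\<phi> x = (d\<^sup>2 * energy 1 f g x + 2 * energy 1 u u' x + d\<^sup>2 * energy 1 h h' x) / 2" for x
    define e\<^sub>z where "e\<^sub>z x = Re 1 * (cmod (g x))\<^sup>2 + Re (1 * ?p z x) * (cmod (f x))\<^sup>2" for x
    define e\<^sub>w where "e\<^sub>w x = Re 1 * (cmod (h' x))\<^sup>2 + Re (1 * ?p w x) * (cmod (h x))\<^sup>2" for x
    define e\<^sub>u where "e\<^sub>u x = Re 1 * (cmod (u' x))\<^sup>2 + Re (1 * (?p w x * h x - ?p z x * f x) * cnj (u x))" for x
    have V': "(V has_vector_derivative (w - z) * (f x * (f x - h x))) (at x within {0..})" if x: "0 \<le> x" for x
    proof -
      have "(V has_vector_derivative (?p w x - ?p z x) * (f x * h x) + (w - z) * (f x)\<^sup>2) (at x within {0..})"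
        unfolding V_def[abs_def] using x
        by (intro has_vector_derivative_add has_vector_derivative_mult_right A' wronskian_has_vector_derivative f h)
      then show ?thesis
        by (rule has_vector_derivative_eq_rhs) (simp add: algebra_simps power2_eq_square)
    qed
    have \<phi>': "(\<phi> has_vector_derivative (d\<^sup>2 * e\<^sub>z x + 2 * e\<^sub>u x + d\<^sup>2 * e\<^sub>w x) / 2) (at x within {0..})"
      if x: "0 \<le> x" for x
    proof -
      have "(energy 1 u u' has_vector_derivative e\<^sub>u x) (at x within {0..})"
        unfolding e\<^sub>u_def
        using f(1) h(1) x unfolding u_def[abs_def] u'_def[abs_def]
        by (intro energy_has_vector_derivative has_vector_derivative_diff) (auto simp: solves_def)
      then show ?thesis
        unfolding \<phi>_def[abs_def]
        using energy_solves_has_vector_derivative[OF f(1) x, of 1] energy_solves_has_vector_derivative[OF h(1) x, of 1]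
        by (intro has_vector_derivative_divide has_vector_derivative_add has_vector_derivative_mult_right)
          (auto simp: e\<^sub>z_def e\<^sub>w_def)
    qed
    have le: "cmod ((w - z) * (f x * (f x - h x))) \<le> (d\<^sup>2 * e\<^sub>z x + 2 * e\<^sub>u x + d\<^sup>2 * e\<^sub>w x) / 2"
      if x: "0 \<le> x" for x
    proof -
      have ez: "(cmod (f x))\<^sup>2 \<le> e\<^sub>z x"
        using Z.energy_derivative_ge[OF x, of "g x" "f x"] unfolding e\<^sub>z_def by (smt (verit) zero_le_power2 mult_1)
      have ew: "(cmod (h x))\<^sup>2 \<le> e\<^sub>w x"
        using W.energy_derivative_ge[OF x, of "h' x" "h x"] unfolding e\<^sub>w_def by (smt (verit) zero_le_power2 mult_1)
      have pw: "?p w x * h x - ?p z x * f x = ?p z x * u x - (w - z) * h x"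
        by (simp add: u_def algebra_simps)
      have "e\<^sub>u x = Re 1 * (cmod (u' x))\<^sup>2 + Re (1 * ?p z x) * (cmod (u x))\<^sup>2 - Re ((w - z) * h x * cnj (u x))"
        unfolding e\<^sub>u_def pw cmod_power2 by (simp add: algebra_simps power2_eq_square)
      moreover have "(cmod (u' x))\<^sup>2 + (cmod (u x))\<^sup>2 \<le> Re 1 * (cmod (u' x))\<^sup>2 + Re (1 * ?p z x) * (cmod (u x))\<^sup>2"
        using Z.energy_derivative_ge[OF x, of "u' x" "u x"] by simp
      moreover have "Re ((w - z) * h x * cnj (u x)) \<le> d * cmod (h x) * cmod (u x)"
        using complex_Re_le_cmod[of "(w - z) * h x * cnj (u x)"] by (simp add: norm_mult d_def)
      moreover have "2 * (d * cmod (h x) * cmod (u x)) \<le> d\<^sup>2 * (cmod (h x))\<^sup>2 + (cmod (u x))\<^sup>2"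
        using sum_squares_bound[of "d * cmod (h x)" "cmod (u x)"] by (simp add: power_mult_distrib)
      ultimately have "(cmod (u x))\<^sup>2 \<le> 2 * e\<^sub>u x + d\<^sup>2 * (cmod (h x))\<^sup>2"
        using zero_le_power2[of "cmod (u' x)"] by linarith
      also have "\<dots> \<le> 2 * e\<^sub>u x + d\<^sup>2 * e\<^sub>w x" using ew by (simp add: mult_left_mono)
      finally have eu: "(cmod (u x))\<^sup>2 \<le> 2 * e\<^sub>u x + d\<^sup>2 * e\<^sub>w x" .
      have "cmod ((w - z) * (f x * (f x - h x))) = d * cmod (f x) * cmod (u x)"
        by (simp add: norm_mult d_def u_def norm_minus_commute)
      also have "\<dots> \<le> (d\<^sup>2 * (cmod (f x))\<^sup>2 + (cmod (u x))\<^sup>2) / 2"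
        using sum_squares_bound[of "d * cmod (f x)" "cmod (u x)"] by (simp add: power_mult_distrib)
      also have "\<dots> \<le> (d\<^sup>2 * e\<^sub>z x + (2 * e\<^sub>u x + d\<^sup>2 * e\<^sub>w x)) / 2"
        using ez eu by (intro divide_right_mono add_mono mult_left_mono) auto
      finally show ?thesis by (simp add: add.assoc)
    qed
    have bound: "cmod (V (real n) - V 0) \<le> \<phi> (real n) - \<phi> 0" for n
      by (rule norm_increment_le_half_line[OF _ _ V' \<phi>']) (use le in auto)
    have ud: "(u \<longlongrightarrow> 0) at_top" "(u' \<longlongrightarrow> 0) at_top"
      unfolding u_def[abs_def] u'_def[abs_def]
      using tendsto_diff[OF hd(1) fd(1)] tendsto_diff[OF hd(2) fd(2)] by simp_all
    have "((\<lambda>x. (d\<^sup>2 * energy 1 f g x + 2 * energy 1 u u' x + d\<^sup>2 * energy 1 h h' x) / 2) \<longlongrightarrow>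
        (d\<^sup>2 * 0 + 2 * 0 + d\<^sup>2 * 0) / 2) at_top"
      by (intro tendsto_intros Z.energy_tendsto_zero fd hd ud) simp
    then have "(\<phi> \<longlongrightarrow> 0) at_top" unfolding \<phi>_def[abs_def] by (simp only: mult_zero_right add_0_left div_0)
    note \<phi>lim = filterlim_compose[OF this seq]
    have "((\<lambda>x. f x * h' x - g x * h x) \<longlongrightarrow> 0 * 0 - 0 * 0) at_top"
      by (intro tendsto_intros fd hd)
    then have "(wronskian f g h h' \<longlongrightarrow> 0) at_top"
      unfolding wronskian_def[abs_def] by (simp only: mult_zero_right diff_0_right)
    note wlim = filterlim_compose[OF this seq]
    have Vlim: "(\<lambda>n. V (real n)) \<longlonglongrightarrow> 0 + (w - z) * D"
      unfolding V_def by (intro tendsto_intros D wlim)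
    have "cmod (0 + (w - z) * D - V 0) \<le> 0 - \<phi> 0"
      by (rule LIMSEQ_le[OF tendsto_norm[OF tendsto_diff[OF Vlim tendsto_const]] tendsto_diff[OF \<phi>lim tendsto_const]])
        (use bound in auto)
    moreover have "V 0 = weyl_m_nonreal q 0 w - weyl_m_nonreal q 0 z"
      by (simp add: V_def wronskian_def A_def f h g0 h0)
    moreover have "- \<phi> 0 \<le> d\<^sup>2 * ((2 * Q + cmod z + cmod w) / 2)"
    proof -
      have "cmod (g 0) \<le> Q + cmod z" using Z.decaying_slope_bound[OF f(1) fd f(2)] by simp
      moreover have "cmod (h' 0) \<le> Q + cmod w" using W.decaying_slope_bound[OF h(1) hd h(2)] by simp
      ultimately have "- Re (g 0) - Re (h' 0) \<le> 2 * Q + cmod z + cmod w"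
        using abs_Re_le_cmod[of "g 0"] abs_Re_le_cmod[of "h' 0"] by linarith
      then have "d\<^sup>2 * (- Re (g 0) - Re (h' 0)) \<le> d\<^sup>2 * (2 * Q + cmod z + cmod w)"
        by (intro mult_left_mono) auto
      moreover have "- \<phi> 0 = d\<^sup>2 * (- Re (g 0) - Re (h' 0)) / 2"
        by (simp add: \<phi>_def energy_def u_def f h algebra_simps)
      ultimately show ?thesis by simp
    qed
    ultimately show ?thesis by (simp add: d_def norm_minus_commute)
  qed
  then show ?thesis by blast
qed

lemma weyl_m_nonreal_holomorphic:
  "weyl_m_nonreal q 0 holomorphic_on {z. Re z < - (Q + 1)}"
proof -
  have op: "open {z. Re z < - (Q + 1)}" by (rule open_halfspace_Re_lt)
  have "\<exists>D. (weyl_m_nonreal q 0 has_field_derivative D) (at z)" if z: "Re z < - (Q + 1)" for z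
  proof -
    obtain D where D: "\<And>w. Re w < - (Q + 1) \<Longrightarrow>
      cmod (weyl_m_nonreal q 0 w - weyl_m_nonreal q 0 z - (w - z) * D) \<le>
        (cmod (w - z))\<^sup>2 * ((2 * Q + cmod z + cmod w) / 2)"
      using weyl_m_nonreal_increment[OF z] by blast
    have ev: "\<forall>\<^sub>F w in at z. w \<in> {z. Re z < - (Q + 1)}"
      using op z by (intro eventually_at_in_open') auto
    have ev': "\<forall>\<^sub>F w in at z. w \<in> ball z 1"
      by (intro eventually_at_in_open') auto
    have "\<forall>\<^sub>F w in at z. cmod (weyl_m_nonreal q 0 w - weyl_m_nonreal q 0 z - (w - z) * D) \<le>
        (Q + cmod z + 1 / 2) * (cmod (w - z))\<^sup>2"
      using ev ev'
    proof eventually_elim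
      case (elim w)
      have "cmod w \<le> cmod z + 1"
        using elim(2) norm_triangle_ineq2[of w z] by (simp add: dist_norm norm_minus_commute)
      then have "(cmod (w - z))\<^sup>2 * ((2 * Q + cmod z + cmod w) / 2) \<le> (cmod (w - z))\<^sup>2 * (Q + cmod z + 1 / 2)"
        by (intro mult_left_mono) auto
      with D[of w] elim show ?case by (simp add: mult.commute)
    qed
    then show ?thesis using has_field_derivative_of_quadratic_error by blast
  qed
  then show ?thesis
    by (auto simp: holomorphic_on_def field_differentiable_def intro: has_field_derivative_at_within)
qed

text \<open>Any analytic continuation agrees with the slope function at the points \<open>z + \<i> / n\<close>, hence by
  continuity at \<open>z\<close>.\<close>

lemma weyl_m_eq_weyl_m_nonreal:
  assumes "Im z \<noteq> 0 \<or> Re z < - (Q + 1)"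
  shows "weyl_m q 0 z = weyl_m_nonreal q 0 z"
proof (cases "Im z = 0")
  case True
  with assms have z: "Re z < - (Q + 1)" by simp
  let ?M = "weyl_m_nonreal q 0"
  have an: "?M analytic_on {z}"
    by (rule analytic_on_subset[of _ "{z. Re z < - (Q + 1)}"])
      (use z weyl_m_nonreal_holomorphic in \<open>auto simp: analytic_on_open open_halfspace_Re_lt\<close>)
  have "(THE w. \<exists>f. f analytic_on {z} \<and> (\<forall>\<^sub>F u in at z. Im u \<noteq> 0 \<longrightarrow> f u = ?M u) \<and> w = f z) = ?M z"
  proof (rule the_equality)
    show "\<exists>f. f analytic_on {z} \<and> (\<forall>\<^sub>F u in at z. Im u \<noteq> 0 \<longrightarrow> f u = ?M u) \<and> ?M z = f z"
      using an by auto
    fix w assume "\<exists>f. f analytic_on {z} \<and> (\<forall>\<^sub>F u in at z. Im u \<noteq> 0 \<longrightarrow> f u = ?M u) \<and> w = f z"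
    then obtain f where f: "f analytic_on {z}" "\<forall>\<^sub>F u in at z. Im u \<noteq> 0 \<longrightarrow> f u = ?M u" "w = f z" by blast
    have lim: "((\<lambda>n. z + \<i> / of_nat (Suc n)) \<longlongrightarrow> z + 0) sequentially"
      by (intro tendsto_add tendsto_const lim_const_over_n[THEN LIMSEQ_Suc])
    then have at: "filterlim (\<lambda>n. z + \<i> / of_nat (Suc n)) (at z) sequentially"
      by (auto simp: filterlim_at simp del: of_nat_Suc)
    have c: "isCont f z" "isCont ?M z"
      using f(1) an by (auto intro: analytic_at_imp_isCont)
    have lim': "(\<lambda>n. z + \<i> / of_nat (Suc n)) \<longlonglongrightarrow> z" using lim by (simp only: add_0_right)
    note l1 = isCont_tendsto_compose[OF c(1) lim'] and l2 = isCont_tendsto_compose[OF c(2) lim']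
    have ev: "\<forall>\<^sub>F n in sequentially. f (z + \<i> / of_nat (Suc n)) = ?M (z + \<i> / of_nat (Suc n))"
      using filterlim_iff[THEN iffD1, OF at, rule_format, OF f(2)]
    proof eventually_elim
      case (elim n)
      have "Im (\<i> / of_nat (Suc n)) = 1 / real (Suc n)" by (simp add: Im_divide_of_nat del: of_nat_Suc)
      then show ?case using elim True by (simp del: of_nat_Suc)
    qed
    have "f z = ?M z"
      by (rule LIMSEQ_unique[OF Lim_transform_eventually[OF l1 ev] l2])
    then show "w = ?M z" using f(3) by simp
  qed
  then show ?thesis using True by (simp add: weyl_m_def)
qed (simp add: weyl_m_def)

end

section \<open>Differential polynomials and the Riccati coefficients\<close>

lemma diff_poly_eq_sum_monomials:
  "p = (\<Sum>m\<in>Poly_Mapping.keys p. Poly_Mapping.single m (Poly_Mapping.lookup p m))"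
  by (rule poly_mapping_eqI) (auto simp: lookup_sum lookup_single when_def in_keys_iff)

text \<open>Evaluation is multiplicative on monomials; the general case follows by expanding both
  factors into monomials.\<close>

lemma dp_eval_mult: "dp_eval (p * p') v = dp_eval p v * dp_eval p' v"
proof -
  have "p * p' = (\<Sum>m\<in>Poly_Mapping.keys p. \<Sum>m'\<in>Poly_Mapping.keys p'.
      Poly_Mapping.single (m + m') (Poly_Mapping.lookup p m * Poly_Mapping.lookup p' m'))"
    by (subst diff_poly_eq_sum_monomials[of p], subst diff_poly_eq_sum_monomials[of p'])
      (simp add: sum_product mult_single)
  then have "dp_eval (p * p') v = (\<Sum>m\<in>Poly_Mapping.keys p. \<Sum>m'\<in>Poly_Mapping.keys p'.
      (Poly_Mapping.lookup p m * mono_eval m v) * (Poly_Mapping.lookup p' m' * mono_eval m' v))"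
    by (simp only: dp_eval_sum dp_eval_single mono_eval_plus mult_ac)
  also have "\<dots> = dp_eval p v * dp_eval p' v" by (simp only: dp_eval_def sum_product)
  finally show ?thesis .
qed

lemma dp_eval_const: "dp_eval (dp_const a) v = a"
  by (simp add: dp_const_def dp_eval_single)

lemma dp_eval_var: "dp_eval (dp_var i) v = v i"
  by (simp add: dp_var_def dp_eval_single)

definition vars_below :: "nat \<Rightarrow> diff_poly \<Rightarrow> bool" where
  "vars_below d p \<longleftrightarrow> (\<forall>m\<in>Poly_Mapping.keys p. Poly_Mapping.keys m \<subseteq> {..<d})"

lemma vars_below_mono: "vars_below d p \<Longrightarrow> d \<le> d' \<Longrightarrow> vars_below d' p"
  by (fastforce simp: vars_below_def)

lemma vars_below_add: "vars_below d p \<Longrightarrow> vars_below d p' \<Longrightarrow> vars_below d (p + p')"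
  using keys_add[of p p'] by (auto simp: vars_below_def)

lemma vars_below_sum: "(\<And>a. a \<in> A \<Longrightarrow> vars_below d (f a)) \<Longrightarrow> vars_below d (sum f A)"
  by (induction A rule: infinite_finite_induct) (auto simp: vars_below_add, auto simp: vars_below_def)

lemma vars_below_mult:
  assumes "vars_below d p" "vars_below d p'" shows "vars_below d (p * p')"
  unfolding vars_below_def
proof
  fix m assume "m \<in> Poly_Mapping.keys (p * p')"
  then obtain a b where "m = a + b" "a \<in> Poly_Mapping.keys p" "b \<in> Poly_Mapping.keys p'"
    using keys_mult[of p p'] by blast
  then show "Poly_Mapping.keys m \<subseteq> {..<d}"
    using keys_add[of a b] assms by (fastforce simp: vars_below_def)
qed

lemma vars_below_const: "vars_below d (dp_const a)"
  by (simp add: vars_below_def dp_const_def)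

lemma vars_below_var: "i < d \<Longrightarrow> vars_below d (dp_var i)"
  by (simp add: vars_below_def dp_var_def)

lemma vars_below_deriv:
  assumes p: "vars_below d p" shows "vars_below (Suc d) (dp_deriv p)"
  unfolding dp_deriv_def
proof (intro vars_below_sum)
  fix m i assume m: "m \<in> Poly_Mapping.keys p" and i: "i \<in> Poly_Mapping.keys m"
  have d: "Poly_Mapping.keys m \<subseteq> {..<d}" using p m by (simp add: vars_below_def)
  have "Poly_Mapping.keys (m - Poly_Mapping.single i 1 + Poly_Mapping.single (Suc i) 1) \<subseteq>
      Poly_Mapping.keys (m - Poly_Mapping.single i 1) \<union> {Suc i}"
    using keys_add[of "m - Poly_Mapping.single i 1" "Poly_Mapping.single (Suc i) 1"] by simp
  also have "Poly_Mapping.keys (m - Poly_Mapping.single i 1) \<subseteq> Poly_Mapping.keys m"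
    by (auto simp: in_keys_iff lookup_minus)
  also have "Poly_Mapping.keys m \<union> {Suc i} \<subseteq> {..<Suc d}" using d i by fastforce
  finally show "vars_below (Suc d) (Poly_Mapping.single
      (m - Poly_Mapping.single i 1 + Poly_Mapping.single (Suc i) 1)
      (Poly_Mapping.lookup p m * of_nat (Poly_Mapping.lookup m i)))"
    by (auto simp: vars_below_def)
qed

text \<open>The coefficients \<open>c\<^sub>j\<close> for \<open>j \<ge> 1\<close>; the index \<open>0\<close> is a dummy.\<close>

fun riccati_coeff :: "nat \<Rightarrow> diff_poly" where
  "riccati_coeff 0 = 0"
| "riccati_coeff (Suc 0) = dp_const (- 1 / 2) * dp_var 0"
| "riccati_coeff (Suc (Suc j)) = dp_const (1 / 2) * (dp_deriv (riccati_coeff (Suc j)) +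
     (\<Sum>l = 1..j. riccati_coeff l * riccati_coeff (Suc j - l)))"

text \<open>This counts derivatives: \<open>c\<^sub>j\<close> involves \<open>q\<close> up to order \<open>j - 1\<close>, so for \<open>q\<close> with \<open>N\<close> bounded weak derivatives
  \<open>c\<^sub>1, \<dots>, c\<^sub>N\<^sub>-\<^sub>1\<close> are differentiable and \<open>c\<^sub>N\<close> is Lipschitz.\<close>

lemma riccati_coeff_vars_below: "vars_below j (riccati_coeff j)"
proof (induction j rule: riccati_coeff.induct)
  case 1 show ?case by (simp add: vars_below_def)
next
  case 2 show ?case by (auto intro!: vars_below_mult vars_below_const vars_below_var)
next
  case (3 j)
  have "vars_below (Suc (Suc j)) (riccati_coeff l * riccati_coeff (Suc j - l))" if l: "l \<in> {1..j}" for l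
    using 3(2)[OF l] 3(3)[OF l] l by (intro vars_below_mult) (auto elim: vars_below_mono)
  then show ?case
    unfolding riccati_coeff.simps using vars_below_deriv[OF 3(1)]
    by (intro vars_below_mult[OF vars_below_const] vars_below_add vars_below_sum) auto
qed

lemma riccati_coeff_at_recursion:
  assumes "1 \<le> j"
  shows "2 * dp_at (riccati_coeff (j + 1)) q x = dp_at (dp_deriv (riccati_coeff j)) q x +
    (\<Sum>l = 1..j - 1. dp_at (riccati_coeff l) q x * dp_at (riccati_coeff (j - l)) q x)"
  using assms by (cases j) (simp_all add: dp_at_def dp_eval_mult dp_eval_add dp_eval_sum dp_eval_const)

lemma riccati_coeff_at_1: "2 * dp_at (riccati_coeff 1) q x = - q x"
  by (simp add: dp_at_def dp_eval_mult dp_eval_const dp_eval_var)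

text \<open>The regularity of the highest classical derivative of a function with bounded weak derivatives; it
  is inherited by differential polynomials because it is stable under products.\<close>

definition bounded_lipschitz :: "(real \<Rightarrow> real) \<Rightarrow> bool" where
  "bounded_lipschitz f \<longleftrightarrow> (\<exists>B. \<forall>x\<ge>0. \<bar>f x\<bar> \<le> B \<and> (\<forall>y\<ge>0. \<bar>f x - f y\<bar> \<le> B * \<bar>x - y\<bar>))"

lemma bounded_lipschitzD:
  assumes "bounded_lipschitz f"
  shows "\<exists>B. 0 \<le> B \<and> (\<forall>x\<ge>0. \<bar>f x\<bar> \<le> B) \<and> (\<forall>x\<ge>0. \<forall>y\<ge>0. \<bar>f x - f y\<bar> \<le> B * \<bar>x - y\<bar>)"
proof -
  obtain B where B: "\<forall>x\<ge>0. \<bar>f x\<bar> \<le> B \<and> (\<forall>y\<ge>0. \<bar>f x - f y\<bar> \<le> B * \<bar>x - y\<bar>)"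
    using assms unfolding bounded_lipschitz_def by blast
  have "\<bar>f 0\<bar> \<le> B" using B[rule_format, of 0] by simp
  then have "0 \<le> B" by linarith
  then show ?thesis using B by (intro exI[of _ B]) auto
qed

lemma bounded_lipschitz_const: "bounded_lipschitz (\<lambda>_. a)"
  unfolding bounded_lipschitz_def by (rule exI[of _ "\<bar>a\<bar>"]) simp

lemma bounded_lipschitz_add:
  assumes "bounded_lipschitz f" "bounded_lipschitz g" shows "bounded_lipschitz (\<lambda>x. f x + g x)"
proof -
  obtain B where B: "0 \<le> B" "\<And>x. 0 \<le> x \<Longrightarrow> \<bar>f x\<bar> \<le> B"
    "\<And>x y. 0 \<le> x \<Longrightarrow> 0 \<le> y \<Longrightarrow> \<bar>f x - f y\<bar> \<le> B * \<bar>x - y\<bar>"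
    using bounded_lipschitzD[OF assms(1)] by blast
  obtain C where C: "0 \<le> C" "\<And>x. 0 \<le> x \<Longrightarrow> \<bar>g x\<bar> \<le> C"
    "\<And>x y. 0 \<le> x \<Longrightarrow> 0 \<le> y \<Longrightarrow> \<bar>g x - g y\<bar> \<le> C * \<bar>x - y\<bar>"
    using bounded_lipschitzD[OF assms(2)] by blast
  have "\<bar>f x + g x\<bar> \<le> B + C" if "0 \<le> x" for x
    using B(2)[OF that] C(2)[OF that] by linarith
  moreover have "\<bar>(f x + g x) - (f y + g y)\<bar> \<le> (B + C) * \<bar>x - y\<bar>" if "0 \<le> x" "0 \<le> y" for x y
    unfolding distrib_right using B(3)[OF that] C(3)[OF that] by linarith
  ultimately show ?thesis unfolding bounded_lipschitz_def by blast
qed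

lemma bounded_lipschitz_mult:
  assumes "bounded_lipschitz f" "bounded_lipschitz g" shows "bounded_lipschitz (\<lambda>x. f x * g x)"
proof -
  obtain B where B: "0 \<le> B" "\<And>x. 0 \<le> x \<Longrightarrow> \<bar>f x\<bar> \<le> B"
    "\<And>x y. 0 \<le> x \<Longrightarrow> 0 \<le> y \<Longrightarrow> \<bar>f x - f y\<bar> \<le> B * \<bar>x - y\<bar>"
    using bounded_lipschitzD[OF assms(1)] by blast
  obtain C where C: "0 \<le> C" "\<And>x. 0 \<le> x \<Longrightarrow> \<bar>g x\<bar> \<le> C"
    "\<And>x y. 0 \<le> x \<Longrightarrow> 0 \<le> y \<Longrightarrow> \<bar>g x - g y\<bar> \<le> C * \<bar>x - y\<bar>"
    using bounded_lipschitzD[OF assms(2)] by blast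
  have "\<bar>f x * g x\<bar> \<le> 2 * B * C" if "0 \<le> x" for x
  proof -
    have "\<bar>f x\<bar> * \<bar>g x\<bar> \<le> B * C" using B C that by (intro mult_mono) auto
    moreover have "0 \<le> B * C" using B C by simp
    ultimately show ?thesis by (simp add: abs_mult)
  qed
  moreover have "\<bar>f x * g x - f y * g y\<bar> \<le> 2 * B * C * \<bar>x - y\<bar>" if xy: "0 \<le> x" "0 \<le> y" for x y
  proof -
    have "f x * g x - f y * g y = f x * (g x - g y) + (f x - f y) * g y" by (simp add: algebra_simps)
    then have "\<bar>f x * g x - f y * g y\<bar> \<le> \<bar>f x\<bar> * \<bar>g x - g y\<bar> + \<bar>f x - f y\<bar> * \<bar>g y\<bar>"
      by (metis abs_mult abs_triangle_ineq)
    also have "\<dots> \<le> B * (C * \<bar>x - y\<bar>) + (B * \<bar>x - y\<bar>) * C"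
      using B C xy by (intro add_mono mult_mono) auto
    finally show ?thesis by (simp add: algebra_simps)
  qed
  ultimately show ?thesis unfolding bounded_lipschitz_def by blast
qed

lemma bounded_lipschitz_power: "bounded_lipschitz f \<Longrightarrow> bounded_lipschitz (\<lambda>x. f x ^ n)"
  by (induction n) (auto intro: bounded_lipschitz_const bounded_lipschitz_mult)

lemma bounded_lipschitz_prod:
  "(\<And>a. a \<in> A \<Longrightarrow> bounded_lipschitz (f a)) \<Longrightarrow> bounded_lipschitz (\<lambda>x. \<Prod>a\<in>A. f a x)"
  by (induction A rule: infinite_finite_induct) (auto intro: bounded_lipschitz_const bounded_lipschitz_mult)

lemma bounded_lipschitz_sum:
  "(\<And>a. a \<in> A \<Longrightarrow> bounded_lipschitz (f a)) \<Longrightarrow> bounded_lipschitz (\<lambda>x. \<Sum>a\<in>A. f a x)"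
  by (induction A rule: infinite_finite_induct) (auto intro: bounded_lipschitz_const bounded_lipschitz_add)

lemma bounded_lipschitz_dp_at:
  assumes "\<And>i. i < d \<Longrightarrow> bounded_lipschitz ((hl_deriv ^^ i) q)" "vars_below d p"
  shows "bounded_lipschitz (dp_at p q)"
  unfolding dp_at_def[abs_def] dp_eval_def
  using assms by (intro bounded_lipschitz_sum bounded_lipschitz_mult bounded_lipschitz_const
      bounded_lipschitz_prod bounded_lipschitz_power) (auto simp: vars_below_def)

lemma dp_at_has_vector_derivative:
  assumes "\<And>i. i < d \<Longrightarrow> ((hl_deriv ^^ i) q has_vector_derivative (hl_deriv ^^ Suc i) q x) (at x within {0..})"
    and "vars_below d p"
  shows "(dp_at p q has_vector_derivative dp_at (dp_deriv p) q x) (at x within {0..})"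
  unfolding dp_at_def[abs_def] has_real_derivative_iff_has_vector_derivative[symmetric]
  by (rule dp_eval_deriv) (use assms in \<open>auto simp: vars_below_def has_real_derivative_iff_has_vector_derivative\<close>)

section \<open>Classical derivatives of Sobolev functions\<close>

text \<open>Functions of this form, with \<open>p\<close> and \<open>m\<close> arbitrary, are closed under differentiation. This makes the
  smoothness of \<open>exp (- 1 / ((x - a) (b - x)))\<close> an induction without a formula for the derivatives.\<close>

definition bump_term :: "real \<Rightarrow> real \<Rightarrow> real poly \<Rightarrow> nat \<Rightarrow> real \<Rightarrow> real" where
  "bump_term a b p m x = (if a < x \<and> x < b
     then poly p x * inverse ((x - a) * (b - x)) ^ m * exp (- inverse ((x - a) * (b - x))) else 0)"

text \<open>With \<open>v = 1 / ((x - a) (b - x))\<close> the claim is that \<open>v\<^sup>m\<^sup>+\<^sup>2 exp (- v)\<close> is bounded.\<close>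

lemma bump_term_quadratic_bound:
  "\<exists>C. \<forall>x. a < x \<longrightarrow> x < b \<longrightarrow> \<bar>bump_term a b p m x\<bar> \<le> C * ((x - a) * (b - x))\<^sup>2"
proof -
  have "compact (poly p ` {a..b})" by (intro compact_continuous_image continuous_intros compact_Icc)
  then have "bounded (poly p ` {a..b})" by (rule compact_imp_bounded)
  then obtain P where P: "\<forall>x\<in>{a..b}. \<bar>poly p x\<bar> \<le> P" unfolding bounded_iff by auto
  let ?n = "m + 2"
  have "\<bar>bump_term a b p m x\<bar> \<le> P * real ?n ^ ?n * ((x - a) * (b - x))\<^sup>2" if x: "a < x" "x < b" for x
  proof -
    define w where "w = (x - a) * (b - x)"
    have w: "w > 0" using x by (simp add: w_def)
    have "(inverse w / real ?n) ^ ?n \<le> (1 + inverse w / real ?n) ^ ?n"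
      using w by (intro power_mono) auto
    also have "\<dots> \<le> exp (inverse w)"
      using w by (intro exp_ge_one_plus_x_over_n_power_n) (auto intro: order.trans[of _ 0])
    finally have "inverse w ^ ?n \<le> real ?n ^ ?n * exp (inverse w)"
      by (simp add: power_divide pos_divide_le_eq mult.commute)
    then have "inverse w ^ ?n * exp (- inverse w) \<le> real ?n ^ ?n"
      by (simp add: exp_minus pos_divide_le_eq divide_inverse[symmetric])
    then have "inverse w ^ ?n * exp (- inverse w) * w\<^sup>2 \<le> real ?n ^ ?n * w\<^sup>2"
      by (rule mult_right_mono) simp
    moreover have "inverse w ^ ?n * w\<^sup>2 = inverse w ^ m"
      using w by (simp add: power_add power_mult_distrib[symmetric] field_simps power2_eq_square)
    ultimately have e: "inverse w ^ m * exp (- inverse w) \<le> real ?n ^ ?n * w\<^sup>2"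
      by (metis mult.assoc mult.commute)
    have "\<bar>bump_term a b p m x\<bar> = \<bar>poly p x\<bar> * (inverse w ^ m * exp (- inverse w))"
      using x w by (simp add: bump_term_def w_def[symmetric] abs_mult power_abs)
    also have "\<dots> \<le> P * (real ?n ^ ?n * w\<^sup>2)"
    proof (rule mult_mono[OF _ e])
      show px: "\<bar>poly p x\<bar> \<le> P" using P x by simp
      show "0 \<le> P" using px by linarith
    qed (use w in simp)
    finally show ?thesis by (simp add: w_def mult.assoc)
  qed
  then show ?thesis by blast
qed

text \<open>Inside the interval this is the product rule. Elsewhere, the end points included, the function is
  quadratically small.\<close>

lemma bump_term_has_derivative:
  "\<exists>p' m'. \<forall>x. (bump_term a b p m has_real_derivative bump_term a b p' m' x) (at x)"
proof (intro exI allI)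
  define W :: "real poly" where "W = [:- (a * b), a + b, - 1:]"
  let ?p' = "pderiv p * W\<^sup>2 - smult (of_nat m) (p * pderiv W * W) + p * pderiv W"
  have W: "poly W x = (x - a) * (b - x)" for x by (simp add: W_def algebra_simps)
  fix x
  show "(bump_term a b p m has_real_derivative bump_term a b ?p' (m + 2) x) (at x)"
  proof (cases "a < x \<and> x < b")
    case True
    let ?v = "inverse (poly W x)" and ?e = "exp (- inverse (poly W x))"
    let ?w' = "poly (pderiv W) x"
    have w: "poly W x > 0" using True by (simp add: W)
    have "((\<lambda>x. poly p x * inverse (poly W x) ^ m * exp (- inverse (poly W x))) has_real_derivative
        (poly (pderiv p) x * ?v ^ m + real m * (- (?v * ?w' * ?v)) * ?v ^ (m - Suc 0) * poly p x) * ?e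
        + - (- (?v * ?w' * ?v)) * ?e * (poly p x * ?v ^ m)) (at x)"
      using w by (auto intro!: derivative_eq_intros simp: algebra_simps)
    moreover have "(poly (pderiv p) x * ?v ^ m + real m * (- (?v * ?w' * ?v)) * ?v ^ (m - Suc 0) * poly p x) * ?e
        + - (- (?v * ?w' * ?v)) * ?e * (poly p x * ?v ^ m) = poly ?p' x * ?v ^ (m + 2) * ?e"
    proof -
      define v where "v = ?v"
      have vw: "poly W x * v = 1" using w by (simp add: v_def)
      have m1: "real m * v ^ (m - Suc 0) * v = real m * v ^ m" by (cases m) auto
      have e1: "poly (pderiv p) x * (poly W x)\<^sup>2 * v ^ (m + 2) = poly (pderiv p) x * v ^ m"
      proof -
        have "poly (pderiv p) x * (poly W x)\<^sup>2 * v ^ (m + 2) = poly (pderiv p) x * v ^ m * (poly W x * v)\<^sup>2"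
          by (simp add: power_add power2_eq_square mult_ac)
        then show ?thesis by (simp add: vw)
      qed
      have e2: "real m * poly p x * ?w' * poly W x * v ^ (m + 2) = real m * v ^ m * v * poly p x * ?w'"
      proof -
        have "real m * poly p x * ?w' * poly W x * v ^ (m + 2) = real m * v ^ m * v * poly p x * ?w' * (poly W x * v)"
          by (simp add: power_add power2_eq_square mult_ac)
        then show ?thesis by (simp add: vw)
      qed
      have e3: "real m * (- (v * ?w' * v)) * v ^ (m - Suc 0) * poly p x = - (real m * v ^ m) * v * ?w' * poly p x"
        unfolding m1[symmetric] by (simp add: mult_ac)
      have "poly ?p' x * v ^ (m + 2) = poly (pderiv p) x * (poly W x)\<^sup>2 * v ^ (m + 2) -
          real m * poly p x * ?w' * poly W x * v ^ (m + 2) + poly p x * ?w' * v ^ (m + 2)"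
        by (simp add: algebra_simps)
      then show ?thesis
        unfolding v_def[symmetric] e1 e2 e3
        by (simp only:) (simp add: algebra_simps power_add power2_eq_square)
    qed
    ultimately have "((\<lambda>x. poly p x * inverse (poly W x) ^ m * exp (- inverse (poly W x))) has_real_derivative
        bump_term a b ?p' (m + 2) x) (at x)"
      using True by (simp only: bump_term_def W if_True simp_thms)
    then show ?thesis
      by (rule has_field_derivative_transform_within_open[of _ _ _ "{a<..<b}"])
        (use True in \<open>auto simp: bump_term_def W\<close>)
  next
    case False
    obtain C where C: "\<And>y. a < y \<Longrightarrow> y < b \<Longrightarrow> \<bar>bump_term a b p m y\<bar> \<le> C * ((y - a) * (b - y))\<^sup>2"
      using bump_term_quadratic_bound by blast
    have "\<bar>bump_term a b p m y\<bar> \<le> \<bar>C\<bar> * (b - a)\<^sup>2 * (norm (y - x))\<^sup>2" for y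
    proof (cases "a < y \<and> y < b")
      case True
      have "(y - a) * (b - y) \<le> (b - a) * \<bar>y - x\<bar>"
      proof (cases "x \<le> a")
        case True
        have "(y - a) * (b - y) \<le> \<bar>y - x\<bar> * (b - a)"
          using True \<open>a < y \<and> y < b\<close> by (intro mult_mono) auto
        then show ?thesis by (simp add: mult.commute)
      next
        case nle: False
        show ?thesis using False True nle by (intro mult_mono) auto
      qed
      then have "((y - a) * (b - y))\<^sup>2 \<le> ((b - a) * \<bar>y - x\<bar>)\<^sup>2" using True by (intro power_mono) auto
      then have "\<bar>C\<bar> * ((y - a) * (b - y))\<^sup>2 \<le> \<bar>C\<bar> * ((b - a) * \<bar>y - x\<bar>)\<^sup>2"
        by (rule mult_left_mono) simp
      moreover have "C * ((y - a) * (b - y))\<^sup>2 \<le> \<bar>C\<bar> * ((y - a) * (b - y))\<^sup>2"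
        by (intro mult_right_mono) auto
      moreover have "\<bar>C\<bar> * ((b - a) * \<bar>y - x\<bar>)\<^sup>2 = \<bar>C\<bar> * (b - a)\<^sup>2 * (norm (y - x))\<^sup>2"
        by (simp add: power_mult_distrib)
      moreover have "\<bar>bump_term a b p m y\<bar> \<le> C * ((y - a) * (b - y))\<^sup>2" using C True by simp
      ultimately show ?thesis by linarith
    qed (auto simp: bump_term_def)
    moreover have "bump_term a b p m x = 0" "bump_term a b ?p' (m + 2) x = 0"
      using False by (simp_all only: bump_term_def if_False)
    ultimately show ?thesis
      by (intro has_field_derivative_of_quadratic_error[where C = "\<bar>C\<bar> * (b - a)\<^sup>2"]) (simp only: diff_0_right mult_zero_right real_norm_def, simp)
  qed
qed

lemma iterated_deriv_bump_term: "\<exists>p' m'. (deriv ^^ i) (bump_term a b p m) = bump_term a b p' m'"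
proof (induction i)
  case (Suc i)
  then obtain p' m' where "(deriv ^^ i) (bump_term a b p m) = bump_term a b p' m'" by blast
  moreover obtain p'' m'' where "\<And>x. (bump_term a b p' m' has_real_derivative bump_term a b p'' m'' x) (at x)"
    using bump_term_has_derivative by blast
  then have "deriv (bump_term a b p' m') = bump_term a b p'' m''"
    by (intro ext DERIV_imp_deriv)
  ultimately show ?case by auto
qed auto

lemma smooth_kernel_exists:
  fixes a b :: real
  assumes "a < b"
  shows "\<exists>\<eta>. (\<forall>x. 0 \<le> \<eta> x) \<and> (\<eta> has_integral 1) {a..b} \<and>
    (\<forall>i x. ((deriv ^^ i) \<eta> has_real_derivative (deriv ^^ Suc i) \<eta> x) (at x)) \<and>
    (\<forall>i x. x \<notin> {a<..<b} \<longrightarrow> (deriv ^^ i) \<eta> x = 0)"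
proof -
  let ?f = "bump_term a b 1 0"
  define I where "I = integral {a..b} ?f"
  have nonneg: "0 \<le> ?f x" for x by (simp add: bump_term_def)
  have c: "continuous_on S (bump_term a b p m)" for p m S
    using bump_term_has_derivative[of a b p m] by (meson DERIV_isCont continuous_at_imp_continuous_on)
  have "I \<noteq> 0"
  proof
    assume "I = 0"
    then have "\<forall>x\<in>{a..b}. ?f x = 0"
      using integral_eq_0_iff[of a b ?f] c nonneg assms by (auto simp: I_def)
    moreover have "?f ((a + b) / 2) \<noteq> 0" using assms by (simp add: bump_term_def)
    ultimately show False using assms by auto
  qed
  moreover have "0 \<le> I" unfolding I_def by (rule integral_nonneg) (use c nonneg in \<open>auto intro: integrable_continuous_real\<close>)
  ultimately have I: "I > 0" by simp
  let ?\<eta> = "bump_term a b [:inverse I:] 0"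
  have eta: "?\<eta> x = inverse I * ?f x" for x by (simp add: bump_term_def)
  have "(?f has_integral I) {a..b}"
    unfolding I_def by (rule integrable_integral) (auto intro: integrable_continuous_real c)
  then have "((\<lambda>x. inverse I * ?f x) has_integral inverse I * I) {a..b}" by (rule has_integral_mult_right)
  then have "(?\<eta> has_integral 1) {a..b}" using I by (simp add: eta[symmetric])
  moreover have "((deriv ^^ i) ?\<eta> has_real_derivative (deriv ^^ Suc i) ?\<eta> x) (at x)" for i x
  proof -
    obtain p m where pm: "(deriv ^^ i) ?\<eta> = bump_term a b p m" using iterated_deriv_bump_term by blast
    obtain p' m' where d: "\<And>x. (bump_term a b p m has_real_derivative bump_term a b p' m' x) (at x)"
      using bump_term_has_derivative by blast
    show ?thesis using d[of x] DERIV_imp_deriv[OF d[of x]] by (simp add: pm)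
  qed
  moreover have "(deriv ^^ i) ?\<eta> x = 0" if "x \<notin> {a<..<b}" for i x
  proof -
    obtain p m where "(deriv ^^ i) ?\<eta> = bump_term a b p m" using iterated_deriv_bump_term by blast
    then show ?thesis using that by (auto simp: bump_term_def)
  qed
  moreover have "0 \<le> ?\<eta> x" for x using I nonneg[of x] by (simp add: eta)
  ultimately show ?thesis by blast
qed

text \<open>A bound on second derivatives makes difference quotients converge at a rate that is uniform in \<open>m\<close>, so
  pointwise convergence of the functions forces pointwise convergence of the derivatives, and the limit
  inherits the first-order Taylor estimate.\<close>

lemma derivative_of_limit:
  fixes G G1 G2 :: "nat \<Rightarrow> real \<Rightarrow> real"
  assumes G: "\<And>m x. 0 \<le> x \<Longrightarrow> (G m has_real_derivative G1 m x) (at x within {0..})"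
    and G1: "\<And>m x. 0 \<le> x \<Longrightarrow> (G1 m has_real_derivative G2 m x) (at x within {0..})"
    and B: "\<And>m x. 0 \<le> x \<Longrightarrow> \<bar>G2 m x\<bar> \<le> B"
    and lim: "\<And>x. 0 \<le> x \<Longrightarrow> (\<lambda>m. G m x) \<longlonglongrightarrow> g x" and x: "0 \<le> x"
  shows "(\<lambda>m. G1 m x) \<longlonglongrightarrow> hl_deriv g x" "(g has_vector_derivative hl_deriv g x) (at x within {0..})"
proof -
  have B0: "0 \<le> B" using B[of 0 0] abs_ge_zero[of "G2 0 0"] by linarith
  have lip: "\<bar>G1 m s - G1 m t\<bar> \<le> B * \<bar>s - t\<bar>" if "0 \<le> s" "0 \<le> t" for m s t
    using field_differentiable_bound[of "{0..}" "G1 m" "G2 m" B s t] G1 B that by auto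
  have taylor: "\<bar>G m y - G m x - (y - x) * G1 m x\<bar> \<le> B * \<bar>y - x\<bar>\<^sup>2" if "0 \<le> y" for y m
  proof -
    \<comment> \<open>Both signs of \<open>y - x\<close> are needed, as the derivative is two-sided at positive \<open>x\<close>.\<close>
    let ?S = "{min x y..max x y}"
    have "norm ((G m y - y * G1 m x) - (G m x - x * G1 m x)) \<le> (B * \<bar>y - x\<bar>) * norm (y - x)"
    proof (rule field_differentiable_bound[of ?S _ "\<lambda>t. G1 m t - G1 m x"])
      fix t assume t: "t \<in> ?S"
      then have t0: "0 \<le> t" using x that by auto
      have "(G m has_real_derivative G1 m t) (at t within ?S)"
        using G[OF t0] by (rule DERIV_subset) (use x that in auto)
      then show "((\<lambda>t. G m t - t * G1 m x) has_real_derivative G1 m t - G1 m x) (at t within ?S)"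
        by (auto intro!: derivative_eq_intros)
      have "\<bar>G1 m t - G1 m x\<bar> \<le> B * \<bar>t - x\<bar>" by (rule lip[OF t0 x])
      also have "\<dots> \<le> B * \<bar>y - x\<bar>" using t B0 by (intro mult_left_mono) auto
      finally show "norm (G1 m t - G1 m x) \<le> B * \<bar>y - x\<bar>" by simp
    qed auto
    then show ?thesis by (simp add: algebra_simps power2_eq_square)
  qed
  have "Cauchy (\<lambda>m. G1 m x)"
  proof (rule CauchyI)
    fix e :: real assume e: "0 < e"
    define h where "h = e / (3 * (B + 1))"
    have h: "h > 0" using e B0 by (simp add: h_def)
    have hB: "B * h < e / 3" using e B0 by (simp add: h_def field_simps)
    define r where "r m = (G m (x + h) - G m x) / h" for m
    have "r \<longlonglongrightarrow> (g (x + h) - g x) / h"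
      unfolding r_def[abs_def] using x h by (intro tendsto_divide tendsto_diff lim tendsto_const) auto
    then have "Cauchy r" by (rule LIMSEQ_imp_Cauchy)
    then obtain M where M: "\<And>m n. m \<ge> M \<Longrightarrow> n \<ge> M \<Longrightarrow> norm (r m - r n) < e / 3"
      using e unfolding Cauchy_iff by (meson divide_pos_pos zero_less_numeral)
    have d: "\<bar>r m - G1 m x\<bar> < e / 3" for m
    proof -
      have "\<bar>G m (x + h) - G m x - h * G1 m x\<bar> \<le> (B * h) * h"
        using taylor[of "x + h" m] x h by (simp add: power2_eq_square mult.assoc)
      then have "\<bar>G m (x + h) - G m x - h * G1 m x\<bar> / h \<le> B * h" using h by (simp add: pos_divide_le_eq)
      moreover have "r m - G1 m x = (G m (x + h) - G m x - h * G1 m x) / h"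
        using h by (simp add: r_def field_simps)
      then have "\<bar>r m - G1 m x\<bar> = \<bar>G m (x + h) - G m x - h * G1 m x\<bar> / h"
        using h by simp
      ultimately show ?thesis using hB by linarith
    qed
    have "norm (G1 m x - G1 n x) < e" if "m \<ge> M" "n \<ge> M" for m n
      using M[OF that] d[of m] d[of n] unfolding real_norm_def by linarith
    then show "\<exists>M. \<forall>m\<ge>M. \<forall>n\<ge>M. norm (G1 m x - G1 n x) < e" by blast
  qed
  then obtain L where L: "(\<lambda>m. G1 m x) \<longlonglongrightarrow> L" using Cauchy_convergent convergent_def by blast
  have "\<bar>g y - g x - (y - x) * L\<bar> \<le> B * \<bar>y - x\<bar>\<^sup>2" if y: "0 \<le> y" for y
    by (rule tendsto_upperbound[OF tendsto_rabs[OF tendsto_diff[OF tendsto_diff[OF lim[OF y] lim[OF x]]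
          tendsto_mult[OF tendsto_const L]]]]) (use taylor[OF y] in auto)
  then have "(g has_real_derivative L) (at x within {0..})"
    by (intro has_field_derivative_of_quadratic_error[where C = B])
      (auto simp: eventually_at_filter)
  then have v: "(g has_vector_derivative L) (at x within {0..})"
    by (simp add: has_real_derivative_iff_has_vector_derivative)
  then have "hl_deriv g x = L" by (rule hl_deriv_eq[OF _ x])
  then show "(\<lambda>m. G1 m x) \<longlonglongrightarrow> hl_deriv g x" "(g has_vector_derivative hl_deriv g x) (at x within {0..})"
    using L v by auto
qed

lemma derivatives_of_limit:
  fixes F :: "nat \<Rightarrow> nat \<Rightarrow> real \<Rightarrow> real"
  assumes F: "\<And>m i x. i < N \<Longrightarrow> 0 \<le> x \<Longrightarrow> (F m i has_real_derivative F m (Suc i) x) (at x within {0..})"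
    and B: "\<And>m i x. i \<le> N \<Longrightarrow> 0 \<le> x \<Longrightarrow> \<bar>F m i x\<bar> \<le> B"
    and lim: "\<And>x. 0 \<le> x \<Longrightarrow> (\<lambda>m. F m 0 x) \<longlonglongrightarrow> f x"
  shows "i < N \<Longrightarrow> 0 \<le> x \<Longrightarrow> (\<lambda>m. F m i x) \<longlonglongrightarrow> (hl_deriv ^^ i) f x"
    and "Suc i < N \<Longrightarrow> 0 \<le> x \<Longrightarrow>
      ((hl_deriv ^^ i) f has_vector_derivative (hl_deriv ^^ Suc i) f x) (at x within {0..})"
    and "i < N \<Longrightarrow> bounded_lipschitz ((hl_deriv ^^ i) f)"
proof -
  have l: "i < N \<Longrightarrow> 0 \<le> x \<Longrightarrow> (\<lambda>m. F m i x) \<longlonglongrightarrow> (hl_deriv ^^ i) f x" for i x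
  proof (induction i arbitrary: x)
    case (Suc i)
    show ?case
      using derivative_of_limit(1)[of "\<lambda>m. F m i" "\<lambda>m. F m (Suc i)" "\<lambda>m. F m (Suc (Suc i))" B "(hl_deriv ^^ i) f" x]
        Suc F B by simp
  qed (use lim in simp)
  show "i < N \<Longrightarrow> 0 \<le> x \<Longrightarrow> (\<lambda>m. F m i x) \<longlonglongrightarrow> (hl_deriv ^^ i) f x" by (rule l)
  show "((hl_deriv ^^ i) f has_vector_derivative (hl_deriv ^^ Suc i) f x) (at x within {0..})"
    if "Suc i < N" "0 \<le> x"
    using derivative_of_limit(2)[of "\<lambda>m. F m i" "\<lambda>m. F m (Suc i)" "\<lambda>m. F m (Suc (Suc i))" B "(hl_deriv ^^ i) f" x]
      that l F B by simp
  show "bounded_lipschitz ((hl_deriv ^^ i) f)" if i: "i < N"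
  proof -
    have "\<bar>(hl_deriv ^^ i) f x\<bar> \<le> B" if x: "0 \<le> x" for x
      by (rule tendsto_upperbound[OF tendsto_rabs[OF l[OF i x]]]) (use B i x in auto)
    moreover have "\<bar>(hl_deriv ^^ i) f x - (hl_deriv ^^ i) f y\<bar> \<le> B * \<bar>x - y\<bar>" if xy: "0 \<le> x" "0 \<le> y" for x y
    proof (rule tendsto_upperbound[OF tendsto_rabs[OF tendsto_diff[OF l[OF i xy(1)] l[OF i xy(2)]]]])
      show "\<forall>\<^sub>F m in sequentially. \<bar>F m i x - F m i y\<bar> \<le> B * \<bar>x - y\<bar>"
      proof (intro always_eventually allI)
        show "\<bar>F m i x - F m i y\<bar> \<le> B * \<bar>x - y\<bar>" for m
          using field_differentiable_bound[of "{0..}" "F m i" "F m (Suc i)" B x y] F B i xy by auto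
      qed
    qed simp
    ultimately show ?thesis unfolding bounded_lipschitz_def by blast
  qed
qed

lemma iterated_deriv_translate:
  "(deriv ^^ i) (\<lambda>t. f (t - x)) = (\<lambda>t. (deriv ^^ i) f (t - x))" for f :: "real \<Rightarrow> real"
proof (induction i)
  case (Suc i)
  have "deriv (\<lambda>t. g (t - x)) = (\<lambda>t. deriv g (t - x))" for g :: "real \<Rightarrow> real"
    by (intro ext) (simp add: deriv_def DERIV_shift[of g _ _ "- x", simplified, symmetric])
  then show ?case using Suc by simp
qed simp

lemma LINT_half_line_eq_integral:
  fixes h :: "real \<Rightarrow> real"
  assumes h: "continuous_on {0..} h" and supp: "\<And>t. t \<notin> {a..b} \<Longrightarrow> h t = 0" and ab: "0 < a"
  shows "(LINT t|half_line. h t) = integral {0..b} h" "integrable half_line h"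
proof -
  have ind: "indicator {0<..} t * h t = indicator {0..b} t * h t" for t :: real
    using supp[of t] ab by (cases "t \<in> {a..b}") (auto simp: indicator_def)
  have i: "integrable (lebesgue_on {0..b}) h"
    by (intro continuous_imp_integrable_real continuous_on_subset[OF h]) auto
  show "(LINT t|half_line. h t) = integral {0..b} h"
    using lebesgue_integral_eq_integral[OF i]
    by (simp add: half_line_def integral_restrict_space ind)
  show "integrable half_line h"
    using i by (simp add: half_line_def integrable_restrict_space ind)
qed

text \<open>The support lies strictly to the right of \<open>0\<close>. Then the translates of the kernel by \<open>x \<ge> 0\<close> are test functions
  on the open half-line, and mollification needs no values of \<open>q\<close> at negative arguments.\<close>

locale smooth_kernel =
  fixes a b :: real and \<eta> :: "real \<Rightarrow> real"
  assumes a_pos: "0 < a" and ab: "a < b"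
    and kernel_nonneg: "\<And>x. 0 \<le> \<eta> x" and kernel_integral: "(\<eta> has_integral 1) {a..b}"
    and kernel_deriv: "\<And>i x. ((deriv ^^ i) \<eta> has_real_derivative (deriv ^^ Suc i) \<eta> x) (at x)"
    and kernel_support: "\<And>i x. x \<notin> {a<..<b} \<Longrightarrow> (deriv ^^ i) \<eta> x = 0"
begin

lemma kernel_continuous: "continuous_on S (\<lambda>t. (deriv ^^ i) \<eta> (t - x))"
proof -
  have "continuous_on UNIV ((deriv ^^ i) \<eta>)"
    using kernel_deriv by (meson DERIV_isCont continuous_at_imp_continuous_on)
  then show ?thesis
    by (rule continuous_on_compose2) (auto intro!: continuous_intros)
qed

lemma kernel_translate_test_function:
  assumes "0 \<le> x"
  shows "(\<lambda>t. \<eta> (t - x)) \<in> test_functions"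
proof -
  have d: "((\<lambda>t. (deriv ^^ i) \<eta> (t - x)) has_real_derivative (deriv ^^ Suc i) \<eta> (t - x)) (at t)" for i t
    using DERIV_shift[of "(deriv ^^ i) \<eta>" _ t "- x"] kernel_deriv[of i "t - x"] by simp
  have "(deriv ^^ i) (\<lambda>t. \<eta> (t - x)) differentiable_on UNIV" for i
    unfolding iterated_deriv_translate differentiable_on_def
    using d by (auto simp: real_differentiable_def intro: has_field_derivative_at_within)
  moreover have sub: "closure {t. \<eta> (t - x) \<noteq> 0} \<subseteq> {x + a..x + b}"
  proof (rule closure_minimal)
    have "t \<in> {x + a..x + b}" if "\<eta> (t - x) \<noteq> 0" for t
    proof -
      have "t - x \<in> {a<..<b}"
        using kernel_support[of "t - x" 0] that by (cases "t - x \<in> {a<..<b}") auto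
      then show ?thesis by auto
    qed
    then show "{t. \<eta> (t - x) \<noteq> 0} \<subseteq> {x + a..x + b}" by blast
  qed simp
  then have "compact (closure {t. \<eta> (t - x) \<noteq> 0})"
    by (meson bounded_closed_interval bounded_subset closed_closure compact_eq_bounded_closed)
  moreover have "closure {t. \<eta> (t - x) \<noteq> 0} \<subseteq> {0<..}"
    using sub a_pos assms by force
  ultimately show ?thesis by (simp add: test_functions_def)
qed

text \<open>The \<open>i\<close>-th derivative of the mollified function, with all derivatives falling on the kernel.\<close>

definition mollify :: "nat \<Rightarrow> (real \<Rightarrow> real) \<Rightarrow> real \<Rightarrow> real" where
  "mollify i q x = (-1) ^ i * (LINT t|half_line. q t * (deriv ^^ i) \<eta> (t - x))"

lemma mollify_eq_integral:
  assumes "continuous_on {0..} q" "0 \<le> x" "x \<le> X"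
  shows "mollify i q x = (-1) ^ i * integral {0..X + b} (\<lambda>t. q t * (deriv ^^ i) \<eta> (t - x))"
proof -
  have "continuous_on {0..} (\<lambda>t. q t * (deriv ^^ i) \<eta> (t - x))"
    by (intro continuous_intros kernel_continuous assms)
  then have "(LINT t|half_line. q t * (deriv ^^ i) \<eta> (t - x)) = integral {0..X + b} (\<lambda>t. q t * (deriv ^^ i) \<eta> (t - x))"
  proof (rule LINT_half_line_eq_integral(1)[of _ "x + a"])
    show "q t * (deriv ^^ i) \<eta> (t - x) = 0" if "t \<notin> {x + a..X + b}" for t
      using kernel_support[of "t - x" i] that assms by auto
  qed (use a_pos assms in auto)
  then show ?thesis by (simp add: mollify_def)
qed

lemma mollify_has_derivative:
  assumes q: "continuous_on {0..} q" and x: "0 \<le> x"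
  shows "(mollify i q has_real_derivative mollify (Suc i) q x) (at x within {0..})"
proof -
  let ?X = "x + 1"
  let ?F = "\<lambda>i x. integral (cbox 0 (?X + b)) (\<lambda>t. q t * (deriv ^^ i) \<eta> (t - x))"
  have cq: "continuous_on {0..?X + b} q" using q by (auto elim: continuous_on_subset)
  have cz: "continuous_on UNIV ((deriv ^^ i) \<eta>)" for i using kernel_continuous[of UNIV i 0] by simp
  have "(?F i has_real_derivative integral (cbox 0 (?X + b)) (\<lambda>t. - (q t * (deriv ^^ Suc i) \<eta> (t - x)))) (at x within {0..?X})"
  proof (rule leibniz_rule_field_derivative)
    fix y t :: real
    have "((\<lambda>y. (deriv ^^ i) \<eta> (t - y)) has_real_derivative (deriv ^^ Suc i) \<eta> (t - y) * (- 1)) (at y)"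
      by (rule DERIV_chain2[OF kernel_deriv]) (auto intro!: derivative_eq_intros)
    then have "((\<lambda>y. (deriv ^^ i) \<eta> (t - y)) has_real_derivative (deriv ^^ Suc i) \<eta> (t - y) * (- 1)) (at y within {0..?X})"
      by (rule has_field_derivative_at_within)
    from DERIV_cmult[OF this, of "q t"]
    show "((\<lambda>y. q t * (deriv ^^ i) \<eta> (t - y)) has_real_derivative - (q t * (deriv ^^ Suc i) \<eta> (t - y))) (at y within {0..?X})"
      by simp
  next
    show "(\<lambda>t. q t * (deriv ^^ i) \<eta> (t - y)) integrable_on cbox 0 (?X + b)" for y
      unfolding cbox_interval by (intro integrable_continuous_real continuous_intros cq kernel_continuous)
    show "continuous_on ({0..?X} \<times> cbox 0 (?X + b)) (\<lambda>(y, t). - (q t * (deriv ^^ Suc i) \<eta> (t - y)))"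
      unfolding split_beta
      by (intro continuous_intros continuous_on_compose2[OF cq] continuous_on_compose2[OF cz]) auto
  qed (use x in auto)
  then have "((\<lambda>x. (-1) ^ i * ?F i x) has_real_derivative (-1) ^ i *
      integral (cbox 0 (?X + b)) (\<lambda>t. - (q t * (deriv ^^ Suc i) \<eta> (t - x)))) (at x within {0..?X})"
    by (rule DERIV_cmult)
  moreover have "(-1) ^ i * integral (cbox 0 (?X + b)) (\<lambda>t. - (q t * (deriv ^^ Suc i) \<eta> (t - x))) = mollify (Suc i) q x"
    by (subst mollify_eq_integral[OF q x, of ?X]) (auto simp: integral_neg)
  ultimately have "((\<lambda>x. (-1) ^ i * ?F i x) has_real_derivative mollify (Suc i) q x) (at x within {0..?X})"
    by simp
  then have "(mollify i q has_real_derivative mollify (Suc i) q x) (at x within {0..?X})"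
    unfolding has_real_derivative_iff_has_vector_derivative
    by (rule has_vector_derivative_transform[rotated 2]) (use x mollify_eq_integral[OF q, of _ ?X i] in auto)
  then show ?thesis by (simp add: at_within_initial_segment)
qed

lemma kernel_translate_has_integral:
  assumes "0 \<le> x"
  shows "((\<lambda>t. \<eta> (t - x)) has_integral 1) {0..x + b}"
proof -
  have "(\<eta> has_integral 1) (cbox (a + x + - x) (b + x + - x))" using kernel_integral by simp
  then have "(\<eta> \<circ> (+) (- x) has_integral 1) (cbox (a + x) (b + x))"
    using has_integral_shift_cbox_iff[of \<eta> "- x" 1 "a + x" "b + x"] by blast
  moreover have "\<eta> \<circ> (+) (- x) = (\<lambda>t. \<eta> (t - x))" by (auto simp: fun_eq_iff)
  ultimately have "((\<lambda>t. \<eta> (t - x)) has_integral 1) {a + x..b + x}" by simp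
  then show ?thesis
    by (rule has_integral_on_superset) (use kernel_support[of _ 0] a_pos assms in auto)
qed

text \<open>Since the kernel is a test function, the derivatives can be moved to \<open>q\<close> in the weak sense; this is the only
  point where weak derivatives enter.\<close>

lemma mollify_bound:
  assumes g: "AE t in half_line. \<bar>g t\<bar> \<le> B" and B: "0 \<le> B" and wd: "weak_derivative i q g" and x: "0 \<le> x"
  shows "\<bar>mollify i q x\<bar> \<le> B"
proof -
  let ?k = "\<lambda>t. \<eta> (t - x)"
  have "(LINT t|half_line. q t * (deriv ^^ i) ?k t) = (-1) ^ i * (LINT t|half_line. g t * ?k t)"
    using wd kernel_translate_test_function[OF x] by (simp add: weak_derivative_def)
  then have eq: "mollify i q x = (LINT t|half_line. g t * ?k t)"
    unfolding mollify_def iterated_deriv_translate by (simp add: power_mult_distrib[symmetric] flip: mult.assoc)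
  have sup: "t \<notin> {x + a..x + b} \<Longrightarrow> B * ?k t = 0" for t
    using kernel_support[of "t - x" 0] by auto
  have cont: "continuous_on {0..} (\<lambda>t. B * ?k t)"
    using kernel_continuous[of "{0..}" 0 x] by (auto intro!: continuous_intros)
  have int: "integrable half_line (\<lambda>t. B * ?k t)"
    by (rule LINT_half_line_eq_integral(2)[OF cont sup]) (use a_pos x in auto)
  have "(LINT t|half_line. B * ?k t) = integral {0..x + b} (\<lambda>t. B * ?k t)"
    by (rule LINT_half_line_eq_integral(1)[OF cont sup]) (use a_pos x in auto)
  also have "\<dots> = B" using integral_unique[OF kernel_translate_has_integral[OF x]] by simp
  finally have lim: "(LINT t|half_line. B * ?k t) = B" .
  have le: "\<bar>c\<bar> \<le> B \<Longrightarrow> c * ?k t \<le> B * ?k t \<and> - (c * ?k t) \<le> B * ?k t" for c t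
    using mult_right_mono[of c B "?k t"] mult_right_mono[of "- c" B "?k t"] kernel_nonneg[of "t - x"] by auto
  have "(LINT t|half_line. g t * ?k t) \<le> (LINT t|half_line. B * ?k t)"
    by (rule integral_mono_AE'[OF int]) (use g le B kernel_nonneg in \<open>auto elim!: eventually_mono\<close>)
  moreover have "(LINT t|half_line. - (g t * ?k t)) \<le> (LINT t|half_line. B * ?k t)"
    by (rule integral_mono_AE'[OF int]) (use g le B kernel_nonneg in \<open>auto elim!: eventually_mono\<close>)
  ultimately show ?thesis unfolding eq lim by (simp add: abs_le_iff)
qed

lemma mollify_close:
  assumes q: "continuous_on {0..} q" and x: "0 \<le> x"
    and e: "\<And>t. x \<le> t \<Longrightarrow> t \<le> x + b \<Longrightarrow> \<bar>q t - q x\<bar> \<le> e"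
  shows "\<bar>mollify 0 q x - q x\<bar> \<le> e"
proof -
  let ?k = "\<lambda>t. \<eta> (t - x)"
  note k = kernel_translate_has_integral[OF x]
  have cq: "continuous_on {0..x + b} q" using q by (auto elim: continuous_on_subset)
  have ck: "continuous_on {0..x + b} ?k" using kernel_continuous[of _ 0] by simp
  have i: "(\<lambda>t. q t * ?k t) integrable_on {0..x + b}"
    by (intro integrable_continuous_real continuous_intros cq ck)
  have "mollify 0 q x = integral {0..x + b} (\<lambda>t. q t * ?k t)"
    using mollify_eq_integral[OF q x, of x 0] by simp
  then have "((\<lambda>t. q t * ?k t) has_integral mollify 0 q x) {0..x + b}" using i by (simp add: has_integral_integral)
  moreover have "((\<lambda>t. q x * ?k t) has_integral q x * 1) {0..x + b}" by (rule has_integral_mult_right[OF k])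
  ultimately have d: "((\<lambda>t. q t * ?k t - q x * ?k t) has_integral mollify 0 q x - q x * 1) {0..x + b}"
    by (rule has_integral_diff)
  have ek: "((\<lambda>t. e * ?k t) has_integral e * 1) {0..x + b}" by (rule has_integral_mult_right[OF k])
  have "norm (integral {0..x + b} (\<lambda>t. q t * ?k t - q x * ?k t)) \<le> integral {0..x + b} (\<lambda>t. e * ?k t)"
  proof (rule Henstock_Kurzweil_Integration.integral_norm_bound_integral)
    fix t assume "t \<in> {0..x + b}"
    have "\<bar>q t - q x\<bar> * ?k t \<le> e * ?k t"
    proof (cases "x \<le> t \<and> t \<le> x + b")
      case True
      then show ?thesis using e kernel_nonneg by (intro mult_right_mono) auto
    next
      case False
      then have "?k t = 0" using kernel_support[of "t - x" 0] a_pos by auto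
      then show ?thesis by simp
    qed
    then show "norm (q t * ?k t - q x * ?k t) \<le> e * ?k t"
      using kernel_nonneg[of "t - x"] by (simp add: abs_mult flip: left_diff_distrib)
  qed (use d ek in auto)
  then show ?thesis unfolding integral_unique[OF d] integral_unique[OF ek] by simp
qed

end

lemma sobolev_Linf_regularity:
  assumes "q \<in> sobolev_Linf N" and q: "continuous_on {0..} q"
  shows "\<And>i. i < N \<Longrightarrow> bounded_lipschitz ((hl_deriv ^^ i) q)"
    and "\<And>i x. Suc i < N \<Longrightarrow> 0 \<le> x \<Longrightarrow>
      ((hl_deriv ^^ i) q has_vector_derivative (hl_deriv ^^ Suc i) q x) (at x within {0..})"
proof -
  have "\<forall>i\<in>{..N}. \<exists>g B. (AE x in half_line. \<bar>g x\<bar> \<le> B) \<and> weak_derivative i q g"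
    using assms(1) by (fastforce simp: sobolev_Linf_def Linf_def)
  then obtain g B where gB: "\<And>i. i \<le> N \<Longrightarrow> AE x in half_line. \<bar>g i x\<bar> \<le> B i"
      "\<And>i. i \<le> N \<Longrightarrow> weak_derivative i q (g i)"
    unfolding bchoice_iff by (metis atMost_iff)
  define K where "K = Max (insert 0 (B ` {..N}))"
  have K0: "0 \<le> K" unfolding K_def by (intro Max_ge) auto
  have gK: "AE x in half_line. \<bar>g i x\<bar> \<le> K" if "i \<le> N" for i
  proof -
    have "B i \<le> K" unfolding K_def using that by (intro Max_ge) auto
    then show ?thesis using gB(1)[OF that] by (auto elim!: eventually_mono)
  qed
  \<comment> \<open>The supports shrink to \<open>0\<close> from the right.\<close>
  define b where "b m = 1 / real (Suc m)" for m
  have b_pos: "0 < b m" for m by (simp add: b_def)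
  then have b0: "0 < b m / 2" "b m / 2 < b m" for m by simp_all
  have "\<exists>\<eta>. \<forall>m. smooth_kernel (b m / 2) (b m) (\<eta> m)"
  proof (intro choice allI)
    fix m
    show "\<exists>\<eta>. smooth_kernel (b m / 2) (b m) \<eta>"
      using smooth_kernel_exists[OF b0(2)[of m]] b0[of m] by (auto simp: smooth_kernel_def)
  qed
  then obtain \<eta> where \<eta>: "\<And>m. smooth_kernel (b m / 2) (b m) (\<eta> m)" by blast
  define F where "F m = (\<lambda>i. smooth_kernel.mollify (\<eta> m) i q)" for m
  have F': "(F m i has_real_derivative F m (Suc i) x) (at x within {0..})" if "0 \<le> x" for m i x
    unfolding F_def by (rule smooth_kernel.mollify_has_derivative[OF \<eta> q that])
  have FK: "\<bar>F m i x\<bar> \<le> K" if "i \<le> N" "0 \<le> x" for m i x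
    unfolding F_def by (rule smooth_kernel.mollify_bound[OF \<eta> gK K0 gB(2)]) (use that in auto)
  have blim: "b \<longlonglongrightarrow> 0" unfolding b_def using lim_1_over_n[THEN LIMSEQ_Suc] by simp
  have lim: "(\<lambda>m. F m 0 x) \<longlonglongrightarrow> q x" if x: "0 \<le> x" for x
  proof (rule tendstoI)
    fix e :: real assume e: "e > 0"
    obtain d where d: "d > 0" "\<And>t. 0 \<le> t \<Longrightarrow> \<bar>t - x\<bar> < d \<Longrightarrow> \<bar>q t - q x\<bar> < e / 2"
      using q x e unfolding continuous_on_iff dist_real_def by (metis atLeast_iff half_gt_zero)
    have "\<forall>\<^sub>F m in sequentially. b m < d" using order_tendstoD(2)[OF blim d(1)] .
    then show "\<forall>\<^sub>F m in sequentially. dist (F m 0 x) (q x) < e"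
    proof eventually_elim
      case (elim m)
      have "\<bar>F m 0 x - q x\<bar> \<le> e / 2"
        unfolding F_def
      proof (rule smooth_kernel.mollify_close[OF \<eta> q x])
        fix t assume "x \<le> t" "t \<le> x + b m"
        then show "\<bar>q t - q x\<bar> \<le> e / 2" using d(2)[of t] elim x by simp
      qed
      then show ?case using e by (simp add: dist_real_def)
    qed
  qed
  show "\<And>i. i < N \<Longrightarrow> bounded_lipschitz ((hl_deriv ^^ i) q)"
    by (rule derivatives_of_limit(3)[of N F K q, OF F' FK lim])
  show "\<And>i x. Suc i < N \<Longrightarrow> 0 \<le> x \<Longrightarrow>
      ((hl_deriv ^^ i) q has_vector_derivative (hl_deriv ^^ Suc i) q x) (at x within {0..})"
    by (rule derivatives_of_limit(2)[of N F K q, OF F' FK lim])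
qed

section \<open>Comparing a decaying solution with an approximate Riccati solution\<close>

text \<open>The function \<open>W = y g - \<sigma> y f\<close> joins \<open>g 0 - \<sigma> 0\<close> to \<open>0\<close> and has derivative \<open>- \<rho> y f\<close> with the residual \<open>\<rho>\<close> of \<open>\<sigma>\<close>.
  The product \<open>|y f|\<close> is at most the mean of \<open>|y|\<^sup>2\<close> and \<open>|f|\<^sup>2\<close>, which are dominated by
  the derivatives of an exponential and of the energy.\<close>

lemma riccati_comparison:
  assumes fg: "solves p f g" "f 0 = 1" and decay: "(f \<longlongrightarrow> 0) at_top" "(g \<longlongrightarrow> 0) at_top"
    and \<tau>: "0 \<le> Re \<tau>" and \<beta>: "0 < \<beta>" "\<And>x. 0 \<le> x \<Longrightarrow> \<beta> \<le> Re (\<tau> * p x)"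
    and \<sigma>: "\<And>x. 0 \<le> x \<Longrightarrow> (\<sigma> has_vector_derivative \<sigma>' x) (at x within {0..})"
    and S: "\<And>x. 0 \<le> x \<Longrightarrow> cmod (\<sigma> x) \<le> S"
    and r: "\<And>x. 0 \<le> x \<Longrightarrow> cmod (\<sigma>' x + (\<sigma> x)\<^sup>2 - p x) \<le> r"
    and y: "\<And>x. 0 \<le> x \<Longrightarrow> (y has_vector_derivative \<sigma> x * y x) (at x within {0..})" "y 0 = 1"
    and \<Lambda>: "0 < \<Lambda>" "\<And>x. 0 \<le> x \<Longrightarrow> (cmod (y x))\<^sup>2 \<le> 4 * exp (- \<Lambda> * x)"
  shows "cmod (g 0 - \<sigma> 0) \<le> r / 2 * (4 / \<Lambda> + cmod \<tau> * cmod (g 0) / \<beta>)"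
proof -
  define W where "W x = y x * g x - (\<sigma> x * y x) * f x" for x
  define \<phi> where "\<phi> x = r / 2 * (- (4 / \<Lambda>) * exp (- \<Lambda> * x) + inverse \<beta> * energy \<tau> f g x)" for x
  let ?e = "\<lambda>x. Re \<tau> * (cmod (g x))\<^sup>2 + Re (\<tau> * p x) * (cmod (f x))\<^sup>2"
  have r0: "0 \<le> r" using r[of 0] norm_ge_zero[of "\<sigma>' 0 + (\<sigma> 0)\<^sup>2 - p 0"] by linarith
  have S0: "0 \<le> S" using S[of 0] norm_ge_zero[of "\<sigma> 0"] by linarith
  have W': "(W has_vector_derivative - ((\<sigma>' x + (\<sigma> x)\<^sup>2 - p x) * (y x * f x))) (at x within {0..})" if "0 \<le> x" for x
  proof -
    have "(W has_vector_derivative (y x * (p x * f x) + \<sigma> x * y x * g x) -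
        ((\<sigma> x * y x) * g x + (\<sigma> x * (\<sigma> x * y x) + \<sigma>' x * y x) * f x)) (at x within {0..})"
      unfolding W_def[abs_def] using fg(1) that
      by (intro has_vector_derivative_diff has_vector_derivative_mult y \<sigma>) (auto simp: solves_def)
    then show ?thesis by (rule has_vector_derivative_eq_rhs) (simp add: algebra_simps power2_eq_square)
  qed
  have \<phi>': "(\<phi> has_vector_derivative r / 2 * (4 * exp (- \<Lambda> * x) + inverse \<beta> * ?e x)) (at x within {0..})" if x: "0 \<le> x" for x
  proof -
    have "((\<lambda>x. - (4 / \<Lambda>) * exp (- \<Lambda> * x)) has_vector_derivative 4 * exp (- \<Lambda> * x)) (at x within {0..})"
      unfolding has_real_derivative_iff_has_vector_derivative[symmetric] using \<Lambda>(1)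
      by (auto intro!: derivative_eq_intros)
    then show ?thesis
      unfolding \<phi>_def[abs_def]
      by (intro has_vector_derivative_mult_right has_vector_derivative_add
          energy_solves_has_vector_derivative fg x)
  qed
  have le: "cmod (- ((\<sigma>' x + (\<sigma> x)\<^sup>2 - p x) * (y x * f x))) \<le> r / 2 * (4 * exp (- \<Lambda> * x) + inverse \<beta> * ?e x)"
    if x: "0 \<le> x" for x
  proof -
    have "\<beta> * (cmod (f x))\<^sup>2 \<le> ?e x"
      using mult_right_mono[OF \<beta>(2)[OF x], of "(cmod (f x))\<^sup>2"] \<tau> by (simp add: add_increasing)
    then have f: "(cmod (f x))\<^sup>2 \<le> inverse \<beta> * ?e x"
      using \<beta>(1) by (simp add: field_simps)
    have "2 * (cmod (y x) * cmod (f x)) \<le> (cmod (y x))\<^sup>2 + (cmod (f x))\<^sup>2"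
      using sum_squares_bound[of "cmod (y x)" "cmod (f x)"] by (simp add: mult.assoc)
    also have "\<dots> \<le> 4 * exp (- \<Lambda> * x) + inverse \<beta> * ?e x"
      using \<Lambda>(2)[OF x] f by (rule add_mono)
    finally have yf: "cmod (y x) * cmod (f x) \<le> (4 * exp (- \<Lambda> * x) + inverse \<beta> * ?e x) / 2" by simp
    have "cmod (\<sigma>' x + (\<sigma> x)\<^sup>2 - p x) * (cmod (y x) * cmod (f x)) \<le>
        r * ((4 * exp (- \<Lambda> * x) + inverse \<beta> * ?e x) / 2)"
      by (intro mult_mono r x yf r0) auto
    then show ?thesis by (simp add: norm_mult)
  qed
  have y2: "cmod (y x) \<le> 2" if x: "0 \<le> x" for x
  proof (rule power2_le_imp_le)
    have "exp (- \<Lambda> * x) \<le> 1" using x \<Lambda>(1) by simp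
    then have "(cmod (y x))\<^sup>2 \<le> 4" using \<Lambda>(2)[OF x] by linarith
    then show "(cmod (y x))\<^sup>2 \<le> 2\<^sup>2" by simp
  qed simp
  have key: "cmod (W 0) \<le> 2 * cmod (g b) + S * 2 * cmod (f b) + r / 2 * (inverse \<beta> * energy \<tau> f g b) - \<phi> 0" if b: "0 \<le> b" for b
  proof -
    have "norm (W b - W 0) \<le> \<phi> b - \<phi> 0"
      by (rule norm_increment_le_half_line[OF _ b W' \<phi>' le]) auto
    moreover have "cmod (W 0) \<le> cmod (W b) + norm (W b - W 0)"
      using norm_triangle_ineq4[of "W b" "W b - W 0"] by simp
    moreover have "cmod (W b) \<le> cmod (y b) * cmod (g b) + cmod (\<sigma> b) * cmod (y b) * cmod (f b)"
      unfolding W_def using norm_triangle_ineq4[of "y b * g b"] by (metis norm_mult)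
    moreover have "cmod (y b) * cmod (g b) \<le> 2 * cmod (g b)"
      using y2[OF b] by (intro mult_right_mono) auto
    moreover have "cmod (\<sigma> b) * cmod (y b) * cmod (f b) \<le> S * 2 * cmod (f b)"
      using y2[OF b] S[OF b] S0 by (intro mult_right_mono mult_mono) auto
    moreover have "\<phi> b \<le> r / 2 * (inverse \<beta> * energy \<tau> f g b)"
      unfolding \<phi>_def using r0 \<Lambda>(1) by (intro mult_left_mono) auto
    ultimately show ?thesis by linarith
  qed
  have "((\<lambda>b. Re (\<tau> * g b * cnj (f b))) \<longlongrightarrow> Re (\<tau> * 0 * cnj 0)) at_top"
    by (intro tendsto_intros decay)
  then have "(energy \<tau> f g \<longlongrightarrow> 0) at_top" by (simp add: energy_def[abs_def])
  then have "((\<lambda>b. 2 * cmod (g b) + S * 2 * cmod (f b) + r / 2 * (inverse \<beta> * energy \<tau> f g b) - \<phi> 0) \<longlongrightarrow>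
      2 * cmod 0 + S * 2 * cmod 0 + r / 2 * (inverse \<beta> * 0) - \<phi> 0) at_top"
    by (intro tendsto_intros decay)
  then have "cmod (W 0) \<le> 2 * cmod 0 + S * 2 * cmod 0 + r / 2 * (inverse \<beta> * 0) - \<phi> 0"
  proof (rule tendsto_lowerbound)
    show "\<forall>\<^sub>F b in at_top. cmod (W 0) \<le> 2 * cmod (g b) + S * 2 * cmod (f b) + r / 2 * (inverse \<beta> * energy \<tau> f g b) - \<phi> 0"
      by (rule eventually_mono[OF eventually_ge_at_top[of 0]]) (rule key)
  qed simp
  moreover have "- \<phi> 0 \<le> r / 2 * (4 / \<Lambda> + cmod \<tau> * cmod (g 0) / \<beta>)"
  proof -
    have "- energy \<tau> f g 0 \<le> cmod \<tau> * cmod (g 0)"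
      using abs_Re_le_cmod[of "\<tau> * g 0"] by (simp add: energy_def fg norm_mult)
    then have "inverse \<beta> * - energy \<tau> f g 0 \<le> inverse \<beta> * (cmod \<tau> * cmod (g 0))"
      using \<beta>(1) by (intro mult_left_mono) auto
    then have "4 / \<Lambda> + inverse \<beta> * - energy \<tau> f g 0 \<le> 4 / \<Lambda> + inverse \<beta> * (cmod \<tau> * cmod (g 0))"
      by (rule add_left_mono)
    then have "r / 2 * (4 / \<Lambda> + inverse \<beta> * - energy \<tau> f g 0) \<le> r / 2 * (4 / \<Lambda> + inverse \<beta> * (cmod \<tau> * cmod (g 0)))"
      using r0 by (intro mult_left_mono) auto
    moreover have "- \<phi> 0 = r / 2 * (4 / \<Lambda> + inverse \<beta> * - energy \<tau> f g 0)"
      by (simp add: \<phi>_def algebra_simps)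
    moreover have "inverse \<beta> * (cmod \<tau> * cmod (g 0)) = cmod \<tau> * cmod (g 0) / \<beta>"
      by (simp add: divide_inverse mult.commute)
    ultimately show ?thesis by (simp only:)
  qed
  moreover have "W 0 = g 0 - \<sigma> 0" by (simp add: W_def y fg)
  ultimately show ?thesis by simp
qed

lemma exp_integral_has_vector_derivative:
  fixes \<sigma> :: "real \<Rightarrow> complex"
  assumes "continuous_on {0..} \<sigma>" "0 \<le> x"
  shows "((\<lambda>x. exp (integral {0..x} \<sigma>)) has_vector_derivative \<sigma> x * exp (integral {0..x} \<sigma>)) (at x within {0..})"
  using field_vector_diff_chain_within[OF integral_half_line_has_vector_derivative[OF assms],
      of exp "exp (integral {0..x} \<sigma>)"]
  by (auto simp: o_def intro: has_field_derivative_at_within DERIV_exp)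

lemma Re_of_real_mult_left: "Re (of_real a * z) = a * Re z"
  by simp

lemma Re_double_mult_of_real: "Re (2 * z * of_real a) = 2 * Re z * a"
  by simp

text \<open>Here \<open>u + v\<close> is an approximate Riccati solution split into its odd and even parts, and \<open>u' + 2 u v\<close> is the
  odd part of the residual. The even part drops out of the derivative of \<open>G = y\<^sup>2 u\<close>, which equals
  \<open>(2 u + (u' + 2 u v) / u) G\<close>. So \<open>|G|\<close> decays like \<open>exp (- \<Lambda> x)\<close>, and
  \<open>|u|\<close> varies at most by a factor \<open>4\<close>.\<close>

lemma exponential_bound_by_odd_part:
  assumes y: "\<And>x. 0 \<le> x \<Longrightarrow> (y has_vector_derivative (u x + v x) * y x) (at x within {0..})" "y 0 = 1"
    and u: "\<And>x. 0 \<le> x \<Longrightarrow> (u has_vector_derivative u' x) (at x within {0..})"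
    and r: "\<And>x. 0 \<le> x \<Longrightarrow> cmod (u' x + 2 * u x * v x) \<le> r"
    and \<Lambda>: "\<And>x. 0 \<le> x \<Longrightarrow> Re (u x) \<le> - (3 / 4) * \<Lambda>"
    and \<kappa>: "0 < \<kappa>" "\<And>x. 0 \<le> x \<Longrightarrow> \<kappa> \<le> cmod (u x)" "cmod (u 0) \<le> 4 * \<kappa>" and small: "2 * r \<le> \<Lambda> * \<kappa>"
    and x: "0 \<le> x"
  shows "(cmod (y x))\<^sup>2 \<le> 4 * exp (- \<Lambda> * x)"
proof -
  define G where "G x = (y x)\<^sup>2 * u x" for x
  have G': "(G has_vector_derivative (y x)\<^sup>2 * (2 * (u x)\<^sup>2 + (u' x + 2 * u x * v x))) (at x within {0..})" if "0 \<le> x" for x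
  proof -
    have "((\<lambda>x. y x * y x * u x) has_vector_derivative y x * y x * u' x +
        (y x * ((u x + v x) * y x) + (u x + v x) * y x * y x) * u x) (at x within {0..})"
      by (intro has_vector_derivative_mult y u that)
    then show ?thesis unfolding G_def[abs_def] power2_eq_square[of "y _"]
      by (rule has_vector_derivative_eq_rhs) (simp add: algebra_simps power2_eq_square)
  qed
  have "(cmod (G x))\<^sup>2 * exp (2 * \<Lambda> * x) \<le> (cmod (G 0))\<^sup>2 * exp (2 * \<Lambda> * 0)"
  proof -
    let ?F = "\<lambda>x. - ((cmod (G x))\<^sup>2 * exp (2 * \<Lambda> * x))"
    let ?d = "\<lambda>x. 2 * Re (((y x)\<^sup>2 * (2 * (u x)\<^sup>2 + (u' x + 2 * u x * v x))) * cnj (G x))"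
    have "?F 0 \<le> ?F x"
    proof (rule mono_half_line[where \<phi> = ?F and \<phi>' = "\<lambda>x. - ((cmod (G x))\<^sup>2 * (2 * \<Lambda> * exp (2 * \<Lambda> * x)) + ?d x * exp (2 * \<Lambda> * x))"])
      fix x :: real assume x: "0 \<le> x"
      have "((\<lambda>x. exp (2 * \<Lambda> * x)) has_vector_derivative 2 * \<Lambda> * exp (2 * \<Lambda> * x)) (at x within {0..})"
        unfolding has_real_derivative_iff_has_vector_derivative[symmetric]
        by (auto intro!: derivative_eq_intros)
      then show "(?F has_vector_derivative - ((cmod (G x))\<^sup>2 * (2 * \<Lambda> * exp (2 * \<Lambda> * x)) + ?d x * exp (2 * \<Lambda> * x))) (at x within {0..})"
        by (intro has_vector_derivative_minus has_vector_derivative_mult norm_square_has_vector_derivative G' x)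
      let ?\<rho> = "u' x + 2 * u x * v x"
      define Y where "Y = (y x)\<^sup>2"
      have "(Y * (2 * (u x)\<^sup>2 + ?\<rho>)) * cnj (Y * u x) = (Y * cnj Y) * (2 * u x * (u x * cnj (u x)) + ?\<rho> * cnj (u x))"
        by (simp add: algebra_simps power2_eq_square)
      also have "\<dots> = of_real ((cmod Y)\<^sup>2) * (2 * u x * of_real ((cmod (u x))\<^sup>2) + ?\<rho> * cnj (u x))"
        by (simp only: complex_norm_square)
      finally have "Re ((Y * (2 * (u x)\<^sup>2 + ?\<rho>)) * cnj (Y * u x)) =
          (cmod Y)\<^sup>2 * Re (2 * u x * of_real ((cmod (u x))\<^sup>2) + ?\<rho> * cnj (u x))"
        by (simp only: Re_of_real_mult_left)
      also have "Re (2 * u x * of_real ((cmod (u x))\<^sup>2) + ?\<rho> * cnj (u x)) = 2 * Re (u x) * (cmod (u x))\<^sup>2 + Re (?\<rho> * cnj (u x))"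
        by (simp only: plus_complex.sel Re_double_mult_of_real)
      finally have d: "?d x = 2 * ((cmod Y)\<^sup>2 * (2 * Re (u x) * (cmod (u x))\<^sup>2 + Re (?\<rho> * cnj (u x))))"
        by (simp only: Y_def G_def)
      have "2 * Re (u x) * (cmod (u x))\<^sup>2 \<le> - (3 / 2 * \<Lambda>) * (cmod (u x))\<^sup>2"
        using \<Lambda>[OF x] by (intro mult_right_mono) auto
      moreover have "Re (?\<rho> * cnj (u x)) \<le> \<Lambda> / 2 * (cmod (u x))\<^sup>2"
      proof -
        have "0 \<le> r" using r[OF x] norm_ge_zero order.trans by blast
        then have "0 \<le> \<Lambda> * \<kappa>" using small by linarith
        then have "0 \<le> \<Lambda>" using \<kappa>(1) by (simp add: zero_le_mult_iff)
        then have "\<Lambda> * \<kappa> \<le> \<Lambda> * cmod (u x)" using \<kappa>(2)[OF x] by (intro mult_left_mono)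
        then have "cmod ?\<rho> \<le> \<Lambda> / 2 * cmod (u x)" using r[OF x] small by linarith
        then have "cmod ?\<rho> * cmod (u x) \<le> \<Lambda> / 2 * cmod (u x) * cmod (u x)" by (intro mult_right_mono) auto
        moreover have "Re (?\<rho> * cnj (u x)) \<le> cmod ?\<rho> * cmod (u x)"
          using complex_Re_le_cmod[of "?\<rho> * cnj (u x)"] by (simp add: norm_mult)
        ultimately show ?thesis by (simp add: power2_eq_square mult.assoc)
      qed
      ultimately have "2 * Re (u x) * (cmod (u x))\<^sup>2 + Re (?\<rho> * cnj (u x)) \<le> - \<Lambda> * (cmod (u x))\<^sup>2" by linarith
      then have "(cmod Y)\<^sup>2 * (2 * Re (u x) * (cmod (u x))\<^sup>2 + Re (?\<rho> * cnj (u x))) \<le> (cmod Y)\<^sup>2 * (- \<Lambda> * (cmod (u x))\<^sup>2)"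
        by (rule mult_left_mono) simp
      then have "?d x \<le> 2 * ((cmod Y)\<^sup>2 * (- \<Lambda> * (cmod (u x))\<^sup>2))"
        unfolding d by (rule mult_left_mono) simp
      moreover have "(cmod (G x))\<^sup>2 * (2 * \<Lambda>) = - (2 * ((cmod Y)\<^sup>2 * (- \<Lambda> * (cmod (u x))\<^sup>2)))"
        by (simp add: G_def Y_def norm_mult power_mult_distrib)
      ultimately have "(cmod (G x))\<^sup>2 * (2 * \<Lambda>) + ?d x \<le> 0" by linarith
      then have "((cmod (G x))\<^sup>2 * (2 * \<Lambda>) + ?d x) * exp (2 * \<Lambda> * x) \<le> 0"
        by (simp add: mult_nonpos_nonneg)
      then show "0 \<le> - ((cmod (G x))\<^sup>2 * (2 * \<Lambda> * exp (2 * \<Lambda> * x)) + ?d x * exp (2 * \<Lambda> * x))"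
        by (simp only: distrib_right mult.assoc)
    qed (use x in auto)
    then show ?thesis by simp
  qed
  moreover have "exp (2 * \<Lambda> * x) = (exp (\<Lambda> * x))\<^sup>2" by (simp add: power2_eq_square flip: exp_add)
  ultimately have "(cmod (G x) * exp (\<Lambda> * x))\<^sup>2 \<le> (cmod (G 0))\<^sup>2"
    by (simp add: power_mult_distrib)
  then have "cmod (G x) * exp (\<Lambda> * x) \<le> cmod (G 0)" by (rule power2_le_imp_le) simp
  then have "(cmod (y x))\<^sup>2 * cmod (u x) * exp (\<Lambda> * x) \<le> 4 * \<kappa>"
    using \<kappa>(3) by (simp add: G_def y(2) norm_mult norm_power)
  moreover have "(cmod (y x))\<^sup>2 * \<kappa> * exp (\<Lambda> * x) \<le> (cmod (y x))\<^sup>2 * cmod (u x) * exp (\<Lambda> * x)"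
    using \<kappa>(2)[OF x] by (intro mult_right_mono mult_left_mono) auto
  ultimately have "(cmod (y x))\<^sup>2 * \<kappa> * exp (\<Lambda> * x) \<le> 4 * \<kappa>" by linarith
  then have "\<kappa> * ((cmod (y x))\<^sup>2 * exp (\<Lambda> * x)) \<le> \<kappa> * 4" by (simp only: mult_ac)
  then have "(cmod (y x))\<^sup>2 * exp (\<Lambda> * x) \<le> 4" using \<kappa>(1) by simp
  then show ?thesis by (simp add: exp_minus field_simps)
qed

section \<open>The approximate Riccati solution\<close>

text \<open>Everything that is used about the values \<open>c\<^sub>j(x)\<close> of the differential polynomials along \<open>q\<close>.\<close>

locale riccati_hierarchy =
  fixes N :: nat and q :: "real \<Rightarrow> real" and c :: "nat \<Rightarrow> real \<Rightarrow> real" and B :: real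
  assumes N: "1 \<le> N" and B: "0 \<le> B"
    and c_bound: "\<And>j x. 1 \<le> j \<Longrightarrow> j \<le> N \<Longrightarrow> 0 \<le> x \<Longrightarrow> \<bar>c j x\<bar> \<le> B"
    and c_lipschitz: "\<And>x y. 0 \<le> x \<Longrightarrow> 0 \<le> y \<Longrightarrow> \<bar>c N x - c N y\<bar> \<le> B * \<bar>x - y\<bar>"
    and c_deriv: "\<And>j x. 1 \<le> j \<Longrightarrow> j < N \<Longrightarrow> 0 \<le> x \<Longrightarrow> (c j has_vector_derivative
       2 * c (j + 1) x - (\<Sum>l = 1..j - 1. c l x * c (j - l) x)) (at x within {0..})"
    and c_1: "\<And>x. 0 \<le> x \<Longrightarrow> 2 * c 1 x = - q x"
begin

text \<open>The average of \<open>c\<^sub>N\<close> over \<open>{x..x+h}\<close>. It is within \<open>B h\<close> of \<open>c\<^sub>N\<close>, and unlike \<open>c\<^sub>N\<close> it is differentiable,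
  with derivative bounded by the Lipschitz constant.\<close>

definition moving_average :: "real \<Rightarrow> real \<Rightarrow> real" where
  "moving_average h x = (integral {0..x + h} (c N) - integral {0..x} (c N)) / h"

lemma c_N_continuous: "continuous_on {0..} (c N)"
proof -
  have "B-lipschitz_on {0..} (c N)" using c_lipschitz B by (auto simp: lipschitz_on_def dist_real_def)
  then show ?thesis by (rule lipschitz_on_continuous_on)
qed

lemma moving_average_has_vector_derivative:
  assumes "0 < h" "0 \<le> x"
  shows "(moving_average h has_vector_derivative (c N (x + h) - c N x) / h) (at x within {0..})"
proof -
  let ?I = "\<lambda>x. integral {0..x} (c N)"
  have I: "(?I has_vector_derivative c N x) (at x within {0..})" if "0 \<le> x" for x
    by (rule integral_half_line_has_vector_derivative[OF c_N_continuous that])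
  have "(?I has_real_derivative c N (x + h)) (at (x + h))"
    using has_vector_derivative_half_line_at[OF I, of "x + h"] assms
    by (simp add: has_real_derivative_iff_has_vector_derivative)
  then have "((\<lambda>x. ?I (x + h)) has_real_derivative c N (x + h)) (at x)"
    by (simp add: DERIV_shift)
  then have "((\<lambda>x. ?I (x + h)) has_vector_derivative c N (x + h)) (at x within {0..})"
    by (auto simp: has_real_derivative_iff_has_vector_derivative intro: has_vector_derivative_at_within)
  then show ?thesis
    unfolding moving_average_def[abs_def]
    by (intro has_vector_derivative_divide has_vector_derivative_diff I assms)
qed

lemma moving_average_increment:
  assumes h: "0 < h" and x: "0 \<le> x" and K: "\<And>t. x < t \<Longrightarrow> t < x + h \<Longrightarrow> \<bar>c N t - a\<bar> \<le> K"
  shows "\<bar>moving_average h x - a\<bar> \<le> K"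
proof -
  let ?I = "\<lambda>x. integral {0..x} (c N)"
  have "norm ((?I (x + h) - (x + h) * a) - (?I x - x * a)) \<le> (x + h) * K - x * K"
  proof (rule norm_increment_le_half_line[where f' = "\<lambda>t. c N t - a"])
    show "((\<lambda>x. ?I x - x * a) has_vector_derivative c N t - a) (at t within {0..})" if "0 \<le> t" for t
      using integral_half_line_has_vector_derivative[OF c_N_continuous that]
      unfolding has_real_derivative_iff_has_vector_derivative[symmetric]
      by (auto intro!: derivative_eq_intros)
    show "((\<lambda>x. x * K) has_vector_derivative K) (at t within {0..})" for t
      unfolding has_real_derivative_iff_has_vector_derivative[symmetric]
      by (auto intro!: derivative_eq_intros)
  qed (use assms in auto)
  then have "\<bar>?I (x + h) - ?I x - h * a\<bar> \<le> K * h" by (simp add: algebra_simps)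
  then have "\<bar>?I (x + h) - ?I x - h * a\<bar> / h \<le> K" using h by (simp add: pos_divide_le_eq)
  moreover have "moving_average h x - a = (?I (x + h) - ?I x - h * a) / h"
    using h by (simp add: moving_average_def field_simps)
  ultimately show ?thesis using h by simp
qed

definition smooth_coeff :: "real \<Rightarrow> nat \<Rightarrow> real \<Rightarrow> real" where
  "smooth_coeff h j x = (if j = N then moving_average h x else c j x)"

definition smooth_coeff_deriv :: "real \<Rightarrow> nat \<Rightarrow> real \<Rightarrow> real" where
  "smooth_coeff_deriv h j x = (if j = N then (c N (x + h) - c N x) / h
     else 2 * c (j + 1) x - (\<Sum>l = 1..j - 1. c l x * c (j - l) x))"

lemma smooth_coeff_has_vector_derivative:
  assumes "0 < h" "1 \<le> j" "j \<le> N" "0 \<le> x"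
  shows "(smooth_coeff h j has_vector_derivative smooth_coeff_deriv h j x) (at x within {0..})"
proof (cases "j = N")
  case True
  then have "smooth_coeff h j = moving_average h" by (auto simp: smooth_coeff_def)
  then show ?thesis using moving_average_has_vector_derivative[OF assms(1,4)] True by (simp add: smooth_coeff_deriv_def)
next
  case False
  then have "smooth_coeff h j = c j" by (auto simp: smooth_coeff_def)
  then show ?thesis using c_deriv[of j x] False assms by (simp add: smooth_coeff_deriv_def)
qed

lemma smooth_coeff_bound:
  assumes "0 < h" "1 \<le> j" "j \<le> N" "0 \<le> x"
  shows "\<bar>smooth_coeff h j x\<bar> \<le> B"
  using moving_average_increment[of h x 0 B] c_bound[of N] c_bound[of j x] assms N
  by (auto simp: smooth_coeff_def)

lemma moving_average_close:
  assumes "0 < h" "0 \<le> x"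
  shows "\<bar>moving_average h x - c N x\<bar> \<le> B * h"
proof (rule moving_average_increment[OF assms])
  fix t assume t: "x < t" "t < x + h"
  have "\<bar>c N t - c N x\<bar> \<le> B * \<bar>t - x\<bar>" using t assms by (intro c_lipschitz) auto
  also have "\<dots> \<le> B * h" using t B by (intro mult_left_mono) auto
  finally show "\<bar>c N t - c N x\<bar> \<le> B * h" .
qed

text \<open>The approximate Riccati solution without its leading term \<open>- k\<close>, as a polynomial in \<open>u = 1 / k\<close>. The scale \<open>h\<close>
  is kept as a separate parameter because the values at \<open>u\<close> and \<open>- u\<close> are compared with the same coefficients.\<close>

definition riccati_tail :: "real \<Rightarrow> complex \<Rightarrow> real \<Rightarrow> complex" where
  "riccati_tail h u x = (\<Sum>j = 1..N. of_real (smooth_coeff h j x) * u ^ j)"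

definition riccati_tail_deriv :: "real \<Rightarrow> complex \<Rightarrow> real \<Rightarrow> complex" where
  "riccati_tail_deriv h u x = (\<Sum>j = 1..N. of_real (smooth_coeff_deriv h j x) * u ^ j)"

lemma riccati_tail_has_vector_derivative:
  assumes "0 < h" "0 \<le> x"
  shows "(riccati_tail h u has_vector_derivative riccati_tail_deriv h u x) (at x within {0..})"
  unfolding riccati_tail_def[abs_def] riccati_tail_deriv_def
  by (intro has_vector_derivative_sum has_vector_derivative_mult_left has_vector_derivative_of_real)
    (use assms smooth_coeff_has_vector_derivative in \<open>auto simp: has_real_derivative_iff_has_vector_derivative\<close>)

lemma riccati_tail_bound:
  assumes "0 < h" "0 \<le> x" "cmod u \<le> 1"
  shows "cmod (riccati_tail h u x) \<le> real N * (B * cmod u)"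
proof -
  have "cmod (riccati_tail h u x) \<le> of_nat (card {1..N}) * (B * cmod u)"
    unfolding riccati_tail_def
  proof (rule sum_norm_bound)
    fix j assume j: "j \<in> {1..N}"
    have "cmod u ^ j \<le> cmod u ^ 1" using assms(3) j by (intro power_decreasing) auto
    then have "\<bar>smooth_coeff h j x\<bar> * cmod u ^ j \<le> B * cmod u"
      using smooth_coeff_bound[of h j x] assms j B by (intro mult_mono) auto
    then show "cmod (of_real (smooth_coeff h j x) * u ^ j) \<le> B * cmod u"
      by (simp add: norm_mult norm_power)
  qed
  then show ?thesis by simp
qed

text \<open>Collecting powers in the square of a polynomial, up to degree \<open>N - 1\<close>.\<close>

lemma sum_pairs_below:
  fixes a :: "nat \<Rightarrow> complex"
  shows "(\<Sum>(i, l)\<in>{(i, l). i \<in> {1..N} \<and> l \<in> {1..N} \<and> i + l < N}. a i * a l * u ^ (i + l)) =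
    (\<Sum>j = 1..N - 1. (\<Sum>l = 1..j - 1. a l * a (j - l)) * u ^ j)"
proof -
  have "(\<Sum>j = 1..N - 1. (\<Sum>l = 1..j - 1. a l * a (j - l)) * u ^ j) =
      (\<Sum>(j, l)\<in>Sigma {1..N - 1} (\<lambda>j. {1..j - 1}). a l * a (j - l) * u ^ j)"
    by (simp add: sum_distrib_right sum.Sigma)
  also have "\<dots> = (\<Sum>(i, l)\<in>{(i, l). i \<in> {1..N} \<and> l \<in> {1..N} \<and> i + l < N}. a i * a l * u ^ (i + l))"
    by (rule sum.reindex_bij_witness[of _ "\<lambda>(i, l). (i + l, i)" "\<lambda>(j, l). (l, j - l)"]) auto
  finally show ?thesis by simp
qed

text \<open>One \<open>B\<close> for the derivative of the smoothed top coefficient, two for its distance from \<open>c\<^sub>N\<close>, and \<open>B\<^sup>2\<close> for each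
  product of coefficients of total degree at least \<open>N\<close>.\<close>

definition residual_bound :: real where
  "residual_bound = 3 * B + (real N * real N) * (B * B)"

text \<open>By the recursion all powers of \<open>u\<close> below \<open>N - 1\<close> cancel. The smoothing leaves the term
  \<open>2 (c\<^sub>N - C\<^sub>N) u\<^sup>N\<^sup>-\<^sup>1\<close>, where \<open>C\<^sub>N\<close> is the average of \<open>c\<^sub>N\<close>; it is of order \<open>N\<close> because the smoothing scale is
  \<open>|u|\<close>.\<close>

lemma riccati_residual_bound:
  assumes u: "u \<noteq> 0" "cmod u \<le> 1" and x: "0 \<le> x"
  shows "cmod (riccati_tail_deriv (cmod u) u x + (- inverse u + riccati_tail (cmod u) u x)\<^sup>2
      - (of_real (q x) + (inverse u)\<^sup>2)) \<le> residual_bound * cmod u ^ N"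
proof -
  let ?h = "cmod u"
  have h: "0 < ?h" using u by simp
  let ?C = "\<lambda>j. of_real (smooth_coeff ?h j x) :: complex" and ?c = "\<lambda>j. of_real (c j x) :: complex"
  let ?D = "\<lambda>j. of_real (smooth_coeff_deriv ?h j x) :: complex"
  let ?P = "{1..N} \<times> {1..N}"
  let ?low = "{(i, l). i \<in> {1..N} \<and> l \<in> {1..N} \<and> i + l < N}"
  let ?high = "{(i, l). i \<in> {1..N} \<and> l \<in> {1..N} \<and> N \<le> i + l}"
  let ?t = "\<lambda>(i, l). ?C i * ?C l * u ^ (i + l)"
  obtain M where M: "N = Suc M" using N by (cases N) auto
  then have NM: "N - 1 = M" by simp
  have split: "(\<Sum>j = 1..N. a j) = (\<Sum>j = 1..M. a j) + a N" for a :: "nat \<Rightarrow> complex" by (simp add: M)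
  have "(riccati_tail ?h u x)\<^sup>2 = sum ?t ?P"
    by (simp add: riccati_tail_def power2_eq_square sum_product sum.cartesian_product power_add mult_ac)
  also have "?P = ?low \<union> ?high" by auto
  also have "sum ?t (?low \<union> ?high) = sum ?t ?low + sum ?t ?high"
    by (rule sum.union_disjoint) (auto intro: finite_subset[of _ ?P])
  also have "sum ?t ?low = (\<Sum>(i, l)\<in>?low. ?c i * ?c l * u ^ (i + l))"
    by (rule sum.cong) (auto simp: smooth_coeff_def)
  also have "\<dots> = (\<Sum>j = 1..N - 1. (\<Sum>l = 1..j - 1. ?c l * ?c (j - l)) * u ^ j)"
    by (rule sum_pairs_below)
  finally have square: "(riccati_tail ?h u x)\<^sup>2 = (\<Sum>j = 1..M. (\<Sum>l = 1..j - 1. ?c l * ?c (j - l)) * u ^ j) + sum ?t ?high"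
    by (simp only: NM)
  have "2 * inverse u * riccati_tail ?h u x = (\<Sum>j = 1..N. 2 * ?C j * u ^ (j - 1))"
    unfolding riccati_tail_def sum_distrib_left
  proof (rule sum.cong)
    fix j assume "j \<in> {1..N}"
    then have "u ^ j = u * u ^ (j - 1)" by (cases j) auto
    then show "2 * inverse u * (?C j * u ^ j) = 2 * ?C j * u ^ (j - 1)" using u by simp
  qed simp
  also have "\<dots> = (\<Sum>j = 1..N. 2 * ?c j * u ^ (j - 1)) + 2 * (?C N - ?c N) * u ^ M"
  proof -
    have "(\<Sum>j = 1..N. 2 * ?C j * u ^ (j - 1)) - (\<Sum>j = 1..N. 2 * ?c j * u ^ (j - 1)) =
        (\<Sum>j = 1..N. if j = N then 2 * (?C N - ?c N) * u ^ M else 0)"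
      unfolding sum_subtractf[symmetric]
      by (rule sum.cong) (auto simp: smooth_coeff_def NM[symmetric] algebra_simps)
    also have "\<dots> = 2 * (?C N - ?c N) * u ^ M" using N by simp
    finally show ?thesis by (simp add: algebra_simps)
  qed
  also have "(\<Sum>j = 1..N. 2 * ?c j * u ^ (j - 1)) = 2 * ?c 1 + (\<Sum>j = 1..M. 2 * ?c (Suc j) * u ^ j)"
    unfolding M by (simp add: sum.atLeast_Suc_atMost sum.shift_bounds_cl_Suc_ivl del: sum.cl_ivl_Suc)
  also have "2 * ?c 1 = - of_real (q x)"
    using c_1[OF x] by (metis of_real_minus of_real_mult of_real_numeral)
  finally have cross: "2 * inverse u * riccati_tail ?h u x =
      - of_real (q x) + (\<Sum>j = 1..M. 2 * ?c (Suc j) * u ^ j) + 2 * (?C N - ?c N) * u ^ M" .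
  have "riccati_tail_deriv ?h u x = (\<Sum>j = 1..M. ?D j * u ^ j) + ?D N * u ^ N"
    by (simp only: riccati_tail_deriv_def split)
  also have "(\<Sum>j = 1..M. ?D j * u ^ j) =
      (\<Sum>j = 1..M. 2 * ?c (Suc j) * u ^ j - (\<Sum>l = 1..j - 1. ?c l * ?c (j - l)) * u ^ j)"
  proof (rule sum.cong)
    fix j assume "j \<in> {1..M}"
    then have "j \<noteq> N" using M by auto
    then show "?D j * u ^ j = 2 * ?c (Suc j) * u ^ j - (\<Sum>l = 1..j - 1. ?c l * ?c (j - l)) * u ^ j"
      by (simp add: smooth_coeff_deriv_def algebra_simps)
  qed simp
  also have "\<dots> = (\<Sum>j = 1..M. 2 * ?c (Suc j) * u ^ j) - (\<Sum>j = 1..M. (\<Sum>l = 1..j - 1. ?c l * ?c (j - l)) * u ^ j)"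
    by (rule sum_subtractf)
  finally have deriv: "riccati_tail_deriv ?h u x = (\<Sum>j = 1..M. 2 * ?c (Suc j) * u ^ j) -
      (\<Sum>j = 1..M. (\<Sum>l = 1..j - 1. ?c l * ?c (j - l)) * u ^ j) + ?D N * u ^ N" .
  have "riccati_tail_deriv ?h u x + (- inverse u + riccati_tail ?h u x)\<^sup>2 - (of_real (q x) + (inverse u)\<^sup>2) =
      riccati_tail_deriv ?h u x - 2 * inverse u * riccati_tail ?h u x + (riccati_tail ?h u x)\<^sup>2 - of_real (q x)"
    by (simp add: power2_eq_square algebra_simps)
  also have "\<dots> = ?D N * u ^ N - 2 * (?C N - ?c N) * u ^ M + sum ?t ?high"
    unfolding deriv cross square by simp
  finally have eq: "riccati_tail_deriv ?h u x + (- inverse u + riccati_tail ?h u x)\<^sup>2 - (of_real (q x) + (inverse u)\<^sup>2) =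
      ?D N * u ^ N - 2 * (?C N - ?c N) * u ^ M + sum ?t ?high" .
  have 1: "cmod (?D N * u ^ N) \<le> B * ?h ^ N"
  proof -
    have "\<bar>c N (x + ?h) - c N x\<bar> \<le> B * ?h" using c_lipschitz[of "x + ?h" x] x h by simp
    then have "\<bar>smooth_coeff_deriv ?h N x\<bar> \<le> B" using h by (simp add: smooth_coeff_deriv_def pos_divide_le_eq)
    then show ?thesis by (simp add: norm_mult norm_power mult_right_mono)
  qed
  have 2: "cmod (2 * (?C N - ?c N) * u ^ M) \<le> 2 * B * ?h ^ N"
  proof -
    have "cmod (?C N - ?c N) \<le> B * ?h"
      using moving_average_close[OF h x] by (simp add: smooth_coeff_def flip: of_real_diff)
    then have "2 * cmod (?C N - ?c N) * ?h ^ M \<le> 2 * (B * ?h) * ?h ^ M" by (intro mult_right_mono) auto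
    moreover have "cmod (2 * (?C N - ?c N) * u ^ M) = 2 * cmod (?C N - ?c N) * ?h ^ M"
      by (simp only: norm_mult norm_power norm_numeral)
    moreover have "2 * (B * ?h) * ?h ^ M = 2 * B * ?h ^ N" by (simp add: M)
    ultimately show ?thesis by simp
  qed
  have 3: "cmod (sum ?t ?high) \<le> real N * real N * (B * B * ?h ^ N)"
  proof -
    have "cmod (sum ?t ?high) \<le> (\<Sum>z\<in>?high. B * B * ?h ^ N)"
    proof (rule sum_norm_le)
      fix z assume "z \<in> ?high"
      then obtain i l where z: "z = (i, l)" "i \<in> {1..N}" "l \<in> {1..N}" "N \<le> i + l" by auto
      have "?h ^ (i + l) \<le> ?h ^ N" using z u(2) by (intro power_decreasing) auto
      then have "\<bar>smooth_coeff ?h i x\<bar> * \<bar>smooth_coeff ?h l x\<bar> * ?h ^ (i + l) \<le> B * B * ?h ^ N"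
        using smooth_coeff_bound[OF h, of _ x] z x B by (intro mult_mono) auto
      then show "cmod (?t z) \<le> B * B * ?h ^ N" by (simp add: z norm_mult norm_power)
    qed
    also have "\<dots> = real (card ?high) * (B * B * ?h ^ N)" by simp
    also have "\<dots> \<le> real (card ?P) * (B * B * ?h ^ N)"
      using B by (intro mult_right_mono of_nat_mono card_mono) auto
    finally show ?thesis by simp
  qed
  show ?thesis
    unfolding eq residual_bound_def
    using norm_triangle_ineq[of "?D N * u ^ N - 2 * (?C N - ?c N) * u ^ M" "sum ?t ?high"]
      norm_triangle_ineq4[of "?D N * u ^ N" "2 * (?C N - ?c N) * u ^ M"] 1 2 3
    by (simp add: algebra_simps)
qed

end

section \<open>The asymptotic expansion\<close>

text \<open>Since \<open>u\<^sup>j\<close> and \<open>(cnj u)\<^sup>j\<close> have the same real part, the left-hand side is at most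
  \<open>|(cnj u)\<^sup>j - (- u)\<^sup>j|\<close>, and \<open>cnj u\<close> and \<open>- u\<close> are mirror images at distance \<open>2 |Re u|\<close>. Near the imaginary
  axis this is much smaller than \<open>|u|\<^sup>j\<close>.\<close>

lemma abs_Re_power_odd_part:
  assumes "cmod u \<le> 1"
  shows "\<bar>Re (u ^ j - (- u) ^ j)\<bar> \<le> 2 * real j * \<bar>Re u\<bar>"
proof -
  have "Re (u ^ j) = Re (cnj u ^ j)" by (metis complex_cnj_power cnj.simps(1))
  then have "\<bar>Re (u ^ j - (- u) ^ j)\<bar> = \<bar>Re (cnj u ^ j - (- u) ^ j)\<bar>" by simp
  also have "\<dots> \<le> cmod (cnj u ^ j - (- u) ^ j)" by (rule abs_Re_le_cmod)
  also have "\<dots> \<le> real j * cmod (cnj u - (- u))" by (rule norm_power_diff) (use assms in auto)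
  also have "cnj u - (- u) = of_real (2 * Re u)" by (simp add: complex_eq_iff)
  finally show ?thesis by (simp add: abs_mult)
qed

context riccati_hierarchy
begin

lemma residual_bound_nonneg: "0 \<le> residual_bound"
  unfolding residual_bound_def using B by simp

lemma q_bound:
  assumes "0 \<le> x" shows "\<bar>q x\<bar> \<le> 2 * B"
  using c_1[OF assms] c_bound[of 1 x] N assms by simp

text \<open>The lower bound for \<open>|k|\<^sup>2\<close> ensures that the tail of \<open>\<sigma>\<close> is small compared with \<open>k\<close> and that its odd part
  changes the decay rate by at most a quarter; the last hypothesis says that the residual is small
  compared with \<open>Re k * |k|\<close>. The comparison bounds the error by \<open>(r / Re k) (2 + |g 0| / |k|)\<close>; as \<open>g 0\<close> is itself within
  the error of \<open>\<sigma> 0 = O(|k|)\<close>, the error can be absorbed.\<close>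

lemma weyl_quotient_riccati_approximation:
  assumes fg: "solves (\<lambda>x. of_real (q x) - (- (k\<^sup>2))) f g" "f 0 = 1"
    and decay: "(f \<longlongrightarrow> 0) at_top" "(g \<longlongrightarrow> 0) at_top"
    and k: "0 < Re k" "1 \<le> cmod k" "4 * (real N)\<^sup>2 * B \<le> (cmod k)\<^sup>2"
    and small: "4 * residual_bound * inverse (cmod k) ^ N \<le> Re k * cmod k"
  shows "cmod (g 0 - (- k + riccati_tail (inverse (cmod k)) (inverse k) 0)) \<le>
    8 * residual_bound * inverse (cmod k) ^ N / Re k"
proof -
  define u where "u = inverse k"
  define h where "h = cmod u"
  define \<Lambda> where "\<Lambda> = Re k"
  define r where "r = residual_bound * h ^ N"
  have k0: "k \<noteq> 0" using k by auto
  have h_eq: "h = inverse (cmod k)" by (simp add: h_def u_def norm_inverse)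
  have h: "0 < h" "h \<le> 1" "cmod u \<le> 1" "cmod (- u) = h" "cmod u = h"
    using k k0 by (simp_all add: h_eq h_def[symmetric] inverse_le_1_iff)
  have r0: "0 \<le> r" unfolding r_def using residual_bound_nonneg h by simp
  have \<Lambda>: "0 < \<Lambda>" using k by (simp add: \<Lambda>_def)
  let ?a = "riccati_tail h u" and ?b = "riccati_tail h (- u)"
  let ?a' = "riccati_tail_deriv h u" and ?b' = "riccati_tail_deriv h (- u)"
  have tail: "cmod (?a x) \<le> cmod k / 4" "cmod (?b x) \<le> cmod k / 4" if "0 \<le> x" for x
  proof -
    have "4 * (real N * B) \<le> 4 * (real N)\<^sup>2 * B"
    proof -
      have "real N * B * 1 \<le> real N * B * real N" using B N by (intro mult_left_mono) auto
      then show ?thesis by (simp add: power2_eq_square mult_ac)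
    qed
    then have "4 * (real N * B) \<le> cmod k * cmod k" using k(3) by (simp add: power2_eq_square)
    then have "real N * (B * h) \<le> cmod k / 4" using k0 by (simp add: h_eq field_simps)
    then show "cmod (?a x) \<le> cmod k / 4" "cmod (?b x) \<le> cmod k / 4"
      using riccati_tail_bound[OF h(1) that, of u] riccati_tail_bound[OF h(1) that, of "- u"] h by simp_all
  qed
  define \<sigma> where "\<sigma> x = - k + ?a x" for x
  define U where "U x = - k + (?a x - ?b x) / 2" for x
  define V where "V x = (?a x + ?b x) / 2" for x
  have \<sigma>': "(\<sigma> has_vector_derivative ?a' x) (at x within {0..})" if "0 \<le> x" for x
    unfolding \<sigma>_def[abs_def] using riccati_tail_has_vector_derivative[OF h(1) that, of u]
    by (auto intro!: derivative_eq_intros)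
  have U': "(U has_vector_derivative (?a' x - ?b' x) / 2) (at x within {0..})" if "0 \<le> x" for x
  proof -
    have "((\<lambda>x. - k + (?a x - ?b x) / 2) has_vector_derivative 0 + (?a' x - ?b' x) / 2) (at x within {0..})"
      by (intro has_vector_derivative_add has_vector_derivative_const has_vector_derivative_divide
          has_vector_derivative_diff riccati_tail_has_vector_derivative h that)
    then show ?thesis by (simp add: U_def[abs_def])
  qed
  have res: "cmod (?a' x + (\<sigma> x)\<^sup>2 - (of_real (q x) + k\<^sup>2)) \<le> r"
    "cmod (?b' x + (k + ?b x)\<^sup>2 - (of_real (q x) + k\<^sup>2)) \<le> r" if "0 \<le> x" for x
    using riccati_residual_bound[of u x] riccati_residual_bound[of "- u" x] that h k0
    by (simp_all add: r_def \<sigma>_def u_def flip: h_def)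
  have odd: "cmod ((?a' x - ?b' x) / 2 + 2 * U x * V x) \<le> r" if "0 \<le> x" for x
  proof -
    let ?A = "?a' x + (\<sigma> x)\<^sup>2 - (of_real (q x) + k\<^sup>2)" and ?B = "?b' x + (k + ?b x)\<^sup>2 - (of_real (q x) + k\<^sup>2)"
    have eq: "(?a' x - ?b' x) / 2 + 2 * U x * V x = (?A - ?B) / 2"
      by (simp add: U_def V_def \<sigma>_def power2_eq_square field_simps)
    have "cmod (?A - ?B) \<le> r + r"
      using norm_triangle_ineq4[of ?A ?B] res[OF that] by linarith
    then show ?thesis unfolding eq by (simp only: norm_divide norm_numeral)
  qed
  have ReU: "Re (U x) \<le> - (3 / 4) * \<Lambda>" if x: "0 \<le> x" for x
  proof -
    have Reu: "Re u = \<Lambda> / (cmod k)\<^sup>2" by (simp add: u_def \<Lambda>_def Re_inverse cmod_power2)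
    have "Re (?a x - ?b x) = (\<Sum>j = 1..N. smooth_coeff h j x * Re (u ^ j - (- u) ^ j))"
      by (simp add: riccati_tail_def sum_subtractf right_diff_distrib)
    also have "\<dots> \<le> (\<Sum>j = 1..N. B * (2 * real N * Re u))"
    proof (rule sum_mono)
      fix j assume j: "j \<in> {1..N}"
      have "Re u \<ge> 0" using \<Lambda> by (simp add: Reu)
      have "smooth_coeff h j x * Re (u ^ j - (- u) ^ j) \<le> \<bar>smooth_coeff h j x\<bar> * \<bar>Re (u ^ j - (- u) ^ j)\<bar>"
        by (metis abs_ge_self abs_mult)
      also have "\<dots> \<le> B * (2 * real j * \<bar>Re u\<bar>)"
        using smooth_coeff_bound[OF h(1), of j x] abs_Re_power_odd_part[OF h(3), of j] j x B
        by (intro mult_mono) auto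
      also have "\<dots> \<le> B * (2 * real N * Re u)"
        using j B \<open>Re u \<ge> 0\<close> by (intro mult_left_mono) (auto intro!: mult_right_mono)
      finally show "smooth_coeff h j x * Re (u ^ j - (- u) ^ j) \<le> B * (2 * real N * Re u)" .
    qed
    also have "\<dots> = (4 * (real N)\<^sup>2 * B) * (\<Lambda> / (cmod k)\<^sup>2) / 2"
      by (simp add: Reu power2_eq_square)
    also have "\<dots> \<le> (cmod k)\<^sup>2 * (\<Lambda> / (cmod k)\<^sup>2) / 2"
      using k(3) \<Lambda> by (intro divide_right_mono mult_right_mono) auto
    also have "\<dots> = \<Lambda> / 2" using k0 by simp
    finally have "Re (?a x - ?b x) \<le> \<Lambda> / 2" .
    moreover have "Re (U x) = - \<Lambda> + Re (?a x - ?b x) / 2" by (simp add: U_def \<Lambda>_def)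
    ultimately show ?thesis by linarith
  qed
  have Unorm: "cmod k / 2 \<le> cmod (U x)" "cmod (U x) \<le> 2 * cmod k" if "0 \<le> x" for x
  proof -
    have "cmod ((?a x - ?b x) / 2) \<le> cmod k / 4"
      using norm_triangle_ineq4[of "?a x" "?b x"] tail[OF that] by (simp add: norm_divide)
    moreover have "cmod (- k) - cmod ((?a x - ?b x) / 2) \<le> cmod (U x)"
      unfolding U_def by (rule norm_diff_ineq)
    moreover have "cmod (U x) \<le> cmod (- k) + cmod ((?a x - ?b x) / 2)"
      unfolding U_def by (rule norm_triangle_ineq)
    moreover have "cmod (- k) = cmod k" "0 \<le> cmod k" by simp_all
    ultimately show "cmod k / 2 \<le> cmod (U x)" "cmod (U x) \<le> 2 * cmod k" by linarith+
  qed
  define y where "y x = exp (integral {0..x} \<sigma>)" for x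
  have y': "(y has_vector_derivative \<sigma> x * y x) (at x within {0..})" if "0 \<le> x" for x
    unfolding y_def[abs_def]
    by (rule exp_integral_has_vector_derivative[OF continuous_on_half_lineI[OF \<sigma>'] that])
  have y0: "y 0 = 1" by (simp add: y_def)
  have y2: "(cmod (y x))\<^sup>2 \<le> 4 * exp (- \<Lambda> * x)" if x: "0 \<le> x" for x
  proof (rule exponential_bound_by_odd_part[where y = y and u = U and v = V
        and u' = "\<lambda>x. (?a' x - ?b' x) / 2" and \<Lambda> = \<Lambda> and r = r and \<kappa> = "cmod k / 2", OF _ y0 U' odd ReU])
    show "(y has_vector_derivative (U x + V x) * y x) (at x within {0..})" if "0 \<le> x" for x
    proof -
      have "U x + V x = \<sigma> x" by (simp add: U_def V_def \<sigma>_def field_simps)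
      then show ?thesis using y'[OF that] by simp
    qed
    show "2 * r \<le> \<Lambda> * (cmod k / 2)" using small by (simp add: r_def h_eq \<Lambda>_def)
  qed (use k0 Unorm x in auto)
  have \<sigma>norm: "cmod (\<sigma> x) \<le> 2 * cmod k" if "0 \<le> x" for x
    unfolding \<sigma>_def
    using norm_triangle_ineq[of "- k" "?a x"] tail(1)[OF that] norm_ge_zero[of k] norm_minus_cancel[of k] by linarith
  \<comment> \<open>The coercivity constant of \<open>q + k\<^sup>2\<close> for the multiplier \<open>cnj k\<close>; keeping the factor \<open>|k|\<^sup>2\<close> here is
    what makes the square integral of the solution of order \<open>1 / Re k\<close>.\<close>
  define \<beta> where "\<beta> = \<Lambda> * (cmod k)\<^sup>2 / 2"
  have "cmod (g 0 - \<sigma> 0) \<le> r / 2 * (4 / \<Lambda> + cmod (cnj k) * cmod (g 0) / \<beta>)"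
  proof (rule riccati_comparison[OF fg decay _ _ _ \<sigma>' \<sigma>norm _ y' y0 \<Lambda> y2])
    show "0 \<le> Re (cnj k)" using k by simp
    show "0 < \<beta>" using \<Lambda> k0 by (simp add: \<beta>_def)
    show "\<beta> \<le> Re (cnj k * (of_real (q x) - (- (k\<^sup>2))))" if x: "0 \<le> x" for x
    proof -
      have "4 * B \<le> 4 * (real N)\<^sup>2 * B" using B N by (simp add: mult_left_mono mult_right_mono)
      then have "(cmod k)\<^sup>2 / 2 \<le> q x + (cmod k)\<^sup>2" using q_bound[OF x] k(3) by linarith
      then have "\<Lambda> * ((cmod k)\<^sup>2 / 2) \<le> \<Lambda> * (q x + (cmod k)\<^sup>2)" using \<Lambda> by (intro mult_left_mono) auto
      also have "\<dots> = Re (cnj k * (of_real (q x) - (- (k\<^sup>2))))"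
        unfolding cmod_power2 \<Lambda>_def by (simp add: power2_eq_square algebra_simps)
      finally show ?thesis by (simp add: \<beta>_def)
    qed
    show "cmod (?a' x + (\<sigma> x)\<^sup>2 - (of_real (q x) - (- (k\<^sup>2)))) \<le> r" if "0 \<le> x" for x
      using res(1)[OF that] by simp
  qed
  also have "\<dots> = r / \<Lambda> * (2 + cmod (g 0) / cmod k)"
    using \<Lambda> k0 by (simp add: \<beta>_def field_simps power2_eq_square)
  finally have X: "cmod (g 0 - \<sigma> 0) \<le> r / \<Lambda> * (2 + cmod (g 0) / cmod k)" .
  have "cmod (g 0) \<le> 2 * cmod k + cmod (g 0 - \<sigma> 0)"
    using norm_triangle_ineq[of "\<sigma> 0" "g 0 - \<sigma> 0"] \<sigma>norm[of 0] by simp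
  then have "cmod (g 0) / cmod k \<le> (2 * cmod k + cmod (g 0 - \<sigma> 0)) / cmod k" by (intro divide_right_mono) auto
  also have "\<dots> = 2 + cmod (g 0 - \<sigma> 0) / cmod k" using k0 by (simp add: field_simps)
  finally have "r / \<Lambda> * (2 + cmod (g 0) / cmod k) \<le> r / \<Lambda> * (4 + cmod (g 0 - \<sigma> 0) / cmod k)"
    using r0 \<Lambda> by (intro mult_left_mono) auto
  with X have X: "cmod (g 0 - \<sigma> 0) \<le> r / \<Lambda> * 4 + r / \<Lambda> / cmod k * cmod (g 0 - \<sigma> 0)"
    by (simp add: algebra_simps)
  have "4 * r \<le> \<Lambda> * cmod k" using small by (simp add: r_def h_eq \<Lambda>_def)
  then have "r / \<Lambda> / cmod k \<le> 1 / 4" using \<Lambda> k0 by (simp add: field_simps)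
  then have "r / \<Lambda> / cmod k * cmod (g 0 - \<sigma> 0) \<le> 1 / 4 * cmod (g 0 - \<sigma> 0)" by (rule mult_right_mono) simp
  moreover have "0 \<le> r / \<Lambda>" using r0 \<Lambda> by simp
  ultimately have "cmod (g 0 - \<sigma> 0) \<le> 8 * (r / \<Lambda>)" using X by linarith
  then show ?thesis by (simp add: \<sigma>_def r_def h_eq u_def \<Lambda>_def)
qed

end

lemma weyl_m_eq_decaying_quotient:
  assumes q: "continuous_on {0..} q" "\<And>x. 0 \<le> x \<Longrightarrow> \<bar>q x\<bar> \<le> Q"
    and k: "Re k > 0" "(cmod k)\<^sup>2 > Q + 1"
  shows "\<exists>f g. solves (\<lambda>x. of_real (q x) - (- (k\<^sup>2))) f g \<and> f 0 = 1 \<and>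
    (f \<longlongrightarrow> 0) at_top \<and> (g \<longlongrightarrow> 0) at_top \<and> g 0 = weyl_m q 0 (- (k\<^sup>2))"
proof -
  have "Im (- (k\<^sup>2)) \<noteq> 0 \<or> Re (- (k\<^sup>2)) < - (Q + 1)"
    using k unfolding cmod_power2 by (auto simp: power2_eq_square)
  then have "weyl_m q 0 (- (k\<^sup>2)) = weyl_m_nonreal q 0 (- (k\<^sup>2))"
    using weyl_m_eq_weyl_m_nonreal[of q Q "- (k\<^sup>2)"] q by blast
  moreover have "dissipative (\<lambda>x. of_real (q x) - (- (k\<^sup>2))) (cnj k) (Re k) (Q + (cmod k)\<^sup>2)"
    using dissipative_right_half_plane[of q Q k] q k by simp
  ultimately show ?thesis
    using weyl_m_nonreal_characterization by metis
qed

text \<open>The finitely many bounds and Lipschitz constants are merged into one constant.\<close>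

lemma riccati_hierarchy_exists:
  assumes N: "1 \<le> N" and q: "q \<in> sobolev_Linf N" "continuous_on {0..} q"
  shows "\<exists>B. riccati_hierarchy N q (\<lambda>j. dp_at (riccati_coeff j) q) B"
proof -
  note reg = sobolev_Linf_regularity[OF q]
  have bl: "bounded_lipschitz (dp_at (riccati_coeff j) q)" if "j \<le> N" for j
    by (rule bounded_lipschitz_dp_at[OF _ riccati_coeff_vars_below]) (use reg(1) that in auto)
  have "\<exists>K. \<forall>j\<in>{..N}. 0 \<le> K j \<and> (\<forall>x\<ge>0. \<bar>dp_at (riccati_coeff j) q x\<bar> \<le> K j) \<and>
      (\<forall>x\<ge>0. \<forall>y\<ge>0. \<bar>dp_at (riccati_coeff j) q x - dp_at (riccati_coeff j) q y\<bar> \<le> K j * \<bar>x - y\<bar>)"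
    by (rule bchoice) (use bounded_lipschitzD[OF bl] in auto)
  then obtain K where K: "\<And>j. j \<le> N \<Longrightarrow> 0 \<le> K j"
      "\<And>j x. j \<le> N \<Longrightarrow> 0 \<le> x \<Longrightarrow> \<bar>dp_at (riccati_coeff j) q x\<bar> \<le> K j"
      "\<And>j x y. j \<le> N \<Longrightarrow> 0 \<le> x \<Longrightarrow> 0 \<le> y \<Longrightarrow>
        \<bar>dp_at (riccati_coeff j) q x - dp_at (riccati_coeff j) q y\<bar> \<le> K j * \<bar>x - y\<bar>"
    by (metis atMost_iff)
  define B where "B = Max (K ` {..N})"
  have KB: "K j \<le> B" if "j \<le> N" for j unfolding B_def using that by (intro Max_ge) auto
  have "riccati_hierarchy N q (\<lambda>j. dp_at (riccati_coeff j) q) B"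
  proof
    show "0 \<le> B" using K(1)[of 0] KB[of 0] by simp
    show "\<bar>dp_at (riccati_coeff j) q x\<bar> \<le> B" if "1 \<le> j" "j \<le> N" "0 \<le> x" for j x
      using K(2)[of j x] KB[of j] that by linarith
    show "\<bar>dp_at (riccati_coeff N) q x - dp_at (riccati_coeff N) q y\<bar> \<le> B * \<bar>x - y\<bar>" if "0 \<le> x" "0 \<le> y" for x y
      using K(3)[OF order.refl that] mult_right_mono[OF KB[OF order.refl], of "\<bar>x - y\<bar>"] by simp
    show "(dp_at (riccati_coeff j) q has_vector_derivative 2 * dp_at (riccati_coeff (j + 1)) q x -
        (\<Sum>l = 1..j - 1. dp_at (riccati_coeff l) q x * dp_at (riccati_coeff (j - l)) q x)) (at x within {0..})"
      if j: "1 \<le> j" "j < N" "0 \<le> x" for j x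
    proof -
      have "(dp_at (riccati_coeff j) q has_vector_derivative dp_at (dp_deriv (riccati_coeff j)) q x) (at x within {0..})"
        by (rule dp_at_has_vector_derivative[OF _ riccati_coeff_vars_below]) (use reg(2) j in auto)
      then show ?thesis using riccati_coeff_at_recursion[OF j(1), of q x] by simp
    qed
    show "2 * dp_at (riccati_coeff 1) q x = - q x" for x by (rule riccati_coeff_at_1)
  qed (use N in simp)
  then show ?thesis by blast
qed

theorem theorem1:
  fixes N n :: nat and q \<gamma> :: "real \<Rightarrow> real"
  assumes "N \<ge> 1" and "n \<le> N - 1"
    and "q \<in> sobolev_Linf N" and "continuous_on {0..} q"
    and "\<And>t. \<gamma> t > 0" and "\<And>t. \<gamma> (- t) = \<gamma> t"
    and "\<exists>c>0. \<exists>C>0. \<forall>t. c * (1 + \<bar>t\<bar>) powi (- int n) \<le> \<gamma> t \<and>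
           \<gamma> t \<le> C * (1 + \<bar>t\<bar>) powi (- int n)"
  shows "\<exists>c :: nat \<Rightarrow> diff_poly.
    c 1 = dp_const (- 1 / 2) * dp_var 0 \<and>
    (\<forall>j\<ge>1. c (j + 1) = dp_const (1 / 2) * (dp_deriv (c j) + (\<Sum>l = 1..j - 1. c l * c (j - l)))) \<and>
    (\<exists>C>0. \<exists>R>0. \<forall>k\<in>Omega_plus \<gamma>. cmod k \<ge> R \<longrightarrow>
       cmod (weyl_m q 0 (- (k ^ 2)) -
             (- k + (\<Sum>j = 1..N - n - 1. complex_of_real (dp_at (c j) q 0) * k powi (- int j))))
         \<le> C * cmod k powi (int n - int N))"
proof (intro exI[of _ riccati_coeff] conjI)
  show "riccati_coeff 1 = dp_const (- 1 / 2) * dp_var 0" by simp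
  show "\<forall>j\<ge>1. riccati_coeff (j + 1) = dp_const (1 / 2) *
      (dp_deriv (riccati_coeff j) + (\<Sum>l = 1..j - 1. riccati_coeff l * riccati_coeff (j - l)))"
  proof (intro allI impI)
    fix j :: nat assume "1 \<le> j"
    then obtain i where "j = Suc i" by (cases j) auto
    then show "riccati_coeff (j + 1) = dp_const (1 / 2) *
      (dp_deriv (riccati_coeff j) + (\<Sum>l = 1..j - 1. riccati_coeff l * riccati_coeff (j - l)))" by simp
  qed
  let ?c = "\<lambda>j. dp_at (riccati_coeff j) q"
  obtain B where "riccati_hierarchy N q ?c B"
    using riccati_hierarchy_exists[OF assms(1,3,4)] by blast
  then interpret riccati_hierarchy N q ?c B .
  obtain a where a: "0 < a" "\<And>t. a * (1 + \<bar>t\<bar>) powi (- int n) \<le> \<gamma> t" using assms(7) by blast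
  define b where "b = a / 2 ^ n"
  have b: "0 < b" using a by (simp add: b_def)
  define K where "K = residual_bound"
  have K: "0 \<le> K" by (simp add: K_def residual_bound_nonneg)
  \<comment> \<open>The summands make \<open>|k| > 1\<close> and \<open>|k|\<^sup>2\<close> larger than the bound \<open>2 B\<close> of \<open>|q|\<close> by more than \<open>1\<close>, make the tail of the
    approximate solution small, and make the residual small compared with \<open>Re k * |k|\<close>.\<close>
  define R where "R = 2 + 2 * B + 4 * (real N)\<^sup>2 * B + 4 * K / b"
  define C where "C = 8 * K / b + real N * B + 1"
  have nN: "n < N" using assms(1,2) by simp
  have "cmod (weyl_m q 0 (- (k ^ 2)) - (- k + (\<Sum>j = 1..N - n - 1. complex_of_real (?c j 0) * k powi (- int j))))
      \<le> C * cmod k powi (int n - int N)" if k: "k \<in> Omega_plus \<gamma>" "R \<le> cmod k" for k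
  proof -
    define h where "h = inverse (cmod k)"
    have terms: "0 \<le> B" "0 \<le> 4 * (real N)\<^sup>2 * B" "0 \<le> 4 * K / b" using B K b by auto
    have R: "1 < cmod k" "2 * B + 1 < cmod k" "4 * (real N)\<^sup>2 * B \<le> cmod k" "4 * K / b \<le> cmod k"
      using k(2) terms unfolding R_def by linarith+
    have sq: "cmod k \<le> (cmod k)\<^sup>2" using mult_left_mono[of 1 "cmod k" "cmod k"] R(1) by (simp add: power2_eq_square)
    have "cmod k \<noteq> 0" using R(1) by linarith
    then have h: "0 < h" "h < 1" "cmod k * h = 1"
      using R(1) by (simp_all add: h_def inverse_less_1_iff)
    have lam: "b * h ^ n \<le> Re k"
    proof -
      have "1 + \<bar>Im k\<bar> \<le> 2 * cmod k" using abs_Im_le_cmod[of k] R(1) by linarith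
      then have "(1 + \<bar>Im k\<bar>) ^ n \<le> (2 * cmod k) ^ n" by (intro power_mono) auto
      then have "a / (2 * cmod k) ^ n \<le> a / (1 + \<bar>Im k\<bar>) ^ n"
        using a(1) zero_less_power[of "2 * cmod k" n] zero_less_power[of "1 + \<bar>Im k\<bar>" n] R(1)
        by (intro divide_left_mono mult_pos_pos) linarith+
      also have "\<dots> = a * (1 + \<bar>Im k\<bar>) powi (- int n)" by (simp add: power_int_minus divide_inverse)
      also have "\<dots> \<le> \<gamma> (Im k)" by (rule a(2))
      also have "\<dots> \<le> Re k" using k(1) by (simp add: Omega_plus_def)
      finally show ?thesis by (simp add: b_def h_def power_mult_distrib divide_inverse power_inverse mult_ac)
    qed
    have lam_pos: "0 < Re k" using lam b h(1) by (meson less_le_trans mult_pos_pos zero_less_power)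
    obtain f g where fg: "solves (\<lambda>x. of_real (q x) - (- (k\<^sup>2))) f g" "f 0 = 1"
        "(f \<longlongrightarrow> 0) at_top" "(g \<longlongrightarrow> 0) at_top" "g 0 = weyl_m q 0 (- (k\<^sup>2))"
      using weyl_m_eq_decaying_quotient[OF assms(4) q_bound lam_pos] R(2) sq by force
    have hN: "h ^ N = h ^ n * h ^ (N - n)" using nN by (simp add: power_add[symmetric])
    have small: "4 * K * h ^ N \<le> Re k * cmod k"
    proof -
      have "h ^ (N - n) \<le> 1" using h by (simp add: power_le_one)
      then have "h ^ N \<le> h ^ n * 1" unfolding hN using h by (intro mult_left_mono) auto
      then have "4 * K * h ^ N \<le> 4 * K * h ^ n" using K by (intro mult_left_mono) auto
      also have "\<dots> \<le> (cmod k * b) * h ^ n"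
        using R(4) b h by (intro mult_right_mono) (auto simp: field_simps)
      also have "\<dots> = (b * h ^ n) * cmod k" by simp
      also have "\<dots> \<le> Re k * cmod k" using lam by (intro mult_right_mono) auto
      finally show ?thesis .
    qed
    let ?T = "riccati_tail h (inverse k) 0"
    have "cmod (weyl_m q 0 (- (k\<^sup>2)) - (- k + ?T)) \<le> 8 * K * h ^ N / Re k"
      using weyl_quotient_riccati_approximation[OF fg(1-4) lam_pos] R(1,3) sq small
      by (simp add: fg(5) K_def h_def)
    also have "\<dots> \<le> 8 * K * h ^ N / (b * h ^ n)"
      using lam lam_pos K h b by (intro divide_left_mono) auto
    also have "\<dots> = 8 * K / b * h ^ (N - n)" using h by (simp add: hN)
    finally have main: "cmod (weyl_m q 0 (- (k\<^sup>2)) - (- k + ?T)) \<le> 8 * K / b * h ^ (N - n)" .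
    let ?s = "\<lambda>j. of_real (smooth_coeff h j 0) * inverse k ^ j :: complex"
    have "{1..N} = {1..N - n - 1} \<union> {N - n..N}" using nN by auto
    then have "?T = sum ?s {1..N - n - 1} + sum ?s {N - n..N}"
      unfolding riccati_tail_def by (simp only:) (rule sum.union_disjoint, use nN in auto)
    moreover have "sum ?s {1..N - n - 1} = (\<Sum>j = 1..N - n - 1. complex_of_real (?c j 0) * k powi (- int j))"
      by (rule sum.cong) (use nN in \<open>auto simp: smooth_coeff_def power_int_minus power_inverse\<close>)
    moreover have "cmod (sum ?s {N - n..N}) \<le> real N * B * h ^ (N - n)"
    proof -
      have "cmod (sum ?s {N - n..N}) \<le> (\<Sum>j\<in>{N - n..N}. B * h ^ (N - n))"
      proof (rule sum_norm_le)
        fix j assume j: "j \<in> {N - n..N}"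
        have "\<bar>smooth_coeff h j 0\<bar> * h ^ j \<le> B * h ^ (N - n)"
          using smooth_coeff_bound[OF h(1), of j 0] j nN h B
          by (intro mult_mono power_decreasing) auto
        then show "cmod (?s j) \<le> B * h ^ (N - n)" by (simp add: norm_mult norm_power norm_inverse h_def)
      qed
      also have "\<dots> = real (Suc n) * (B * h ^ (N - n))" using nN by simp
      also have "\<dots> \<le> real N * (B * h ^ (N - n))"
        using nN B h by (intro mult_right_mono) auto
      finally show ?thesis by simp
    qed
    moreover have "w - (- k + s) = (w - (- k + t)) + e" if "t = s + e" for w s t e :: complex
      using that by simp
    ultimately have "cmod (weyl_m q 0 (- (k\<^sup>2)) - (- k + (\<Sum>j = 1..N - n - 1. complex_of_real (?c j 0) * k powi (- int j))))
        \<le> 8 * K / b * h ^ (N - n) + real N * B * h ^ (N - n)"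
      by (smt (verit) main norm_triangle_ineq)
    also have "\<dots> \<le> C * h ^ (N - n)" using h by (simp add: C_def distrib_right)
    also have "h ^ (N - n) = cmod k powi (int n - int N)"
    proof -
      have "int n - int N = - int (N - n)" using nN by simp
      then show ?thesis by (simp only: power_int_minus power_int_of_nat h_def power_inverse)
    qed
    finally show ?thesis .
  qed
  moreover have "0 < C" "0 < R"
  proof -
    have "0 \<le> 8 * K / b" "0 \<le> real N * B" "0 \<le> 4 * (real N)\<^sup>2 * B" "0 \<le> 4 * K / b"
      using K b B by auto
    then show "0 < C" "0 < R" using B unfolding C_def R_def by linarith+
  qed
  ultimately show "\<exists>C>0. \<exists>R>0. \<forall>k\<in>Omega_plus \<gamma>. cmod k \<ge> R \<longrightarrow>
       cmod (weyl_m q 0 (- (k ^ 2)) - (- k + (\<Sum>j = 1..N - n - 1. complex_of_real (?c j 0) * k powi (- int j))))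
         \<le> C * cmod k powi (int n - int N)"
    by blast
qed

end
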